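(* Let $(X,*,R_1,R_2)$ be an oriented singquandle. The set of colorings of an oriented singular link by $X$ is an invariant of oriented singular links: if $D$ and $D'$ are two diagrams of equivalent oriented singular links, then the set of colorings of $D$ by $X$ is in bijection with the set of colorings of $D'$ by $X$.
   Context: A quandle is a set $X$ with a binary operation $*$ such that (1) $a*a=a$ for all $a\in X$; (2) for all $a,b\in X$ there is a unique $x\in X$ with $a=x*b$; (3) $(a*b)*c=(a*c)*(b*c)$ for all $a,b,c\in X$. The inverse operation $\bar{*}$ is defined by $(x*y)\,\bar{*}\,y=x=(x\,\bar{*}\,y)*y$. An oriented singquandle is a quadruple $(X,*,R_1,R_2)$ where $(X,* )$ is a quandle and $R_1,R_2:X\times X\to X$ are maps satisfying, for all $x,y,z\in X$: $$R_1(x\bar{*}y,z)*y=R_1(x,z*y),$$ $$R_2(x\bar{*}y,z)=R_2(x,z*y)\bar{*}y,$$ $$(y\bar{*}R_1(x,z))*x=(y*R_2(x,z))\bar{*}z,$$ $$R_2(x,y)=R_1(y,x*y),$$ $$R_1(x,y)*R_2(x,y)=R_2(y,x*y).$$ A singular link in $S^3$ is the image of a smooth immersion of finitely many circles having finitely many double points (singular points); orienting each circle gives an oriented singular link. A diagram is a generic planar projection with classical crossings (over/under information recorded) and singular crossings. Two oriented singular links are equivalent if and only if their diagrams are related by planar isotopy and a finite sequence of oriented singular Reidemeister moves. These moves are: the classical oriented Reidemeister moves of types 1, 2, 3; the moves $\Omega4$, in which a third strand passing entirely over, or entirely under, two adjacent legs of a singular crossing is moved across the singular crossing so as to pass over,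 respectively under, the other two legs; and the moves $\Omega5$, in which a singular crossing followed by a classical crossing of the same two strands (joined by two edges bounding a bigon) is replaced by the same classical crossing followed by the singular crossing; all orientations of the strands are allowed. A semiarc of a diagram is an edge between vertices when the diagram is regarded as a $4$-valent graph (the vertices being the classical and singular crossings). A coloring of a diagram by $X$ is a function $C$ from the set of semiarcs to $X$ satisfying the following rules. At each classical crossing the two semiarcs of the over-strand have the same color $y$; if the incoming semiarc of the under-strand has color $x$, then the outgoing semiarc of the under-strand has color $x*y$ if the crossing is positive and $x\,\bar{*}\,y$ if the crossing is negative. At each singular crossing, drawn with both branches oriented downward, if the top-left and top-right (incoming) semiarcs have colors $x$ and $y$ respectively, then the bottom-left and bottom-right (outgoing) semiarcs have colors $R_1(x,y)$ and $R_2(x,y)$ respectively. *)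

theory Defs
  imports "HOL-Analysis.Analysis"
begin

section \<open>Oriented singquandles\<close>

locale quandle =
  fixes X :: "'a set" and star :: "'a \<Rightarrow> 'a \<Rightarrow> 'a" (infixl "\<triangleright>" 70)
  assumes star_closed: "\<lbrakk>a \<in> X; b \<in> X\<rbrakk> \<Longrightarrow> a \<triangleright> b \<in> X"
    and idem: "a \<in> X \<Longrightarrow> a \<triangleright> a = a"
    and right_divisible: "\<lbrakk>a \<in> X; b \<in> X\<rbrakk> \<Longrightarrow> \<exists>!x. x \<in> X \<and> a = x \<triangleright> b"
    and self_distrib: "\<lbrakk>a \<in> X; b \<in> X; c \<in> X\<rbrakk> \<Longrightarrow> (a \<triangleright> b) \<triangleright> c = (a \<triangleright> c) \<triangleright> (b \<triangleright> c)"
begin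

definition bar :: "'a \<Rightarrow> 'a \<Rightarrow> 'a" (infixl "\<triangleleft>" 70) where
  "a \<triangleleft> b = (THE x. x \<in> X \<and> a = x \<triangleright> b)"

end

locale oriented_singquandle = quandle X star
  for X :: "'a set" and star :: "'a \<Rightarrow> 'a \<Rightarrow> 'a" (infixl "\<triangleright>" 70) +
  fixes R1 R2 :: "'a \<Rightarrow> 'a \<Rightarrow> 'a"
  assumes R1_closed: "\<lbrakk>x \<in> X; y \<in> X\<rbrakk> \<Longrightarrow> R1 x y \<in> X"
    and R2_closed: "\<lbrakk>x \<in> X; y \<in> X\<rbrakk> \<Longrightarrow> R2 x y \<in> X"
    and sing1: "\<lbrakk>x \<in> X; y \<in> X; z \<in> X\<rbrakk> \<Longrightarrow> R1 (x \<triangleleft> y) z \<triangleright> y = R1 x (z \<triangleright> y)"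
    and sing2: "\<lbrakk>x \<in> X; y \<in> X; z \<in> X\<rbrakk> \<Longrightarrow> R2 (x \<triangleleft> y) z = R2 x (z \<triangleright> y) \<triangleleft> y"
    and sing3: "\<lbrakk>x \<in> X; y \<in> X; z \<in> X\<rbrakk> \<Longrightarrow> (y \<triangleleft> R1 x z) \<triangleright> x = (y \<triangleright> R2 x z) \<triangleleft> z"
    and sing4: "\<lbrakk>x \<in> X; y \<in> X\<rbrakk> \<Longrightarrow> R2 x y = R1 y (x \<triangleright> y)"
    and sing5: "\<lbrakk>x \<in> X; y \<in> X\<rbrakk> \<Longrightarrow> R1 x y \<triangleright> R2 x y = R2 y (x \<triangleright> y)"


section \<open>Smooth maps\<close>

text \<open>
  \<open>C\<^sup>\<infinity>\<close> maps: the map is differentiable and so are, coinductively, all its iterated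
  partial derivatives.
\<close>

coinductive smooth :: "('a::euclidean_space \<Rightarrow> 'b::real_normed_vector) \<Rightarrow> bool" where
  "\<lbrakk>\<forall>x. f differentiable (at x);
    \<forall>b\<in>Basis. smooth (\<lambda>x. frechet_derivative f (at x) b)\<rbrakk> \<Longrightarrow> smooth f"

definition diffeo :: "('a::euclidean_space \<Rightarrow> 'a) \<Rightarrow> bool" where
  "diffeo h \<longleftrightarrow> bij h \<and> smooth h \<and> smooth (inv h)"


section \<open>Diagrams of oriented singular links\<close>

text \<open>
  The plane is the complex plane. A diagram has components \<open>0, \<dots>, ncomp D - 1\<close>, each an oriented
  closed curve given by a map of period 1. A pair \<open>(i, t)\<close> stands for the passage of component \<open>i\<close>
  at time \<open>t\<close>; times matter only modulo 1. The field \<open>kind\<close> records how a passage goes through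
  a double point; its values at other passages carry no information.
\<close>

datatype passage_kind = Over | Under | Singular

fun opposite :: "passage_kind \<Rightarrow> passage_kind" where
  "opposite Over = Under"
| "opposite Under = Over"
| "opposite Singular = Singular"

record sdiagram =
  ncomp :: nat
  strand :: "nat \<Rightarrow> real \<Rightarrow> complex"
  kind :: "nat \<times> real \<Rightarrow> passage_kind"

definition passages :: "sdiagram \<Rightarrow> (nat \<times> real) set" where
  "passages D = {..<ncomp D} \<times> UNIV"

definition pos :: "sdiagram \<Rightarrow> nat \<times> real \<Rightarrow> complex" where
  "pos D P = strand D (fst P) (snd P)"

definition dir :: "sdiagram \<Rightarrow> nat \<times> real \<Rightarrow> complex" where
  "dir D P = vector_derivative (strand D (fst P)) (at (snd P))"

definition same_passage :: "nat \<times> real \<Rightarrow> nat \<times> real \<Rightarrow> bool" where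
  "same_passage P Q \<longleftrightarrow> fst P = fst Q \<and> snd P - snd Q \<in> \<int>"

definition meets :: "sdiagram \<Rightarrow> nat \<times> real \<Rightarrow> nat \<times> real \<Rightarrow> bool" where
  "meets D P Q \<longleftrightarrow>
     P \<in> passages D \<and> Q \<in> passages D \<and> pos D P = pos D Q \<and> \<not> same_passage P Q"

definition vertices :: "sdiagram \<Rightarrow> complex set" where
  "vertices D = {pos D P | P Q. meets D P Q}"

text \<open>
  The determinant of the pair of plane vectors \<open>(v, w)\<close>: it is positive iff \<open>w\<close> points to the
  left of \<open>v\<close>.
\<close>

definition cdet :: "complex \<Rightarrow> complex \<Rightarrow> real" where
  "cdet v w = Re v * Im w - Im v * Re w"

definition diagram :: "sdiagram \<Rightarrow> bool" where
  "diagram D \<longleftrightarrow>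
     (\<forall>i<ncomp D. smooth (strand D i) \<and> (\<forall>t. strand D i (t + 1) = strand D i t)) \<and>
     (\<forall>P\<in>passages D. dir D P \<noteq> 0) \<and>
     (\<forall>P\<in>passages D. \<forall>Q\<in>passages D. same_passage P Q \<longrightarrow> kind D P = kind D Q) \<and>
     finite (vertices D) \<and>
     (\<forall>P Q. meets D P Q \<longrightarrow> cdet (dir D P) (dir D Q) \<noteq> 0 \<and> kind D Q = opposite (kind D P)) \<and>
     (\<forall>P Q R. meets D P Q \<and> meets D P R \<longrightarrow> same_passage Q R)"


section \<open>Planar isotopy\<close>

text \<open>
  A diagram is considered as an oriented curve, so the closed curves may also be renumbered and
  reparametrized preserving their orientation. A smooth isotopy over the interval from 0 to 1 can
  be made stationary near its ends, so it is no restriction to let it be defined for all times.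
\<close>

definition planar_isotopic :: "sdiagram \<Rightarrow> sdiagram \<Rightarrow> bool" where
  "planar_isotopic D D' \<longleftrightarrow> diagram D \<and> diagram D' \<and> ncomp D' = ncomp D \<and>
     (\<exists>(H :: real \<Rightarrow> complex \<Rightarrow> complex) (\<pi> :: nat \<Rightarrow> nat) (\<phi> :: nat \<Rightarrow> real \<Rightarrow> real).
        smooth (\<lambda>(s, z). H s z) \<and> (\<forall>s\<in>{0..1}. diffeo (H s)) \<and> H 0 = id \<and>
        bij_betw \<pi> {..<ncomp D} {..<ncomp D} \<and>
        (\<forall>i<ncomp D. smooth (\<phi> i) \<and> (\<forall>t. deriv (\<phi> i) t > 0 \<and> \<phi> i (t + 1) = \<phi> i t + 1) \<and>
           (\<forall>t. strand D' i t = H 1 (strand D (\<pi> i) (\<phi> i t)))) \<and>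
        (\<forall>i t Q. meets D' (i, t) Q \<longrightarrow> kind D' (i, t) = kind D (\<pi> i, \<phi> i t)))"


section \<open>Oriented singular Reidemeister moves\<close>

text \<open>
  Since planar isotopies are available, a move only has to be described for diagrams that are in
  a standard position inside the following square.
\<close>

definition square :: "complex set" where
  "square = {z. \<bar>Re z\<bar> \<le> 1 \<and> \<bar>Im z\<bar> \<le> 1}"

text \<open>
  A piece \<open>(c, a, l)\<close> of a diagram is the arc of component \<open>c\<close> with parameters between \<open>a - l\<close> and
  \<open>a + l\<close>, reparametrized by \<open>u \<in> [-1, 1]\<close>. As \<open>l\<close> may have either sign, the orientation
  of the component may agree with the direction of increasing \<open>u\<close> or be opposite to it.
\<close>

type_synonym piece = "nat \<times> real \<times> real"

fun along :: "piece \<Rightarrow> real \<Rightarrow> nat \<times> real" where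
  "along (c, a, l) u = (c, a + l * u)"

text \<open>
  The part of \<open>D\<close> in the square consists exactly of the pieces \<open>ps\<close>, which are disjoint as
  arcs of parameters and follow the curves \<open>cs\<close>.
\<close>

definition in_square :: "sdiagram \<Rightarrow> piece list \<Rightarrow> (real \<Rightarrow> complex) list \<Rightarrow> bool" where
  "in_square D ps cs \<longleftrightarrow> length ps = length cs \<and>
     (\<forall>m<length ps. \<forall>u\<in>{-1..1}.
        along (ps ! m) u \<in> passages D \<and> pos D (along (ps ! m) u) = (cs ! m) u) \<and>
     (\<forall>m<length ps. \<forall>n<length ps. \<forall>u\<in>{-1..1}. \<forall>v\<in>{-1..1}.
        same_passage (along (ps ! m) u) (along (ps ! n) v) \<longrightarrow> m = n \<and> u = v) \<and>
     (\<forall>P\<in>passages D. pos D P \<in> square \<longrightarrow>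
        (\<exists>m<length ps. \<exists>u\<in>{-1..1}. same_passage P (along (ps ! m) u)))"

definition local_change ::
  "piece list \<Rightarrow> (real \<Rightarrow> complex) list \<Rightarrow> (real \<Rightarrow> complex) list \<Rightarrow> sdiagram \<Rightarrow> sdiagram \<Rightarrow> bool" where
  "local_change ps cs cs' D D' \<longleftrightarrow> diagram D \<and> diagram D' \<and> ncomp D' = ncomp D \<and>
     in_square D ps cs \<and> in_square D' ps cs' \<and>
     (\<forall>P\<in>passages D. pos D P \<notin> square \<longrightarrow> pos D' P = pos D P \<and> kind D' P = kind D P)"

text \<open>
  A smooth bump that vanishes with all its derivatives at \<open>-1\<close> and \<open>1\<close>, has maximum 1 at 0, and is
  strictly monotone on each of \<open>[-1, 0]\<close> and \<open>[0, 1]\<close>. It deforms a strand inside the square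
  without destroying smoothness at the boundary.
\<close>

definition bump :: "real \<Rightarrow> real" where
  "bump u = (if \<bar>u\<bar> < 1 then exp (1 - 1 / (1 - u\<^sup>2)) else 0)"

text \<open>
  The second curve is a curl: its only double point is at the two parameters \<open>u\<close> with
  \<open>bump u = 1/2\<close>.
\<close>

definition move1 :: "sdiagram \<Rightarrow> sdiagram \<Rightarrow> bool" where
  "move1 D D' \<longleftrightarrow> (\<exists>p.
     local_change [p] [\<lambda>u. Complex u 0] [\<lambda>u. Complex (u * (1 - 2 * bump u)) (bump u / 2)] D D' \<and>
     (\<forall>u\<in>{-1..1}. \<forall>v\<in>{-1..1}. meets D' (along p u) (along p v) \<longrightarrow> kind D' (along p u) \<noteq> Singular))"

text \<open>
  The two curves of \<open>D'\<close> cross twice, where \<open>bump u = 1/2\<close>.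
\<close>

definition move2 :: "sdiagram \<Rightarrow> sdiagram \<Rightarrow> bool" where
  "move2 D D' \<longleftrightarrow> (\<exists>p q. \<exists>k\<in>{Over, Under}.
     local_change [p, q]
       [\<lambda>u. Complex u (1/2), \<lambda>u. Complex u (-1/2)]
       [\<lambda>u. Complex u (1/2 - bump u), \<lambda>u. Complex u (bump u - 1/2)] D D' \<and>
     (\<forall>u\<in>{-1..1}. \<forall>v\<in>{-1..1}. meets D' (along p u) (along q v) \<longrightarrow> kind D' (along p u) = k))"

text \<open>
  Two strands form the diagonals of the square, and the third one is moved from above to below their
  common point.
\<close>

definition triangle_change :: "piece \<Rightarrow> piece \<Rightarrow> piece \<Rightarrow> sdiagram \<Rightarrow> sdiagram \<Rightarrow> bool" where
  "triangle_change p q r = local_change [p, q, r]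
     [\<lambda>u. Complex u u, \<lambda>u. Complex u (- u), \<lambda>u. Complex u (bump u / 2)]
     [\<lambda>u. Complex u u, \<lambda>u. Complex u (- u), \<lambda>u. Complex u (- bump u / 2)]"

text \<open>
  All three crossings are classical, and the strands lie at distinct heights, the same before and
  after the move.
\<close>

definition move3 :: "sdiagram \<Rightarrow> sdiagram \<Rightarrow> bool" where
  "move3 D D' \<longleftrightarrow> (\<exists>p q r. \<exists>height :: nat \<Rightarrow> nat. inj_on height {..<3} \<and>
     triangle_change p q r D D' \<and>
     (\<forall>E\<in>{D, D'}. \<forall>m<3. \<forall>n<3. \<forall>u\<in>{-1..1}. \<forall>v\<in>{-1..1}.
        meets E (along ([p, q, r] ! m) u) (along ([p, q, r] ! n) v) \<and> height m > height n \<longrightarrow>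
        kind E (along ([p, q, r] ! m) u) = Over))"

definition move4 :: "sdiagram \<Rightarrow> sdiagram \<Rightarrow> bool" where
  "move4 D D' \<longleftrightarrow> (\<exists>p q r. \<exists>k\<in>{Over, Under}.
     triangle_change p q r D D' \<and>
     (\<forall>E\<in>{D, D'}. kind E (along p 0) = Singular \<and>
        (\<forall>s\<in>{p, q}. \<forall>u\<in>{-1..1}. \<forall>v\<in>{-1..1}.
           meets E (along r u) (along s v) \<longrightarrow> kind E (along r u) = k)))"

text \<open>
  The curves do not change. The first strand descends at the left crossing (\<open>u < 0\<close>) and ascends at
  the right one (\<open>u > 0\<close>), the second strand does the converse. So the classical crossing is the
  same before and after the move if the ascending strand plays the same role, i.e. if the first
  strand in \<open>D\<close> and the second strand in \<open>D'\<close> have equal kinds there.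
\<close>

definition move5 :: "sdiagram \<Rightarrow> sdiagram \<Rightarrow> bool" where
  "move5 D D' \<longleftrightarrow> (\<exists>p q. \<exists>k\<in>{Over, Under}.
     local_change [p, q]
       [\<lambda>u. Complex u (1/2 - bump u), \<lambda>u. Complex u (bump u - 1/2)]
       [\<lambda>u. Complex u (1/2 - bump u), \<lambda>u. Complex u (bump u - 1/2)] D D' \<and>
     (\<forall>u\<in>{-1..1}. \<forall>v\<in>{-1..1}. meets D (along p u) (along q v) \<longrightarrow>
        kind D (along p u) = (if u < 0 then Singular else k)) \<and>
     (\<forall>u\<in>{-1..1}. \<forall>v\<in>{-1..1}. meets D' (along p u) (along q v) \<longrightarrow>
        kind D' (along q v) = (if v < 0 then k else Singular)))"

text \<open>
  By the Reidemeister theorem for singular links, this is equivalence of the links presented by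
  the diagrams.
\<close>

definition equivalent_links :: "sdiagram \<Rightarrow> sdiagram \<Rightarrow> bool" where
  "equivalent_links = equivclp (\<lambda>D D'.
     planar_isotopic D D' \<or> move1 D D' \<or> move2 D D' \<or> move3 D D' \<or> move4 D D' \<or> move5 D D')"


section \<open>Colorings\<close>

definition semiarcs :: "sdiagram \<Rightarrow> complex set set" where
  "semiarcs D = components (pos D ` passages D - vertices D)"

definition incoming :: "sdiagram \<Rightarrow> nat \<times> real \<Rightarrow> complex set" where
  "incoming D P =
     (THE e. e \<in> semiarcs D \<and> (\<forall>\<^sub>F t in at_left (snd P). strand D (fst P) t \<in> e))"

definition outgoing :: "sdiagram \<Rightarrow> nat \<times> real \<Rightarrow> complex set" where
  "outgoing D P =
     (THE e. e \<in> semiarcs D \<and> (\<forall>\<^sub>F t in at_right (snd P). strand D (fst P) t \<in> e))"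

text \<open>
  A classical crossing is positive if the under-strand crosses the over-strand from right to left.
  At a singular crossing with both branches drawn downward, the branch \<open>P\<close> coming from the
  top left leaves at the bottom right, and the other branch \<open>Q\<close> crosses it from its left to its
  right.
\<close>

definition colorings ::
  "'a set \<Rightarrow> ('a \<Rightarrow> 'a \<Rightarrow> 'a) \<Rightarrow> ('a \<Rightarrow> 'a \<Rightarrow> 'a) \<Rightarrow> ('a \<Rightarrow> 'a \<Rightarrow> 'a) \<Rightarrow> sdiagram \<Rightarrow>
    (complex set \<Rightarrow> 'a) set" where
  "colorings X star R1 R2 D = {C \<in> semiarcs D \<rightarrow>\<^sub>E X. \<forall>P Q. meets D P Q \<longrightarrow>
     (kind D P = Over \<longrightarrow>
        C (outgoing D P) = C (incoming D P) \<and>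
        C (outgoing D Q) =
          (if cdet (dir D P) (dir D Q) > 0
           then star (C (incoming D Q)) (C (incoming D P))
           else quandle.bar X star (C (incoming D Q)) (C (incoming D P)))) \<and>
     (kind D P = Singular \<and> cdet (dir D P) (dir D Q) < 0 \<longrightarrow>
        C (outgoing D Q) = R1 (C (incoming D P)) (C (incoming D Q)) \<and>
        C (outgoing D P) = R2 (C (incoming D P)) (C (incoming D Q)))}"

end

theory Submission
  imports Defs
begin

text \<open>
  A coloring is the same as a function on the passages of a diagram that is locally constant along
  the strands away from the vertices and obeys the crossing rules. In this form a planar isotopy
  acts on colorings by relabelling passages; it preserves the signs of crossings since the
  Jacobian of an isotopy that starts at the identity never vanishes.

  For a Reidemeister move, the diagrams agree outside a square. Inside it, the colors of the ends
  of the pieces determine the remaining colors, and the colors of the ends that occur are the same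
  for both diagrams. Hence restriction to the outside identifies both sets of colorings with the
  same set. That the same boundary colors occur is a statement about the singquandle: idempotence
  for move 1, invertibility for move 2, distributivity for move 3, the first three axioms
  for \<open>R1\<close> and \<open>R2\<close> for move 4, and the last two, together with the others, for move 5.
\<close>

section \<open>Passages and semiarcs\<close>

text \<open>A semiarc is a connected subset of the plane that may enter and leave the square many
  times, so a move can cut, merge and deform semiarcs far away from it, and the colorings of two
  diagrams have different domains. The passages, in contrast, are the same pairs before and after a
  move. This is why colors are attached to passages. The price is a topological fact: such a locally
  constant function cannot take two values on one semiarc.

  Inside the square all orientations have to be treated. Pieces are therefore followed in the
  direction of the standard curves, and orientations survive only as boolean flags in the relations
  between the colors at a crossing.

  A singular crossing cannot in general be solved for the colors on one side, since
  \<open>R1\<close> and \<open>R2\<close> need not be invertible. The middle colors of a piece are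
  therefore always computed from classical crossings, and every move that involves a singular
  crossing offers a classical one next to each unknown segment.\<close>

lemma smooth_differentiable: "smooth f \<Longrightarrow> f differentiable (at x)"
  by (cases rule: smooth.cases) auto

lemma same_passage_refl [simp]: "same_passage P P"
  by (simp add: same_passage_def)

lemma same_passage_sym: "same_passage P Q \<Longrightarrow> same_passage Q P"
  by (auto simp: same_passage_def) (metis Ints_minus minus_diff_eq)

lemma same_passage_trans: "same_passage P Q \<Longrightarrow> same_passage Q R \<Longrightarrow> same_passage P R"
  by (auto simp: same_passage_def) (metis Ints_add diff_add_cancel add_diff_eq)

lemma meets_sym: "meets D P Q \<Longrightarrow> meets D Q P"
  by (auto simp: meets_def dest: same_passage_sym)

lemma meets_passages: "meets D P Q \<Longrightarrow> P \<in> passages D \<and> Q \<in> passages D"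
  by (simp add: meets_def)

lemma passages_iff [simp]: "P \<in> passages D \<longleftrightarrow> fst P < ncomp D"
  by (cases P) (simp add: passages_def)

definition regular :: "sdiagram \<Rightarrow> nat \<times> real \<Rightarrow> bool" where
  "regular D P \<longleftrightarrow> P \<in> passages D \<and> pos D P \<notin> vertices D"

text \<open>\<open>vertices\<close> keeps the points and forgets the passages that produced them. A
  passage over the vertex of P' and Q' either equals P' up to an integer, and then meets Q', or
  differs from it, and then meets P'.\<close>

lemma regular_iff_no_meets: "regular D P \<longleftrightarrow> P \<in> passages D \<and> (\<forall>Q. \<not> meets D P Q)"
proof -
  have "\<exists>Q. meets D P Q" if "P \<in> passages D" "pos D P \<in> vertices D"
  proof -
    from that obtain P' Q' where *: "meets D P' Q'" "pos D P = pos D P'"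
      by (auto simp: vertices_def)
    show ?thesis
    proof (cases "same_passage P P'")
      case True
      with * that have "meets D P Q'"
        by (auto simp: meets_def dest: same_passage_trans same_passage_sym)
      then show ?thesis ..
    next
      case False
      with * that have "meets D P P'"
        by (auto simp: meets_def)
      then show ?thesis ..
    qed
  qed
  then show ?thesis
    unfolding regular_def vertices_def by blast
qed

definition semiarc_of :: "sdiagram \<Rightarrow> nat \<times> real \<Rightarrow> complex set" where
  "semiarc_of D P = connected_component_set (pos D ` passages D - vertices D) (pos D P)"

lemma semiarc_of_in_semiarcs: "regular D P \<Longrightarrow> semiarc_of D P \<in> semiarcs D"
  by (auto simp: semiarc_of_def semiarcs_def regular_def intro!: componentsI)

lemma pos_in_semiarc_of: "regular D P \<Longrightarrow> pos D P \<in> semiarc_of D P"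
  by (auto simp: semiarc_of_def regular_def intro!: connected_component_refl)

lemma semiarc_of_eqI: "e \<in> semiarcs D \<Longrightarrow> pos D P \<in> e \<Longrightarrow> semiarc_of D P = e"
  unfolding semiarc_of_def semiarcs_def
  by (metis connected_component_eq componentsE)

lemma semiarcsE:
  assumes "e \<in> semiarcs D"
  obtains P where "regular D P" "e = semiarc_of D P"
  using assms unfolding semiarcs_def
  by (auto elim!: componentsE simp: semiarc_of_def regular_def simp del: passages_iff)

context
  fixes D assumes diag: "diagram D"
begin

lemma strand_smooth: "i < ncomp D \<Longrightarrow> smooth (strand D i)"
  using diag by (auto simp: diagram_def)

lemma strand_differentiable: "i < ncomp D \<Longrightarrow> strand D i differentiable (at t)"
  by (simp add: smooth_differentiable strand_smooth)

lemma strand_continuous: "i < ncomp D \<Longrightarrow> continuous_on S (strand D i)"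
  by (meson continuous_at_imp_continuous_on differentiable_imp_continuous_within strand_differentiable)

lemma strand_has_dir:
  "i < ncomp D \<Longrightarrow> (strand D i has_vector_derivative dir D (i, t)) (at t)"
  using strand_differentiable vector_derivative_works by (auto simp: dir_def)

lemma strand_add_int:
  assumes "i < ncomp D" "k \<in> \<int>"
  shows "strand D i (t + k) = strand D i t"
proof -
  have per: "strand D i (t + 1) = strand D i t" for t
    using diag assms by (auto simp: diagram_def)
  have nat: "strand D i (t + of_nat n) = strand D i t" for t n
    by (induction n) (simp_all add: per add.assoc[symmetric] add.commute[of 1])
  obtain n where "k = of_int n" using assms by (auto elim: Ints_cases)
  then show ?thesis
    using nat[of t "nat n"] nat[of "t + k" "nat (- n)"] by (cases "n \<ge> 0") auto
qed

lemma same_passage_pos: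
  assumes "same_passage P Q" "P \<in> passages D"
  shows "pos D P = pos D Q"
proof -
  have "strand D (fst P) (snd Q + (snd P - snd Q)) = strand D (fst P) (snd Q)"
    using assms by (intro strand_add_int) (auto simp: same_passage_def)
  then show ?thesis using assms by (simp add: pos_def same_passage_def)
qed

lemma same_passage_regular:
  assumes "same_passage P Q" "regular D P"
  shows "regular D Q"
  using assms same_passage_pos[of P Q] by (auto simp: regular_def same_passage_def)

text \<open>There are finitely many vertices, and within one half-open period at most two parameters
  lie over each of them, because a third one would make a triple point.\<close>

lemma finite_irregular:
  "finite {s \<in> {x..<x + 1}. i < ncomp D \<and> \<not> regular D (i, s)}" (is "finite ?B")
proof (rule finite_subset)
  show "?B \<subseteq> (\<Union>z\<in>vertices D. {s \<in> ?B. strand D i s = z})"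
    by (auto simp: regular_def pos_def)
  have "finite {s \<in> ?B. strand D i s = z}" (is "finite ?F") for z
  proof (cases "?F = {}")
    case False
    then obtain s1 where s1: "s1 \<in> ?F" by blast
    have int: "s = s'" if "s \<in> {x..<x + 1}" "s' \<in> {x..<x + 1}" "same_passage (i, s) (i, s')" for s s'
    proof -
      have "\<bar>s - s'\<bar> < 1" using that by auto
      then show ?thesis using that Ints_nonzero_abs_less1[of "s - s'"] by (auto simp: same_passage_def)
    qed
    have "s = s'" if "s \<in> ?F - {s1}" "s' \<in> ?F - {s1}" for s s'
    proof -
      have "meets D (i, s1) (i, s)" "meets D (i, s1) (i, s')"
        using that s1 int[of s1 s] int[of s1 s'] by (auto simp: meets_def pos_def)
      then have "same_passage (i, s) (i, s')" using diag unfolding diagram_def by blast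
      then show ?thesis using int that by blast
    qed
    then have "\<exists>s2. ?F \<subseteq> {s1, s2}" by blast
    then show ?thesis by (meson finite.emptyI finite.insertI finite_subset)
  next
    case True
    then show ?thesis by (metis finite.emptyI)
  qed
  then show "finite (\<Union>z\<in>vertices D. {s \<in> ?B. strand D i s = z})"
    using diag by (auto simp: diagram_def)
qed

lemma eventually_regular:
  assumes "i < ncomp D"
  shows "\<forall>\<^sub>F s in at t. regular D (i, s)"
proof -
  let ?B = "{s \<in> {t - 1/2..<t - 1/2 + 1}. i < ncomp D \<and> \<not> regular D (i, s)}"
  have "open ({t - 1/2<..<t + 1/2} - (?B - {t}))"
    by (intro open_Diff finite_imp_closed finite_Diff finite_irregular) auto
  then show ?thesis
    unfolding eventually_at_topological using assms
    by (intro exI[of _ "{t - 1/2<..<t + 1/2} - (?B - {t})"]) auto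
qed

lemma semiarc_of_const:
  assumes "\<And>s. s \<in> {x..y} \<Longrightarrow> regular D (i, s)" "x \<le> y"
  shows "semiarc_of D (i, x) = semiarc_of D (i, y)"
proof -
  have "regular D (i, x)" using assms(2) by (intro assms(1)) simp
  then have i: "i < ncomp D" by (simp add: regular_def)
  have "connected (strand D i ` {x..y})"
    by (intro connected_continuous_image strand_continuous i) auto
  moreover have "strand D i ` {x..y} \<subseteq> pos D ` passages D - vertices D"
  proof (rule image_subsetI)
    fix s assume "s \<in> {x..y}"
    then have "regular D (i, s)" by (rule assms(1))
    then show "strand D i s \<in> pos D ` passages D - vertices D"
      unfolding regular_def by (metis DiffI fst_conv image_eqI pos_def snd_conv)
  qed
  ultimately have "connected_component (pos D ` passages D - vertices D) (strand D i x) (strand D i y)"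
    unfolding connected_component_def using assms(2)
    by (intro exI[of _ "strand D i ` {x..y}"]) auto
  then show ?thesis
    using connected_component_eq by (auto simp: semiarc_of_def pos_def)
qed

lemma semiarc_of_const':
  assumes "is_interval J" "\<And>s. s \<in> J \<Longrightarrow> regular D (i, s)" "x \<in> J" "y \<in> J"
  shows "semiarc_of D (i, x) = semiarc_of D (i, y)"
proof -
  have "{x..y} \<subseteq> J" "{y..x} \<subseteq> J"
    using assms(1,3,4) mem_is_interval_1_I by (meson atLeastAtMost_iff subsetI)+
  then have *: "\<And>s. s \<in> {x..y} \<Longrightarrow> regular D (i, s)" "\<And>s. s \<in> {y..x} \<Longrightarrow> regular D (i, s)"
    using assms(2) by blast+
  show ?thesis
  proof (cases "x \<le> y")
    case True
    show ?thesis by (rule semiarc_of_const[OF *(1) True])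
  next
    case False
    then have "y \<le> x" by simp
    from semiarc_of_const[OF *(2) this] show ?thesis by simp
  qed
qed

text \<open>Evaluates the definite descriptions in \<open>incoming\<close> and
  \<open>outgoing\<close>: along a nontrivial filter, two semiarcs that eventually contain the
  strand share a point and hence coincide.\<close>

lemma limit_semiarc_unique:
  assumes F: "F \<noteq> bot" "\<forall>\<^sub>F s in F. regular D (i, s) \<and> semiarc_of D (i, s) = e"
  shows "(THE e. e \<in> semiarcs D \<and> (\<forall>\<^sub>F s in F. strand D i s \<in> e)) = e"
proof (rule the_equality)
  obtain s where "regular D (i, s)" "semiarc_of D (i, s) = e"
    using eventually_happens[OF F(2)] F(1) by auto
  then have e: "e \<in> semiarcs D" using semiarc_of_in_semiarcs by blast
  have "\<forall>\<^sub>F s in F. strand D i s \<in> e"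
    by (rule eventually_mono[OF F(2)]) (metis pos_in_semiarc_of pos_def fst_conv snd_conv)
  with e show "e \<in> semiarcs D \<and> (\<forall>\<^sub>F s in F. strand D i s \<in> e)" by blast
  fix e' assume e': "e' \<in> semiarcs D \<and> (\<forall>\<^sub>F s in F. strand D i s \<in> e')"
  have "\<forall>\<^sub>F s in F. semiarc_of D (i, s) = e \<and> strand D i s \<in> e'"
    using F(2) conjunct2[OF e'] by eventually_elim simp
  from eventually_happens[OF this] F(1)
  obtain s where "semiarc_of D (i, s) = e" "strand D i s \<in> e'" by blast
  then show "e' = e" using semiarc_of_eqI[of e' D "(i, s)"] e' by (simp add: pos_def)
qed

lemma incoming_semiarc:
  assumes "i < ncomp D"
  shows "\<forall>\<^sub>F s in at_left t. regular D (i, s) \<and> semiarc_of D (i, s) = incoming D (i, t)"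
proof -
  have "\<forall>\<^sub>F s in at_left t. regular D (i, s)"
    using eventually_regular[OF assms, of t] by (simp add: eventually_at_split)
  then obtain b where b: "b < t" "\<forall>s>b. s < t \<longrightarrow> regular D (i, s)"
    unfolding eventually_at_left_field by blast
  let ?e = "semiarc_of D (i, (b + t) / 2)"
  have "semiarc_of D (i, s) = ?e" if "b < s" "s < t" for s
    using that b by (intro semiarc_of_const'[of "{b<..<t}"]) (auto simp: is_interval_1)
  then have *: "\<forall>\<^sub>F s in at_left t. regular D (i, s) \<and> semiarc_of D (i, s) = ?e"
    unfolding eventually_at_left_field using b by blast
  have eq: "incoming D (i, t) = ?e"
    unfolding incoming_def using limit_semiarc_unique[OF _ *] by simp
  show ?thesis unfolding eq by (rule *)
qed

lemma outgoing_semiarc: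
  assumes "i < ncomp D"
  shows "\<forall>\<^sub>F s in at_right t. regular D (i, s) \<and> semiarc_of D (i, s) = outgoing D (i, t)"
proof -
  have "\<forall>\<^sub>F s in at_right t. regular D (i, s)"
    using eventually_regular[OF assms, of t] by (simp add: eventually_at_split)
  then obtain b where b: "b > t" "\<forall>s>t. s < b \<longrightarrow> regular D (i, s)"
    unfolding eventually_at_right_field by blast
  let ?e = "semiarc_of D (i, (b + t) / 2)"
  have "semiarc_of D (i, s) = ?e" if "t < s" "s < b" for s
    using that b by (intro semiarc_of_const'[of "{t<..<b}"]) (auto simp: is_interval_1)
  then have *: "\<forall>\<^sub>F s in at_right t. regular D (i, s) \<and> semiarc_of D (i, s) = ?e"
    unfolding eventually_at_right_field using b by blast
  have eq: "outgoing D (i, t) = ?e"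
    unfolding outgoing_def using limit_semiarc_unique[OF _ *] by simp
  show ?thesis unfolding eq by (rule *)
qed

lemma eventually_semiarc_of_const:
  assumes "regular D (i, t)"
  shows "\<forall>\<^sub>F s in at t. regular D (i, s) \<and> semiarc_of D (i, s) = semiarc_of D (i, t)"
proof -
  have "i < ncomp D" using assms by (simp add: regular_def)
  from eventually_regular[OF this, of t]
  obtain d where d: "d > 0" "\<And>s. s \<noteq> t \<Longrightarrow> dist s t < d \<Longrightarrow> regular D (i, s)"
    unfolding eventually_at by blast
  have reg: "regular D (i, s)" if "s \<in> ball t d" for s
    using d(2)[of s] assms that by (cases "s = t") (simp_all add: dist_commute)
  have "semiarc_of D (i, s) = semiarc_of D (i, t)" if "s \<in> ball t d" for s
    by (rule semiarc_of_const'[of "ball t d", OF _ reg])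
      (use that d(1) in \<open>auto simp: is_interval_ball_real\<close>)
  with reg show ?thesis
    unfolding eventually_at by (intro exI[of _ d] conjI d(1)) (metis dist_commute mem_ball)
qed

lemma regular_semiarc:
  assumes "regular D P"
  shows "incoming D P = semiarc_of D P" "outgoing D P = semiarc_of D P"
proof -
  obtain i t where P: "P = (i, t)" by force
  have "\<forall>\<^sub>F s in at_left t. regular D (i, s) \<and> semiarc_of D (i, s) = semiarc_of D (i, t)"
    "\<forall>\<^sub>F s in at_right t. regular D (i, s) \<and> semiarc_of D (i, s) = semiarc_of D (i, t)"
    using eventually_semiarc_of_const[of i t] assms unfolding P eventually_at_split by blast+
  from limit_semiarc_unique[OF _ this(1)] limit_semiarc_unique[OF _ this(2)]
  show "incoming D P = semiarc_of D P" "outgoing D P = semiarc_of D P"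
    unfolding incoming_def outgoing_def P fst_conv snd_conv by (metis trivial_limit_at_left_real trivial_limit_at_right_real)+
qed

lemma incoming_in_semiarcs:
  assumes "P \<in> passages D" shows "incoming D P \<in> semiarcs D"
proof (cases P)
  case (Pair i t)
  with assms have "i < ncomp D" by simp
  have nt: "at_left t \<noteq> bot" by simp
  have "\<exists>s. regular D (i, s) \<and> semiarc_of D (i, s) = incoming D (i, t)"
    by (rule eventually_happens'[OF nt]) (rule incoming_semiarc[OF \<open>i < ncomp D\<close>])
  then obtain s where s: "regular D (i, s)" "semiarc_of D (i, s) = incoming D (i, t)" by blast
  show ?thesis using semiarc_of_in_semiarcs[OF s(1)] unfolding s(2) Pair .
qed

lemma outgoing_in_semiarcs:
  assumes "P \<in> passages D" shows "outgoing D P \<in> semiarcs D"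
proof (cases P)
  case (Pair i t)
  with assms have "i < ncomp D" by simp
  have nt: "at_right t \<noteq> bot" by simp
  have "\<exists>s. regular D (i, s) \<and> semiarc_of D (i, s) = outgoing D (i, t)"
    by (rule eventually_happens'[OF nt]) (rule outgoing_semiarc[OF \<open>i < ncomp D\<close>])
  then obtain s where s: "regular D (i, s)" "semiarc_of D (i, s) = outgoing D (i, t)" by blast
  show ?thesis using semiarc_of_in_semiarcs[OF s(1)] unfolding s(2) Pair .
qed

end

section \<open>Colorings as functions on passages\<close>

text \<open>
  \<open>a P\<close> and \<open>b P\<close> stand for the colors of the semiarcs that enter and leave the passage \<open>P\<close>. All
  conditions are local in the parameter, so such functions can be changed piece by piece.
\<close>

definition passage_colors :: "sdiagram \<Rightarrow> 'a set \<Rightarrow> (nat \<times> real \<Rightarrow> 'a) \<Rightarrow> (nat \<times> real \<Rightarrow> 'a) \<Rightarrow> bool" where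
  "passage_colors D X a b \<longleftrightarrow>
     (\<forall>P\<in>passages D. a P \<in> X \<and> b P \<in> X) \<and>
     (\<forall>P\<in>passages D. \<forall>Q. same_passage P Q \<longrightarrow> a P = a Q \<and> b P = b Q) \<and>
     (\<forall>P. regular D P \<longrightarrow> a P = b P) \<and>
     (\<forall>i<ncomp D. \<forall>t. (\<forall>\<^sub>F s in at_left t. a (i, s) = a (i, t)) \<and>
        (\<forall>\<^sub>F s in at_right t. a (i, s) = b (i, t)))"

lemma passage_colorsD:
  assumes "passage_colors D X a b" "P \<in> passages D"
  shows "a P \<in> X" "b P \<in> X" "same_passage P Q \<Longrightarrow> a P = a Q" "same_passage P Q \<Longrightarrow> b P = b Q"
    "regular D P \<Longrightarrow> a P = b P"
  using assms unfolding passage_colors_def by blast+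

lemma passage_colors_near:
  assumes ab: "passage_colors D X a b" and "i < ncomp D"
  shows "\<forall>\<^sub>F s in at_left t. a (i, s) = a (i, t)" "\<forall>\<^sub>F s in at_right t. a (i, s) = b (i, t)"
    "regular D (i, t) \<Longrightarrow> \<forall>\<^sub>F s in at t. a (i, s) = a (i, t)"
proof -
  show *: "\<forall>\<^sub>F s in at_left t. a (i, s) = a (i, t)" "\<forall>\<^sub>F s in at_right t. a (i, s) = b (i, t)"
    using assms unfolding passage_colors_def by blast+
  show "\<forall>\<^sub>F s in at t. a (i, s) = a (i, t)" if "regular D (i, t)"
  proof -
    have "a (i, t) = b (i, t)" using ab that unfolding passage_colors_def by blast
    with * show ?thesis by (simp add: eventually_at_split)
  qed
qed

context
  fixes D assumes diag: "diagram D"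
begin

lemma same_passage_incoming:
  assumes "same_passage P Q" "P \<in> passages D"
  shows "incoming D P = incoming D Q" "outgoing D P = outgoing D Q"
proof -
  obtain i t u where [simp]: "P = (i, t)" "Q = (i, u)"
    using assms(1) by (cases P; cases Q) (auto simp: same_passage_def)
  define k where "k = t - u"
  have k: "k \<in> \<int>" "t = u + k" and i: "i < ncomp D"
    using assms by (auto simp: same_passage_def k_def)
  have sh: "strand D i (s + k) = strand D i s" for s
    by (rule strand_add_int[OF diag i k(1)])
  have L: "(\<forall>\<^sub>F s in at_left t. Q s) \<longleftrightarrow> (\<forall>\<^sub>F s in at_left u. Q (s + k))" for Q
    unfolding k(2) eventually_at_left_field
  proof (intro iffI; elim exE conjE)
    fix b assume "b < u + k" "\<forall>y>b. y < u + k \<longrightarrow> Q y"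
    then show "\<exists>b<u. \<forall>y>b. y < u \<longrightarrow> Q (y + k)"
      by (intro exI[of _ "b - k"]) (simp add: algebra_simps)
  next
    fix b assume "b < u" and *: "\<forall>y>b. y < u \<longrightarrow> Q (y + k)"
    moreover have "Q y" if "b + k < y \<and> y < u + k" for y
      using *[rule_format, of "y - k"] that by (simp add: algebra_simps)
    ultimately show "\<exists>b<u + k. \<forall>y>b. y < u + k \<longrightarrow> Q y"
      by (intro exI[of _ "b + k"]) simp
  qed
  have R: "(\<forall>\<^sub>F s in at_right t. Q s) \<longleftrightarrow> (\<forall>\<^sub>F s in at_right u. Q (s + k))" for Q
    unfolding k(2) eventually_at_right_field
  proof (intro iffI; elim exE conjE)
    fix b assume "b > u + k" "\<forall>y>u + k. y < b \<longrightarrow> Q y"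
    then show "\<exists>b>u. \<forall>y>u. y < b \<longrightarrow> Q (y + k)"
      by (intro exI[of _ "b - k"]) (simp add: algebra_simps)
  next
    fix b assume "b > u" and *: "\<forall>y>u. y < b \<longrightarrow> Q (y + k)"
    moreover have "Q y" if "u + k < y \<and> y < b + k" for y
      using *[rule_format, of "y - k"] that by (simp add: algebra_simps)
    ultimately show "\<exists>b>u + k. \<forall>y>u + k. y < b \<longrightarrow> Q y"
      by (intro exI[of _ "b + k"]) simp
  qed
  show "incoming D P = incoming D Q" "outgoing D P = outgoing D Q"
    by (simp_all add: incoming_def outgoing_def L R sh)
qed

lemma coloring_passage_colors:
  assumes C: "C \<in> semiarcs D \<rightarrow>\<^sub>E X"
  shows "passage_colors D X (\<lambda>P. C (incoming D P)) (\<lambda>P. C (outgoing D P))"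
  unfolding passage_colors_def
proof (intro conjI ballI allI impI)
  fix P assume "P \<in> passages D"
  then show "C (incoming D P) \<in> X" "C (outgoing D P) \<in> X"
    using C incoming_in_semiarcs[OF diag] outgoing_in_semiarcs[OF diag] by blast+
next
  fix P Q assume "P \<in> passages D" "same_passage P Q"
  then show "C (incoming D P) = C (incoming D Q)" "C (outgoing D P) = C (outgoing D Q)"
    using same_passage_incoming by metis+
next
  fix P assume "regular D P"
  then show "C (incoming D P) = C (outgoing D P)"
    using regular_semiarc[OF diag] by metis
next
  fix i t assume i: "i < ncomp D"
  show "\<forall>\<^sub>F s in at_left t. C (incoming D (i, s)) = C (incoming D (i, t))"
    by (rule eventually_mono[OF incoming_semiarc[OF diag i, of t]]) (metis regular_semiarc(1)[OF diag])
  show "\<forall>\<^sub>F s in at_right t. C (incoming D (i, s)) = C (outgoing D (i, t))"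
    by (rule eventually_mono[OF outgoing_semiarc[OF diag i, of t]]) (metis regular_semiarc(1)[OF diag])
qed

text \<open>
  The passages with a given color form a closed set away from the vertices, and so do those with
  another color; their images split the connected semiarc into two relatively closed parts.
\<close>

lemma passage_colors_semiarc:
  assumes ab: "passage_colors D X a b"
    and P: "regular D P" and Q: "regular D Q" and eq: "semiarc_of D P = semiarc_of D Q"
  shows "a P = a Q"
proof (rule ccontr)
  assume neq: "a P \<noteq> a Q"
  define S where "S = pos D ` passages D - vertices D"
  \<comment> \<open>One period reaches every passage; being bounded, it makes the closures compact
    and their images closed.\<close>
  define T where "T v i = {s \<in> {0..1}. regular D (i, s) \<and> v (a (i, s))}" for v i
  define A where "A v = (\<Union>i<ncomp D. strand D i ` closure (T v i))" for v
  have clT: "closure (T v i) \<subseteq> {0..1}" for v i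
    by (rule closure_minimal) (auto simp: T_def)
  have closed: "closed (A v)" for v
    unfolding A_def
  proof (intro closed_UN ballI finite_lessThan)
    fix i assume "i \<in> {..<ncomp D}"
    moreover have "compact (closure (T v i))"
      using clT[of v i] by (intro compact_closure[THEN iffD2] bounded_subset[OF bounded_closed_interval[of 0 1]])
        (auto simp: T_def)
    ultimately show "closed (strand D i ` closure (T v i))"
      by (intro compact_imp_closed compact_continuous_image strand_continuous[OF diag]) auto
  qed
  \<comment> \<open>Passing to the closure adds no wrong passage over a regular position: colors are
    constant near a regular passage, and only one passage, up to integers, lies over such a
    position.\<close>
  have val: "v (a R)" if z: "pos D R \<in> A v" and R: "regular D R" for v R
  proof -
    from z obtain i t where it: "i < ncomp D" "t \<in> closure (T v i)" "pos D R = strand D i t"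
      by (auto simp: A_def)
    have reg: "regular D (i, t)" using R it by (simp add: regular_def pos_def)
    have "\<forall>\<^sub>F s in at t. a (i, s) = a (i, t)"
      by (rule passage_colors_near(3)[OF ab it(1) reg])
    then obtain U where U: "open U" "t \<in> U" "\<And>s. s \<in> U \<Longrightarrow> s \<noteq> t \<Longrightarrow> a (i, s) = a (i, t)"
      unfolding eventually_at_topological by blast
    obtain s where "s \<in> U" "s \<in> T v i"
      using it(2) U(1,2) unfolding closure_iff_nhds_not_empty by blast
    then have "v (a (i, t))" using U(3)[of s] by (cases "s = t") (auto simp: T_def)
    moreover have "same_passage R (i, t)"
    proof (rule ccontr)
      assume "\<not> same_passage R (i, t)"
      then have "meets D R (i, t)" using R it by (auto simp: meets_def regular_def pos_def)
      then show False using R by (auto simp: regular_iff_no_meets)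
    qed
    moreover have "R \<in> passages D" using R by (simp add: regular_def)
    ultimately show ?thesis using passage_colorsD(3)[OF ab, of R "(i, t)"] by simp
  qed
  have cover: "pos D R \<in> A v" if "regular D R" "v (a R)" for v R
  proof -
    obtain i t where [simp]: "R = (i, t)" by force
    have same: "same_passage R (i, frac t)"
      by (simp add: same_passage_def frac_def)
    have "a (i, frac t) = a R" 
      using passage_colorsD(3)[OF ab _ same] that(1) by (simp add: regular_def)
    moreover have "regular D (i, frac t)" by (rule same_passage_regular[OF diag same that(1)])
    ultimately have "frac t \<in> T v i" using that frac_lt_1[of t] by (simp add: T_def less_imp_le)
    moreover have "i < ncomp D" using that by (simp add: regular_def)
    moreover have "pos D R = strand D i (frac t)"
      using same_passage_pos[OF diag same] that(1) by (simp add: regular_def pos_def)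
    ultimately show ?thesis using closure_subset[of "T v i"] unfolding A_def by blast
  qed
  have regS: "\<exists>R. regular D R \<and> z = pos D R" if "z \<in> S" for z
    using that by (auto simp: S_def regular_def simp del: passages_iff)
  let ?e = "semiarc_of D P"
  let ?v = "\<lambda>c. c = a P" and ?w = "\<lambda>c. c \<noteq> a P"
  have eS: "?e \<subseteq> S" by (simp add: semiarc_of_def S_def connected_component_subset)
  have "A ?v \<inter> ?e = {} \<or> A ?w \<inter> ?e = {}"
  proof (rule connected_closedD[OF _ _ _ closed closed])
    show "connected ?e" by (simp add: semiarc_of_def)
    show "A ?v \<inter> A ?w \<inter> ?e = {}"
    proof (rule ccontr)
      assume "A ?v \<inter> A ?w \<inter> ?e \<noteq> {}"
      then obtain R where "regular D R" "pos D R \<in> A ?v" "pos D R \<in> A ?w"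
        using regS eS by blast
      then show False using val[of R ?v] val[of R ?w] by blast
    qed
    show "?e \<subseteq> A ?v \<union> A ?w"
    proof
      fix z assume "z \<in> ?e"
      then obtain R where "regular D R" "z = pos D R" using regS eS by blast
      then show "z \<in> A ?v \<union> A ?w" using cover[of R ?v] cover[of R ?w] by blast
    qed
  qed
  moreover have "pos D P \<in> A ?v \<inter> ?e" using cover[OF P, of ?v] pos_in_semiarc_of[OF P] by simp
  moreover have "pos D Q \<in> A ?w \<inter> ?e"
    using cover[OF Q, of ?w] pos_in_semiarc_of[OF Q] eq neq by simp
  ultimately show False by blast
qed

lemma passage_colors_imp_coloring:
  assumes ab: "passage_colors D X a b"
  obtains C where "C \<in> semiarcs D \<rightarrow>\<^sub>E X"
    "\<And>P. P \<in> passages D \<Longrightarrow> C (incoming D P) = a P"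
    "\<And>P. P \<in> passages D \<Longrightarrow> C (outgoing D P) = b P"
proof -
  \<comment> \<open>Any regular passage on the semiarc may be chosen, since all of them have the
    same color.\<close>
  define C where "C = (\<lambda>e\<in>semiarcs D. a (SOME P. regular D P \<and> semiarc_of D P = e))"
  have C: "C (semiarc_of D P) = a P" if "regular D P" for P
  proof -
    have "regular D (SOME Q. regular D Q \<and> semiarc_of D Q = semiarc_of D P) \<and>
        semiarc_of D (SOME Q. regular D Q \<and> semiarc_of D Q = semiarc_of D P) = semiarc_of D P"
      by (rule someI) (use that in blast)
    then show ?thesis
      using passage_colors_semiarc[OF ab _ that] semiarc_of_in_semiarcs[OF that] by (simp add: C_def)
  qed
  show thesis
  proof
    show "C \<in> semiarcs D \<rightarrow>\<^sub>E X"
    proof (rule PiE_I)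
      fix e assume "e \<in> semiarcs D"
      then obtain P where "regular D P" "e = semiarc_of D P" by (rule semiarcsE)
      then show "C e \<in> X" using C passage_colorsD(1)[OF ab, of P] by (simp add: regular_def)
    qed (simp add: C_def)
  next
    \<comment> \<open>\<open>P\<close> may lie at a vertex, which belongs to no semiarc, so both
      colors are read off at regular parameters shortly before and after it.\<close>
    fix P assume P: "P \<in> passages D"
    obtain i t where Pit: "P = (i, t)" by force
    have i: "i < ncomp D" using P Pit by simp
    have "\<forall>\<^sub>F s in at_left t. a (i, s) = a (i, t)" "\<forall>\<^sub>F s in at_right t. a (i, s) = b (i, t)"
        by (rule passage_colors_near[OF ab i])+
    then have *: "\<forall>\<^sub>F s in at_left t. (regular D (i, s) \<and> semiarc_of D (i, s) = incoming D (i, t)) \<and> a (i, s) = a (i, t)"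
      "\<forall>\<^sub>F s in at_right t. (regular D (i, s) \<and> semiarc_of D (i, s) = outgoing D (i, t)) \<and> a (i, s) = b (i, t)"
      using incoming_semiarc[OF diag i, of t] outgoing_semiarc[OF diag i, of t] eventually_conj by blast+
    have "\<exists>s. (regular D (i, s) \<and> semiarc_of D (i, s) = incoming D (i, t)) \<and> a (i, s) = a (i, t)"
      by (rule eventually_happens'[OF _ *(1)]) simp
    then show "C (incoming D P) = a P" using C Pit by metis
    have "\<exists>s. (regular D (i, s) \<and> semiarc_of D (i, s) = outgoing D (i, t)) \<and> a (i, s) = b (i, t)"
      by (rule eventually_happens'[OF _ *(2)]) simp
    then show "C (outgoing D P) = b P" using C Pit by metis
  qed
qed

lemma coloring_ext:
  assumes "C \<in> semiarcs D \<rightarrow>\<^sub>E X" "C' \<in> semiarcs D \<rightarrow>\<^sub>E X"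
    and "\<And>P. regular D P \<Longrightarrow> C (incoming D P) = C' (incoming D P)"
  shows "C = C'"
proof (rule PiE_ext[OF assms(1,2)])
  fix e assume "e \<in> semiarcs D"
  then obtain P where "regular D P" "e = semiarc_of D P" by (rule semiarcsE)
  then show "C e = C' e" using assms(3)[of P] regular_semiarc(1)[OF diag] by metis
qed

text \<open>On the open interval the color is locally constant and hence constant. The endpoints may
  be crossings, so they are reached only through the one-sided conditions: the color after the left
  end and the color before the right end.\<close>

lemma passage_colors_const:
  assumes ab: "passage_colors D X a b" and i: "i < ncomp D"
    and reg: "\<And>s. x < s \<Longrightarrow> s < y \<Longrightarrow> regular D (i, s)"
    and s: "x < s" "s < y"
  shows "a (i, s) = b (i, x)" "a (i, s) = a (i, y)"
proof -
  have const: "a (i, u) = a (i, v)" if "u \<in> {x<..<y}" "v \<in> {x<..<y}" for u v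
  proof (rule connected_local_const[of "{x<..<y}" _ _ "\<lambda>s. a (i, s)", OF _ that])
    show "\<forall>u\<in>{x<..<y}. \<forall>\<^sub>F v in at u within {x<..<y}. a (i, u) = a (i, v)"
    proof
      fix u assume "u \<in> {x<..<y}"
      then have "regular D (i, u)" using reg by simp
      then have "\<forall>\<^sub>F v in at u. a (i, v) = a (i, u)"
        by (rule passage_colors_near(3)[OF ab i])
      then have "\<forall>\<^sub>F v in at u within {x<..<y}. a (i, v) = a (i, u)"
        by (rule filter_leD[OF at_le, rotated]) simp
      then show "\<forall>\<^sub>F v in at u within {x<..<y}. a (i, u) = a (i, v)"
        by (rule eventually_mono) simp
    qed
  qed simp
  have xy: "x < y" using s by simp
  have "\<forall>\<^sub>F v in at_right x. a (i, v) = b (i, x) \<and> v \<in> {x<..<y}"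
    by (intro eventually_conj passage_colors_near[OF ab i] eventually_at_rightI[OF _ xy])
  from eventually_happens'[OF trivial_limit_at_right_real this]
  show "a (i, s) = b (i, x)" using const[of s] s by (metis greaterThanLessThan_iff)
  have "\<forall>\<^sub>F v in at_left y. a (i, v) = a (i, y) \<and> v \<in> {x<..<y}"
    by (intro eventually_conj passage_colors_near[OF ab i] eventually_at_leftI[OF _ xy])
  from eventually_happens'[OF trivial_limit_at_left_real this]
  show "a (i, s) = a (i, y)" using const[of s] s by (metis greaterThanLessThan_iff)
qed

end

text \<open>The clause of \<open>colorings\<close> for an ordered pair of passages, with the colors
  as arguments, so that it also applies to colors that are not yet known to come from semiarcs. At a
  crossing of a diagram exactly one of the two orders of the passages gives a rule with
  content.\<close>

definition crossing_rule :: "'a set \<Rightarrow> ('a \<Rightarrow> 'a \<Rightarrow> 'a) \<Rightarrow> ('a \<Rightarrow> 'a \<Rightarrow> 'a) \<Rightarrow> ('a \<Rightarrow> 'a \<Rightarrow> 'a) \<Rightarrow>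
    sdiagram \<Rightarrow> nat \<times> real \<Rightarrow> nat \<times> real \<Rightarrow> 'a \<Rightarrow> 'a \<Rightarrow> 'a \<Rightarrow> 'a \<Rightarrow> bool" where
  "crossing_rule X star R1 R2 D P Q aP bP aQ bQ \<longleftrightarrow>
     (kind D P = Over \<longrightarrow> bP = aP \<and>
        bQ = (if cdet (dir D P) (dir D Q) > 0 then star aQ aP else quandle.bar X star aQ aP)) \<and>
     (kind D P = Singular \<and> cdet (dir D P) (dir D Q) < 0 \<longrightarrow> bQ = R1 aP aQ \<and> bP = R2 aP aQ)"

lemma colorings_iff:
  "C \<in> colorings X star R1 R2 D \<longleftrightarrow> C \<in> semiarcs D \<rightarrow>\<^sub>E X \<and>
     (\<forall>P Q. meets D P Q \<longrightarrow> crossing_rule X star R1 R2 D P Q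
        (C (incoming D P)) (C (outgoing D P)) (C (incoming D Q)) (C (outgoing D Q)))"
  unfolding colorings_def crossing_rule_def mem_Collect_eq ..

text \<open>Two sets of colorings are compared through their images in a third set, so that no map
  between them has to be constructed or inverted by hand.\<close>

lemma ex_bij_betw_of_injections:
  assumes "inj_on f A" "inj_on g B" "f ` A \<subseteq> g ` B" "g ` B \<subseteq> f ` A"
  shows "\<exists>h. bij_betw h A B"
proof -
  have "f ` A = g ` B" using assms by blast
  then have "bij_betw f A (g ` B)" "bij_betw g B (g ` B)" using assms by (auto simp: bij_betw_def)
  then show ?thesis using bij_betw_inv_into bij_betw_trans by blast
qed

section \<open>Planar isotopy\<close>

lemma passage_colors_imp_colorings:
  assumes "diagram D" "passage_colors D X a b"
    and "\<And>P Q. meets D P Q \<Longrightarrow> crossing_rule X star R1 R2 D P Q (a P) (b P) (a Q) (b Q)"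
  shows "\<exists>C\<in>colorings X star R1 R2 D. \<forall>P\<in>passages D.
    C (incoming D P) = a P \<and> C (outgoing D P) = b P"
proof -
  obtain C where C: "C \<in> semiarcs D \<rightarrow>\<^sub>E X"
    "\<And>P. P \<in> passages D \<Longrightarrow> C (incoming D P) = a P"
    "\<And>P. P \<in> passages D \<Longrightarrow> C (outgoing D P) = b P"
    using passage_colors_imp_coloring[OF assms(1,2)] by blast
  moreover have "C \<in> colorings X star R1 R2 D"
    unfolding colorings_iff using C assms(3) meets_passages[of D] by metis
  ultimately show ?thesis by blast
qed

lemma colorings_imp_passage_colors:
  assumes "diagram D" "C \<in> colorings X star R1 R2 D"
  shows "passage_colors D X (\<lambda>P. C (incoming D P)) (\<lambda>P. C (outgoing D P))"
  using assms coloring_passage_colors unfolding colorings_iff by blast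

lemma colorings_eqI:
  assumes "diagram D" "C \<in> colorings X star R1 R2 D" "C' \<in> colorings X star R1 R2 D"
    and "\<And>P. regular D P \<Longrightarrow> C (incoming D P) = C' (incoming D P)"
  shows "C = C'"
  using assms coloring_ext unfolding colorings_iff by blast

section \<open>Relabelling of passages\<close>

definition move_passage :: "(nat \<Rightarrow> nat) \<Rightarrow> (nat \<Rightarrow> real \<Rightarrow> real) \<Rightarrow> nat \<times> real \<Rightarrow> nat \<times> real" where
  "move_passage \<pi> \<phi> P = (\<pi> (fst P), \<phi> (fst P) (snd P))"

text \<open>Keeps of an isotopy only what colorings can see: which passages meet, their kinds, the
  signs of the crossings, and the order of parameters along each component. In contrast to
  \<open>planar_isotopic\<close>, this relation is easily inverted.\<close>

definition relabels :: "sdiagram \<Rightarrow> sdiagram \<Rightarrow> (nat \<Rightarrow> nat) \<Rightarrow> (nat \<Rightarrow> real \<Rightarrow> real) \<Rightarrow> bool" where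
  "relabels D D' \<pi> \<phi> \<longleftrightarrow> diagram D \<and> diagram D' \<and> ncomp D' = ncomp D \<and>
     bij_betw \<pi> {..<ncomp D} {..<ncomp D} \<and>
     (\<forall>i<ncomp D. strict_mono (\<phi> i) \<and> surj (\<phi> i) \<and> (\<forall>s t. \<phi> i s - \<phi> i t \<in> \<int> \<longleftrightarrow> s - t \<in> \<int>)) \<and>
     (\<forall>P\<in>passages D'. \<forall>Q\<in>passages D'.
        meets D' P Q = meets D (move_passage \<pi> \<phi> P) (move_passage \<pi> \<phi> Q) \<and>
        (meets D' P Q \<longrightarrow> kind D' P = kind D (move_passage \<pi> \<phi> P) \<and>
          sgn (cdet (dir D' P) (dir D' Q)) = sgn (cdet (dir D (move_passage \<pi> \<phi> P)) (dir D (move_passage \<pi> \<phi> Q)))))"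

text \<open>Makes the relation symmetric, so that transporting colorings in one direction is enough
  for a bijection.\<close>

lemma relabels_inverse:
  assumes rel: "relabels D D' \<pi> \<phi>"
  obtains \<pi>' \<phi>' where "relabels D' D \<pi>' \<phi>'"
    "\<And>P. P \<in> passages D \<Longrightarrow> move_passage \<pi>' \<phi>' P \<in> passages D \<and> move_passage \<pi> \<phi> (move_passage \<pi>' \<phi>' P) = P"
    "\<And>P. P \<in> passages D' \<Longrightarrow> move_passage \<pi> \<phi> P \<in> passages D \<and> move_passage \<pi>' \<phi>' (move_passage \<pi> \<phi> P) = P"
proof -
  define n where "n = ncomp D"
  have n: "ncomp D = n" "ncomp D' = n" and bij: "bij_betw \<pi> {..<n} {..<n}"
    and phi: "\<And>i. i < n \<Longrightarrow> strict_mono (\<phi> i) \<and> surj (\<phi> i) \<and> (\<forall>s t. \<phi> i s - \<phi> i t \<in> \<int> \<longleftrightarrow> s - t \<in> \<int>)"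
    and K: "\<And>P Q. P \<in> passages D' \<Longrightarrow> Q \<in> passages D' \<Longrightarrow>
        meets D' P Q = meets D (move_passage \<pi> \<phi> P) (move_passage \<pi> \<phi> Q) \<and>
        (meets D' P Q \<longrightarrow> kind D' P = kind D (move_passage \<pi> \<phi> P) \<and>
          sgn (cdet (dir D' P) (dir D' Q)) = sgn (cdet (dir D (move_passage \<pi> \<phi> P)) (dir D (move_passage \<pi> \<phi> Q))))"
    using rel unfolding relabels_def n_def by blast+
  define \<pi>' where "\<pi>' = inv_into {..<n} \<pi>"
  define \<phi>' where "\<phi>' j = inv (\<phi> (\<pi>' j))" for j
  have bij': "bij_betw \<pi>' {..<n} {..<n}"
    unfolding \<pi>'_def by (rule bij_betw_inv_into[OF bij])
  have lt: "\<pi>' j < n" "\<pi> j < n" if "j < n" for j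
    using bij bij' that by (auto dest: bij_betwE)
  have pp: "\<pi> (\<pi>' j) = j" "\<pi>' (\<pi> j) = j" if "j < n" for j
    using bij that by (auto simp: \<pi>'_def bij_betw_inv_into_left bij_betw_inv_into_right)
  have inj: "inj (\<phi> i)" if "i < n" for i
    using phi[OF that] by (simp add: strict_mono_imp_inj_on)
  have ff: "\<phi> i (inv (\<phi> i) t) = t" "inv (\<phi> i) (\<phi> i t) = t" if "i < n" for i t
    using phi[OF that] inj[OF that] by (simp_all add: surj_f_inv_f)
  have A: "move_passage \<pi>' \<phi>' P \<in> passages D \<and> move_passage \<pi> \<phi> (move_passage \<pi>' \<phi>' P) = P"
    if "P \<in> passages D" for P
    using that lt pp ff n by (cases P) (auto simp: move_passage_def \<phi>'_def)
  have B: "move_passage \<pi> \<phi> P \<in> passages D \<and> move_passage \<pi>' \<phi>' (move_passage \<pi> \<phi> P) = P"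
    if "P \<in> passages D'" for P
    using that lt pp ff n by (cases P) (auto simp: move_passage_def \<phi>'_def)
  have "relabels D' D \<pi>' \<phi>'"
    unfolding relabels_def n
  proof (intro conjI ballI allI impI)
    fix j assume j: "j < n"
    note i = lt(1)[OF j]
    show "strict_mono (\<phi>' j)"
    proof (rule strict_monoI)
      fix x y :: real assume "x < y"
      then show "\<phi>' j x < \<phi>' j y"
        using phi[OF i] ff(1)[OF i] unfolding \<phi>'_def by (metis strict_mono_less)
    qed
    show "surj (\<phi>' j)" unfolding \<phi>'_def using inj[OF i] by (rule inj_imp_surj_inv)
    show "\<phi>' j s - \<phi>' j t \<in> \<int> \<longleftrightarrow> s - t \<in> \<int>" for s t
      using phi[OF i] ff(1)[OF i] unfolding \<phi>'_def by metis
  next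
    fix P Q assume P: "P \<in> passages D" and Q: "Q \<in> passages D"
    let ?P = "move_passage \<pi>' \<phi>' P" and ?Q = "move_passage \<pi>' \<phi>' Q"
    have "?P \<in> passages D'" "?Q \<in> passages D'" using A[OF P] A[OF Q] n by simp_all
    then have "meets D' ?P ?Q = meets D P Q \<and>
      (meets D' ?P ?Q \<longrightarrow> kind D' ?P = kind D P \<and>
          sgn (cdet (dir D' ?P) (dir D' ?Q)) = sgn (cdet (dir D P) (dir D Q)))"
      using K[of ?P ?Q] A[OF P] A[OF Q] by simp
    then have *: "meets D P Q = meets D' ?P ?Q \<and>
      (meets D P Q \<longrightarrow> kind D P = kind D' ?P \<and>
          sgn (cdet (dir D P) (dir D Q)) = sgn (cdet (dir D' ?P) (dir D' ?Q)))"
      by metis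
    then show "meets D P Q = meets D' ?P ?Q" by blast
    assume "meets D P Q"
    with * show "kind D P = kind D' ?P" "sgn (cdet (dir D P) (dir D Q)) = sgn (cdet (dir D' ?P) (dir D' ?Q))"
      by blast+
  qed (use rel bij' in \<open>simp_all add: relabels_def\<close>)
  then show thesis using that A B by blast
qed

lemma relabels_coloring:
  assumes rel: "relabels D D' \<pi> \<phi>" and C: "C \<in> colorings X star R1 R2 D"
  shows "\<exists>C'\<in>colorings X star R1 R2 D'. \<forall>P\<in>passages D'.
    C' (incoming D' P) = C (incoming D (move_passage \<pi> \<phi> P))"
proof -
  let ?m = "move_passage \<pi> \<phi>"
  let ?a = "\<lambda>P. C (incoming D P)" and ?b = "\<lambda>P. C (outgoing D P)"
  have diag: "diagram D" "diagram D'" and n: "ncomp D' = ncomp D"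
    and bij: "bij_betw \<pi> {..<ncomp D} {..<ncomp D}"
    and phi: "\<And>i. i < ncomp D \<Longrightarrow> strict_mono (\<phi> i) \<and> surj (\<phi> i) \<and> (\<forall>s t. \<phi> i s - \<phi> i t \<in> \<int> \<longleftrightarrow> s - t \<in> \<int>)"
    and M: "\<And>P Q. P \<in> passages D' \<Longrightarrow> Q \<in> passages D' \<Longrightarrow> meets D' P Q = meets D (?m P) (?m Q)"
    and K: "\<And>P Q. meets D' P Q \<Longrightarrow> kind D' P = kind D (?m P) \<and>
          sgn (cdet (dir D' P) (dir D' Q)) = sgn (cdet (dir D (?m P)) (dir D (?m Q)))"
    using rel meets_passages[of D'] unfolding relabels_def by blast+
  have mP: "?m P \<in> passages D" if "P \<in> passages D'" for P
    using that bij n by (auto simp: move_passage_def dest: bij_betwE)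
  have ab: "passage_colors D X ?a ?b" by (rule colorings_imp_passage_colors[OF diag(1) C])
  obtain \<pi>' \<phi>' where inv: "\<And>P. P \<in> passages D \<Longrightarrow> move_passage \<pi>' \<phi>' P \<in> passages D \<and> ?m (move_passage \<pi>' \<phi>' P) = P"
    using relabels_inverse[OF rel] by metis
  have pe: "passages D' = passages D" by (simp add: passages_def n)
  \<comment> \<open>A meeting partner in \<open>D\<close> is itself a relabelled passage, because
    the relabelling is onto; it would give a meeting partner in \<open>D'\<close>.\<close>
  have reg: "regular D (?m P)" if "regular D' P" for P
  proof -
    have P: "P \<in> passages D'" using that by (simp add: regular_def)
    have "\<not> meets D (?m P) Q" for Q
    proof
      assume Q: "meets D (?m P) Q"
      then have "Q \<in> passages D" by (simp add: meets_def)
      with inv pe obtain Q' where "Q' \<in> passages D'" "?m Q' = Q" by metis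
      then have "meets D' P Q'" using M P Q by blast
      then show False using that unfolding regular_iff_no_meets by blast
    qed
    then show ?thesis using mP[OF P] unfolding regular_iff_no_meets by blast
  qed
  have sgn_cong: "(x > 0) = (y > 0) \<and> (x < 0) = (y < 0)" if "sgn x = sgn y" for x y :: real
    using that by (auto simp: sgn_if split: if_splits)
  have pc: "passage_colors D' X (?a \<circ> ?m) (?b \<circ> ?m)"
    unfolding passage_colors_def
  proof (intro conjI ballI allI impI)
    fix P assume "P \<in> passages D'"
    then show "(?a \<circ> ?m) P \<in> X" "(?b \<circ> ?m) P \<in> X"
      using passage_colorsD(1,2)[OF ab mP] by simp_all
  next
    fix P Q assume P: "P \<in> passages D'" and "same_passage P Q"
    then have "same_passage (?m P) (?m Q)"
      using phi n by (auto simp: same_passage_def move_passage_def)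
    then show "(?a \<circ> ?m) P = (?a \<circ> ?m) Q" "(?b \<circ> ?m) P = (?b \<circ> ?m) Q"
      using passage_colorsD(3,4)[OF ab mP[OF P]] by simp_all
  next
    fix P assume "regular D' P"
    then show "(?a \<circ> ?m) P = (?b \<circ> ?m) P"
      using passage_colorsD(5)[OF ab _ reg] mP unfolding regular_def by simp
  next
    fix i t assume i: "i < ncomp D'"
    then have i': "\<pi> i < ncomp D" using mP[of "(i, t)"] by (simp add: move_passage_def)
    \<comment> \<open>An increasing bijection carries left neighborhoods to left neighborhoods and
      right ones to right ones, so the one-sided conditions are transported separately.\<close>
    have mono: "\<phi> i x < \<phi> i y \<longleftrightarrow> x < y" for x y
      using phi[of i] i n by (simp add: strict_mono_less)
    have surj: "\<exists>x. y = \<phi> i x" for y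
      using phi[of i] i n by (metis surjD)
    obtain b where "b < \<phi> i t" and b: "\<forall>y>b. y < \<phi> i t \<longrightarrow> ?a (\<pi> i, y) = ?a (\<pi> i, \<phi> i t)"
      using passage_colors_near(1)[OF ab i', of "\<phi> i t"] unfolding eventually_at_left_field by blast
    moreover obtain x where "b = \<phi> i x" using surj by blast
    ultimately show "\<forall>\<^sub>F s in at_left t. (?a \<circ> ?m) (i, s) = (?a \<circ> ?m) (i, t)"
      unfolding eventually_at_left_field by (intro exI[of _ x]) (simp add: mono move_passage_def)
    obtain b where "b > \<phi> i t" and b: "\<forall>y>\<phi> i t. y < b \<longrightarrow> ?a (\<pi> i, y) = ?b (\<pi> i, \<phi> i t)"
      using passage_colors_near(2)[OF ab i', of "\<phi> i t"] unfolding eventually_at_right_field by blast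
    moreover obtain x where "b = \<phi> i x" using surj by blast
    ultimately show "\<forall>\<^sub>F s in at_right t. (?a \<circ> ?m) (i, s) = (?b \<circ> ?m) (i, t)"
      unfolding eventually_at_right_field by (intro exI[of _ x]) (simp add: mono move_passage_def)
  qed
  have cr: "crossing_rule X star R1 R2 D' P Q ((?a \<circ> ?m) P) ((?b \<circ> ?m) P) ((?a \<circ> ?m) Q) ((?b \<circ> ?m) Q)"
    if "meets D' P Q" for P Q
  proof -
    have "meets D (?m P) (?m Q)" using M that meets_passages[OF that] by blast
    then have "crossing_rule X star R1 R2 D (?m P) (?m Q) (?a (?m P)) (?b (?m P)) (?a (?m Q)) (?b (?m Q))"
      using C unfolding colorings_iff by blast
    moreover have "(cdet (dir D' P) (dir D' Q) > 0) = (cdet (dir D (?m P)) (dir D (?m Q)) > 0)"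
      "(cdet (dir D' P) (dir D' Q) < 0) = (cdet (dir D (?m P)) (dir D (?m Q)) < 0)"
      using sgn_cong[OF conjunct2[OF K[OF that]]] by blast+
    moreover have k: "kind D (?m P) = kind D' P" using K[OF that] by simp
    ultimately show ?thesis unfolding crossing_rule_def comp_def k by simp
  qed
  show ?thesis
    using passage_colors_imp_colorings[OF diag(2) pc cr] unfolding comp_def by blast
qed

lemma relabels_bij:
  fixes X :: "'a set"
  assumes rel: "relabels D D' \<pi> \<phi>"
  shows "\<exists>f. bij_betw f (colorings X star R1 R2 D) (colorings X star R1 R2 D')"
proof -
  let ?m = "move_passage \<pi> \<phi>"
  obtain \<pi>' \<phi>' where rel': "relabels D' D \<pi>' \<phi>'"
    and A: "\<And>P. P \<in> passages D \<Longrightarrow> move_passage \<pi>' \<phi>' P \<in> passages D \<and> ?m (move_passage \<pi>' \<phi>' P) = P"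
    and B: "\<And>P. P \<in> passages D' \<Longrightarrow> ?m P \<in> passages D \<and> move_passage \<pi>' \<phi>' (?m P) = P"
    using relabels_inverse[OF rel] by metis
  have diag: "diagram D" "diagram D'" and pe: "passages D' = passages D"
    using rel by (simp_all add: relabels_def passages_def)
  let ?f = "\<lambda>C :: complex set \<Rightarrow> 'a. \<lambda>P\<in>passages D'. C (incoming D (?m P))"
  let ?g = "\<lambda>C :: complex set \<Rightarrow> 'a. \<lambda>P\<in>passages D'. C (incoming D' P)"
  show ?thesis
  proof (rule ex_bij_betw_of_injections)
    show "inj_on ?f (colorings X star R1 R2 D)"
    proof (rule inj_onI, rule colorings_eqI[OF diag(1)])
      fix C C' P assume eq: "?f C = ?f C'" and "regular D P"
      then have "P \<in> passages D" by (simp add: regular_def)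
      with A pe have "move_passage \<pi>' \<phi>' P \<in> passages D'" "?m (move_passage \<pi>' \<phi>' P) = P" by blast+
      with fun_cong[OF eq, of "move_passage \<pi>' \<phi>' P"] show "C (incoming D P) = C' (incoming D P)"
        by simp
    qed
    show "inj_on ?g (colorings X star R1 R2 D')"
    proof (rule inj_onI, rule colorings_eqI[OF diag(2)])
      fix C C' P assume eq: "?g C = ?g C'" and "regular D' P"
      then have "P \<in> passages D'" by (simp add: regular_def)
      with fun_cong[OF eq, of P] show "C (incoming D' P) = C' (incoming D' P)" by simp
    qed
    show "?f ` colorings X star R1 R2 D \<subseteq> ?g ` colorings X star R1 R2 D'"
    proof (rule image_subsetI)
      fix C assume "C \<in> colorings X star R1 R2 D"
      from relabels_coloring[OF rel this] obtain C' where C': "C' \<in> colorings X star R1 R2 D'"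
        "\<forall>P\<in>passages D'. C' (incoming D' P) = C (incoming D (?m P))" by blast
      then have "?f C = ?g C'" by (intro restrict_ext) simp
      with C'(1) show "?f C \<in> ?g ` colorings X star R1 R2 D'" by blast
    qed
    show "?g ` colorings X star R1 R2 D' \<subseteq> ?f ` colorings X star R1 R2 D"
    proof (rule image_subsetI)
      fix C' assume "C' \<in> colorings X star R1 R2 D'"
      from relabels_coloring[OF rel' this] obtain C where C: "C \<in> colorings X star R1 R2 D"
        "\<forall>P\<in>passages D. C (incoming D P) = C' (incoming D' (move_passage \<pi>' \<phi>' P))" by blast
      then have "?g C' = ?f C" using B by (intro restrict_ext) simp
      with C(1) show "?g C' \<in> ?f ` colorings X star R1 R2 D" by blast
    qed
  qed
qed

section \<open>Orientation and the Jacobian of an isotopy\<close>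

lemma cdet_linear:
  assumes "linear L"
  shows "cdet (L v) (L w) = cdet (L 1) (L \<i>) * cdet v w"
proof -
  have *: "L x = Re x *\<^sub>R L 1 + Im x *\<^sub>R L \<i>" for x
  proof -
    have "x = Re x *\<^sub>R 1 + Im x *\<^sub>R \<i>" by (simp add: complex_eq_iff)
    then have "L x = L (Re x *\<^sub>R 1 + Im x *\<^sub>R \<i>)" by (rule arg_cong)
    then show ?thesis by (simp add: linear_add[OF assms] linear_scale[OF assms])
  qed
  show ?thesis unfolding *[of v] *[of w] by (simp add: cdet_def algebra_simps)
qed

lemma cdet_scaleR [simp]:
  "cdet (r *\<^sub>R v) w = r * cdet v w" "cdet v (r *\<^sub>R w) = r * cdet v w"
  by (simp_all add: cdet_def algebra_simps)

text \<open>\<open>cdet (L 1) (L \<i>)\<close> is the determinant of \<open>L\<close>. By the chain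
  rule for \<open>inv h \<circ> h\<close> the derivative of the inverse inverts \<open>L\<close>, so
  the two determinants have product 1.\<close>

lemma diffeo_cdet_nonzero:
  fixes h :: "complex \<Rightarrow> complex"
  assumes "diffeo h" "(h has_derivative L) (at z)"
  shows "cdet (L 1) (L \<i>) \<noteq> 0"
proof -
  from assms(1) have "bij h" "inv h differentiable (at (h z))"
    by (auto simp: diffeo_def smooth_differentiable)
  then obtain M where M: "(inv h has_derivative M) (at (h z))" by (auto simp: differentiable_def)
  have "(inv h \<circ> h has_derivative M \<circ> L) (at z)"
    by (rule diff_chain_at[OF assms(2) M])
  moreover have "inv h \<circ> h = (\<lambda>x. x)" using \<open>bij h\<close> by (simp add: bij_def id_def)
  ultimately have "((\<lambda>x. x) has_derivative M \<circ> L) (at z)" by simp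
  from has_derivative_unique[OF this has_derivative_ident]
  have "M (L w) = w" for w by (auto dest: fun_cong)
  then have "cdet (M (L 1)) (M (L \<i>)) = cdet 1 \<i>" by simp
  moreover have "linear M" using M by (rule has_derivative_linear)
  ultimately have "cdet (M 1) (M \<i>) * cdet (L 1) (L \<i>) = 1"
    using cdet_linear[of M "L 1" "L \<i>"] by (simp add: cdet_def)
  then show ?thesis by auto
qed

text \<open>At a fixed point the Jacobian depends continuously on the time \<open>s\<close> and
  equals 1 at time 0; if it were not positive at time 1, the intermediate value theorem would
  produce a zero in between.\<close>

lemma isotopy_preserves_orientation:
  fixes H :: "real \<Rightarrow> complex \<Rightarrow> complex"
  assumes smooth: "smooth (\<lambda>(s, z). H s z)" and diffeo: "\<And>s. s \<in> {0..1} \<Longrightarrow> diffeo (H s)"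
    and H0: "H 0 = id" and L: "(H 1 has_derivative L) (at z)"
  shows "cdet (L 1) (L \<i>) > 0"
proof -
  define G where "G = (\<lambda>(s, z). H s z)"
  define F where "F b s = frechet_derivative G (at (s, z)) b" for b s
  have dG: "(G has_derivative frechet_derivative G (at x)) (at x)" for x
    using smooth smooth_differentiable frechet_derivative_works unfolding G_def by blast
  have dH: "(H s has_derivative (\<lambda>w. F (0, w) s)) (at z)" for s
  proof -
    have "((\<lambda>w. (s, w)) has_derivative (\<lambda>w. (0, w))) (at z)"
      by (auto intro!: derivative_eq_intros)
    from diff_chain_at[OF this dG] show ?thesis
      by (simp add: G_def comp_def F_def)
  qed
  \<comment> \<open>Continuity in \<open>s\<close> of the derivative in direction \<open>z\<close>
    uses the joint smoothness of the isotopy: the partial derivatives of \<open>G\<close> are again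
    smooth, hence continuous in both variables.\<close>
  have cont: "continuous_on {0..1} (F b)" if "b \<in> Basis" for b
  proof -
    have "smooth (\<lambda>x. frechet_derivative G (at x) b)"
      using smooth that unfolding G_def by (cases rule: smooth.cases) blast
    then have "continuous_on UNIV (\<lambda>x. frechet_derivative G (at x) b)"
      by (meson continuous_at_imp_continuous_on differentiable_imp_continuous_within smooth_differentiable)
    then have "continuous_on {0..1} (\<lambda>s. (\<lambda>x. frechet_derivative G (at x) b) (s, z))"
      by (rule continuous_on_compose2) (auto intro: continuous_on_Pair continuous_on_const continuous_on_id)
    then show ?thesis by (simp add: F_def[abs_def])
  qed
  define J where "J s = cdet (F (0, 1) s) (F (0, \<i>) s)" for s
  have "(0, 1) \<in> (Basis :: (real \<times> complex) set)" "(0, \<i>) \<in> (Basis :: (real \<times> complex) set)"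
    by (auto simp: Basis_prod_def Basis_complex_def)
  then have "continuous_on {0..1} J"
    unfolding J_def cdet_def by (intro continuous_intros cont)
  moreover have nz: "J s \<noteq> 0" if "s \<in> {0..1}" for s
    using diffeo_cdet_nonzero[OF diffeo[OF that] dH] by (simp add: J_def)
  moreover have "J 0 = 1"
  proof -
    have "(\<lambda>w. F (0, w) 0) = (\<lambda>w. w)"
      by (rule has_derivative_unique[OF dH[of 0, unfolded H0 id_def] has_derivative_ident])
    then have "F (0, w) 0 = w" for w by (rule fun_cong)
    then show ?thesis by (simp add: J_def cdet_def)
  qed
  ultimately have "J 1 > 0"
  proof (intro linorder_not_le[THEN iffD1] notI)
    assume "continuous_on {0..1} J" "J 0 = 1" "J 1 \<le> 0"
    then have "\<exists>x. 0 \<le> x \<and> x \<le> 1 \<and> J x = 0" by (intro IVT2') simp_all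
    then show False using nz by auto
  qed
  moreover have "L = (\<lambda>w. F (0, w) 1)"
    by (rule has_derivative_unique[OF L dH])
  ultimately show ?thesis by (simp add: J_def)
qed

text \<open>Such a map is the lift of an orientation-preserving map of the circle of degree one. It
  commutes with integer translations, and injectivity turns this into the equivalence about integer
  differences.\<close>

lemma increasing_lift:
  assumes "smooth \<phi>" and phi: "\<And>t::real. deriv \<phi> t > (0::real) \<and> \<phi> (t + 1) = \<phi> t + 1"
  shows "strict_mono \<phi>" "surj \<phi>" "\<phi> s - \<phi> t \<in> \<int> \<longleftrightarrow> s - t \<in> \<int>"
proof -
  have d: "(\<phi> has_real_derivative deriv \<phi> t) (at t)" for t
    using smooth_differentiable[OF assms(1)] DERIV_deriv_iff_real_differentiable by blast
  show mono: "strict_mono \<phi>"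
  proof (rule strict_monoI)
    fix x y :: real assume "x < y"
    then show "\<phi> x < \<phi> y" by (rule DERIV_pos_imp_increasing) (use d phi in blast)
  qed
  have nat: "\<phi> (t + of_nat n) = \<phi> t + of_nat n" for t n
    by (induction n) (simp_all add: phi add.assoc[symmetric] add.commute[of 1])
  have int: "\<phi> (t + of_int n) = \<phi> t + of_int n" for t n
    using nat[of t "nat n"] nat[of "t + of_int n" "nat (- n)"] by (cases "n \<ge> 0") auto
  show "\<phi> s - \<phi> t \<in> \<int> \<longleftrightarrow> s - t \<in> \<int>"
  proof
    assume "\<phi> s - \<phi> t \<in> \<int>"
    then obtain n where "\<phi> s - \<phi> t = of_int n" by (elim Ints_cases)
    then have "\<phi> s = \<phi> (t + of_int n)" by (simp add: int)
    then have "s = t + of_int n" using mono by (simp add: strict_mono_eq)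
    then show "s - t \<in> \<int>" by simp
  next
    assume "s - t \<in> \<int>"
    then obtain n where "s - t = of_int n" by (elim Ints_cases)
    then have "\<phi> s = \<phi> t + of_int n" using int[of t n] by (simp add: algebra_simps)
    then show "\<phi> s - \<phi> t \<in> \<int>" by simp
  qed
  show "surj \<phi>"
    unfolding surj_def
  proof
    fix y
    \<comment> \<open>The values at the integers \<open>m\<close> and \<open>m + 1\<close> are
      \<open>\<phi> 0 + m\<close> and \<open>\<phi> 0 + m + 1\<close>, which enclose
      \<open>y\<close>.\<close>
    define m n where "m = \<lfloor>y - \<phi> 0\<rfloor>" and "n = m + 1"
    have "\<phi> (of_int m) = \<phi> 0 + of_int m" "\<phi> (of_int n) = \<phi> 0 + of_int n"
      using int[of 0 m] int[of 0 n] by simp_all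
    then have "\<phi> (of_int m) \<le> y" "y \<le> \<phi> (of_int n)" "of_int m \<le> (of_int n :: real)"
      unfolding m_def n_def by linarith+
    moreover have "continuous_on {of_int m..of_int n} \<phi>"
      using d by (intro continuous_at_imp_continuous_on) (auto intro: DERIV_isCont)
    ultimately show "\<exists>x. y = \<phi> x"
      using IVT'[of \<phi> "of_int m" y "of_int n"] by blast
  qed
qed

lemma planar_isotopic_relabels:
  assumes "planar_isotopic D D'"
  shows "\<exists>\<pi> \<phi>. relabels D D' \<pi> \<phi>"
proof -
  obtain H :: "real \<Rightarrow> complex \<Rightarrow> complex" and \<pi> :: "nat \<Rightarrow> nat" and \<phi> :: "nat \<Rightarrow> real \<Rightarrow> real"
    where diag: "diagram D" "diagram D'" and n: "ncomp D' = ncomp D"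
    and smooth: "smooth (\<lambda>(s, z). H s z)" and diffeo: "\<forall>s\<in>{0..1}. diffeo (H s)"
    and H0: "H 0 = id" and bij: "bij_betw \<pi> {..<ncomp D} {..<ncomp D}"
    and phi: "\<And>i. i < ncomp D \<Longrightarrow> smooth (\<phi> i) \<and> (\<forall>t. deriv (\<phi> i) t > 0 \<and> \<phi> i (t + 1) = \<phi> i t + 1) \<and>
           (\<forall>t. strand D' i t = H 1 (strand D (\<pi> i) (\<phi> i t)))"
    and kinds: "\<And>i t Q. meets D' (i, t) Q \<Longrightarrow> kind D' (i, t) = kind D (\<pi> i, \<phi> i t)"
    using assms unfolding planar_isotopic_def by blast
  let ?m = "move_passage \<pi> \<phi>"
  have lift: "strict_mono (\<phi> i)" "surj (\<phi> i)" "\<phi> i s - \<phi> i t \<in> \<int> \<longleftrightarrow> s - t \<in> \<int>" if "i < ncomp D" for i s t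
    using increasing_lift[of "\<phi> i"] phi[OF that] by blast+
  have pi: "\<pi> i < ncomp D" if "i < ncomp D" for i
    using bij that by (auto dest: bij_betwE)
  have injpi: "\<pi> i = \<pi> j \<longleftrightarrow> i = j" if "i < ncomp D" "j < ncomp D" for i j
    using bij that by (auto simp: bij_betw_def inj_on_def)
  have dif: "diffeo (H 1)" using diffeo by simp
  then have injH: "H 1 x = H 1 y \<longleftrightarrow> x = y" for x y
    by (auto simp: diffeo_def bij_def inj_eq)
  have pos: "pos D' P = H 1 (pos D (?m P))" if "P \<in> passages D'" for P
    using that n phi by (simp add: pos_def move_passage_def)
  have mP: "?m P \<in> passages D" if "P \<in> passages D'" for P
    using that n pi by (simp add: move_passage_def)
  have same: "same_passage (?m P) (?m Q) = same_passage P Q" if "P \<in> passages D'" "Q \<in> passages D'" for P Q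
    using that n injpi[of "fst P" "fst Q"] lift(3)[of "fst P"] by (auto simp: same_passage_def move_passage_def)
  have meets: "meets D' P Q = meets D (?m P) (?m Q)" if "P \<in> passages D'" "Q \<in> passages D'" for P Q
    unfolding meets_def pos[OF that(1)] pos[OF that(2)] same[OF that] injH using that mP by blast
  define L where "L z = frechet_derivative (H 1) (at z)" for z
  have L: "(H 1 has_derivative L z) (at z)" for z
    using dif smooth_differentiable frechet_derivative_works unfolding diffeo_def L_def by blast
  \<comment> \<open>The chain rule for the composition of reparametrization, strand and final map of
    the isotopy: a positive factor times the image under the derivative \<open>L\<close>.\<close>
  have dir: "dir D' P = deriv (\<phi> (fst P)) (snd P) *\<^sub>R L (pos D (?m P)) (dir D (?m P))"
    if "P \<in> passages D'" for P
  proof -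
    obtain i t where P: "P = (i, t)" by force
    have i: "i < ncomp D" using that P n by simp
    have "(\<phi> i has_vector_derivative deriv (\<phi> i) t) (at t)"
      using smooth_differentiable[of "\<phi> i"] phi[OF i]
      by (simp add: DERIV_deriv_iff_real_differentiable flip: has_real_derivative_iff_has_vector_derivative)
    from vector_diff_chain_at[OF this strand_has_dir[OF diag(1) pi[OF i]]]
    have "(strand D (\<pi> i) \<circ> \<phi> i has_vector_derivative deriv (\<phi> i) t *\<^sub>R dir D (?m P)) (at t)"
      by (simp add: P move_passage_def)
    from diff_chain_at[OF this[unfolded has_vector_derivative_def] L]
    have "(H 1 \<circ> (strand D (\<pi> i) \<circ> \<phi> i) has_derivative
        L (pos D (?m P)) \<circ> (\<lambda>x. x *\<^sub>R deriv (\<phi> i) t *\<^sub>R dir D (?m P))) (at t)"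
      by (simp add: P pos_def move_passage_def)
    moreover have "H 1 \<circ> (strand D (\<pi> i) \<circ> \<phi> i) = strand D' i"
      using phi[OF i] by auto
    moreover have "linear (L (pos D (?m P)))" using L by (rule has_derivative_linear)
    ultimately have "(strand D' i has_vector_derivative deriv (\<phi> i) t *\<^sub>R L (pos D (?m P)) (dir D (?m P))) (at t)"
      by (simp add: has_vector_derivative_def comp_def linear_scale)
    then show ?thesis by (simp add: dir_def P vector_derivative_at)
  qed
  \<comment> \<open>The two passages share their position, so the same linear map of positive
    determinant acts on both directions; the speeds contribute two further positive factors.\<close>
  have sgn: "sgn (cdet (dir D' P) (dir D' Q)) = sgn (cdet (dir D (?m P)) (dir D (?m Q)))"
    if "meets D' P Q" for P Q
  proof -
    have P: "P \<in> passages D'" and Q: "Q \<in> passages D'" using meets_passages[OF that] by blast+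
    have "pos D (?m P) = pos D (?m Q)"
      using that meets[OF P Q] by (simp add: meets_def)
    moreover have "deriv (\<phi> (fst P)) (snd P) > 0" "deriv (\<phi> (fst Q)) (snd Q) > 0"
      using P Q phi n by simp_all
    moreover have "cdet (L z 1) (L z \<i>) > 0" for z
      using isotopy_preserves_orientation[OF smooth _ H0 L] diffeo by blast
    ultimately show ?thesis
      using cdet_linear[OF has_derivative_linear[OF L], of "pos D (?m P)" "dir D (?m P)" "dir D (?m Q)"]
      by (simp add: dir[OF P] dir[OF Q] sgn_mult)
  qed
  have "relabels D D' \<pi> \<phi>"
    unfolding relabels_def
  proof (intro conjI ballI allI impI diag n bij lift)
    fix P Q assume "P \<in> passages D'" "Q \<in> passages D'"
    then show "meets D' P Q = meets D (?m P) (?m Q)" by (rule meets)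
    assume m: "meets D' P Q"
    then show "sgn (cdet (dir D' P) (dir D' Q)) = sgn (cdet (dir D (?m P)) (dir D (?m Q)))" by (rule sgn)
    show "kind D' P = kind D (?m P)" using kinds[of "fst P" "snd P" Q] m by (simp add: move_passage_def)
  qed
  then show ?thesis by blast
qed

section \<open>Changing a diagram inside the square\<close>

text \<open>
  A piece is followed in the direction of increasing \<open>u\<close>, whatever its orientation. Colors before
  and after a crossing in this direction are the incoming and outgoing colors in an order that
  depends on the sign of the third component of the piece.
\<close>

definition enter :: "piece \<Rightarrow> 'a \<Rightarrow> 'a \<Rightarrow> 'a" where
  "enter p x y = (if snd (snd p) > 0 then x else y)"

definition leave :: "piece \<Rightarrow> 'a \<Rightarrow> 'a \<Rightarrow> 'a" where
  "leave p x y = (if snd (snd p) > 0 then y else x)"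

lemma enter_leave [simp]:
  "enter p (enter p x y) (leave p x y) = x" "leave p (enter p x y) (leave p x y) = y"
  "enter p x x = x" "leave p x x = x"
  by (simp_all add: enter_def leave_def)

text \<open>
  Two parameters \<open>b1 < b2\<close> cut a piece into the segments 0, 1, 2. This is enough for all moves; a
  cut at a regular passage only forces the two adjacent segments to have the same color.
\<close>

definition seg_before :: "real \<Rightarrow> real \<Rightarrow> real \<Rightarrow> nat" where
  "seg_before b1 b2 u = (if u \<le> b1 then 0 else if u \<le> b2 then 1 else 2)"

definition seg_after :: "real \<Rightarrow> real \<Rightarrow> real \<Rightarrow> nat" where
  "seg_after b1 b2 u = (if u < b1 then 0 else if u < b2 then 1 else 2)"

lemma seg_less_3: "seg_before b1 b2 u < 3" "seg_after b1 b2 u < 3"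
  by (simp_all add: seg_before_def seg_after_def)

lemma same_passage_meets:
  assumes "diagram D" "meets D P Q" "same_passage Q Q'"
  shows "meets D P Q'"
proof -
  have Q: "Q \<in> passages D" using meets_passages[OF assms(2)] by blast
  then have "Q' \<in> passages D" using assms(3) by (simp add: same_passage_def)
  moreover have "pos D Q' = pos D Q" using same_passage_pos[OF assms(1,3) Q] by simp
  moreover have "\<not> same_passage P Q'"
    using assms same_passage_trans same_passage_sym unfolding meets_def by blast
  ultimately show ?thesis using assms(2) by (simp add: meets_def)
qed

lemma same_passage_dir:
  assumes "diagram D" "same_passage P Q" "P \<in> passages D"
  shows "dir D P = dir D Q"
proof -
  obtain i t u where [simp]: "P = (i, t)" "Q = (i, u)"
    using assms(2) by (cases P; cases Q) (auto simp: same_passage_def)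
  have i: "i < ncomp D" and k: "t - u \<in> \<int>" using assms by (simp_all add: same_passage_def)
  have "(strand D i \<circ> (\<lambda>s. s + (t - u)) has_vector_derivative 1 *\<^sub>R dir D (i, u + (t - u))) (at u)"
    by (rule vector_diff_chain_at[OF _ strand_has_dir[OF assms(1) i]]) (auto intro!: derivative_eq_intros)
  moreover have "strand D i \<circ> (\<lambda>s. s + (t - u)) = strand D i"
    using strand_add_int[OF assms(1) i k] by (auto simp: comp_def)
  ultimately have "(strand D i has_vector_derivative dir D P) (at u)" by simp
  then show ?thesis using strand_has_dir[OF assms(1) i, of u] vector_derivative_unique_at by fastforce
qed

lemma crossing_rule_same_passage:
  assumes diag: "diagram D" and P: "same_passage P P'" "P \<in> passages D" and Q: "same_passage Q Q'" "Q \<in> passages D"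
  shows "crossing_rule X star R1 R2 D P Q = crossing_rule X star R1 R2 D P' Q'"
proof -
  have P': "P' \<in> passages D" using P by (simp add: same_passage_def)
  have "kind D P = kind D P'" using diag P P' unfolding diagram_def by blast
  then show ?thesis
    unfolding crossing_rule_def fun_eq_iff using same_passage_dir[OF diag P] same_passage_dir[OF diag Q] by simp
qed

text \<open>\<open>c m k\<close> is the color of segment \<open>k\<close> of piece \<open>m\<close>;
  values outside these ranges are arbitrary. The second condition has content only at a break that
  is not a crossing, where it equates the adjacent segments.\<close>

definition local_coloring :: "'a set \<Rightarrow> ('a \<Rightarrow> 'a \<Rightarrow> 'a) \<Rightarrow> ('a \<Rightarrow> 'a \<Rightarrow> 'a) \<Rightarrow> ('a \<Rightarrow> 'a \<Rightarrow> 'a) \<Rightarrow>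
    sdiagram \<Rightarrow> piece list \<Rightarrow> (nat \<Rightarrow> real) \<Rightarrow> (nat \<Rightarrow> real) \<Rightarrow> (nat \<Rightarrow> nat \<Rightarrow> 'a) \<Rightarrow> bool" where
  "local_coloring X star R1 R2 D ps b1 b2 c \<longleftrightarrow>
     (\<forall>m<length ps. \<forall>k<3. c m k \<in> X) \<and>
     (\<forall>m<length ps. \<forall>u\<in>{-1..1}. regular D (along (ps ! m) u) \<longrightarrow>
        c m (seg_before (b1 m) (b2 m) u) = c m (seg_after (b1 m) (b2 m) u)) \<and>
     (\<forall>m<length ps. \<forall>n<length ps. \<forall>u\<in>{-1..1}. \<forall>v\<in>{-1..1}.
        meets D (along (ps ! m) u) (along (ps ! n) v) \<longrightarrow>
        crossing_rule X star R1 R2 D (along (ps ! m) u) (along (ps ! n) v)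
          (enter (ps ! m) (c m (seg_before (b1 m) (b2 m) u)) (c m (seg_after (b1 m) (b2 m) u)))
          (leave (ps ! m) (c m (seg_before (b1 m) (b2 m) u)) (c m (seg_after (b1 m) (b2 m) u)))
          (enter (ps ! n) (c n (seg_before (b1 n) (b2 n) v)) (c n (seg_after (b1 n) (b2 n) v)))
          (leave (ps ! n) (c n (seg_before (b1 n) (b2 n) v)) (c n (seg_after (b1 n) (b2 n) v))))"

text \<open>The breaks of a piece must include all its crossings, but a break need not be a
  crossing. They lie strictly inside, so that crossings stay away from the ends of the
  pieces.\<close>

locale square_part =
  fixes D :: sdiagram and ps :: "piece list" and cs :: "(real \<Rightarrow> complex) list" and b1 b2 :: "nat \<Rightarrow> real"
  assumes diag: "diagram D" and in_sq: "in_square D ps cs"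
    and curves_in_square: "\<And>m u. m < length ps \<Longrightarrow> u \<in> {-1..1} \<Longrightarrow> (cs ! m) u \<in> square"
    and breaks: "\<And>m. m < length ps \<Longrightarrow> -1 < b1 m \<and> b1 m < b2 m \<and> b2 m < 1"
    and meets_breaks: "\<And>m n u v. m < length ps \<Longrightarrow> n < length ps \<Longrightarrow> u \<in> {-1..1} \<Longrightarrow> v \<in> {-1..1} \<Longrightarrow>
      meets D (along (ps ! m) u) (along (ps ! n) v) \<Longrightarrow> u = b1 m \<or> u = b2 m"
begin

lemma along_passage: "m < length ps \<Longrightarrow> u \<in> {-1..1} \<Longrightarrow> along (ps ! m) u \<in> passages D"
  and along_pos: "m < length ps \<Longrightarrow> u \<in> {-1..1} \<Longrightarrow> pos D (along (ps ! m) u) = (cs ! m) u"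
  and along_inj: "m < length ps \<Longrightarrow> n < length ps \<Longrightarrow> u \<in> {-1..1} \<Longrightarrow> v \<in> {-1..1} \<Longrightarrow>
      same_passage (along (ps ! m) u) (along (ps ! n) v) \<Longrightarrow> m = n \<and> u = v"
  and square_along: "P \<in> passages D \<Longrightarrow> pos D P \<in> square \<Longrightarrow>
      \<exists>m<length ps. \<exists>u\<in>{-1..1}. same_passage P (along (ps ! m) u)"
  using in_sq unfolding in_square_def by blast+

lemma along_in_square:
  assumes "P \<in> passages D" "m < length ps" "u \<in> {-1..1}" "same_passage P (along (ps ! m) u)"
  shows "pos D P \<in> square"
  using same_passage_pos[OF diag assms(4,1)] along_pos[OF assms(2,3)] curves_in_square[OF assms(2,3)] by simp

lemma speed_nonzero: "m < length ps \<Longrightarrow> snd (snd (ps ! m)) \<noteq> 0"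
proof
  assume m: "m < length ps" and "snd (snd (ps ! m)) = 0"
  then have "along (ps ! m) 0 = along (ps ! m) 1" by (cases "ps ! m") simp
  then show False using along_inj[OF m m, of 0 1] by simp
qed

lemma meets_along:
  assumes "m < length ps" "u \<in> {-1..1}" "meets D (along (ps ! m) u) Q"
  obtains n v where "n < length ps" "v \<in> {-1..1}" "same_passage Q (along (ps ! n) v)"
    "meets D (along (ps ! m) u) (along (ps ! n) v)"
proof -
  have "Q \<in> passages D" using assms(3) meets_passages by blast
  moreover have "pos D Q \<in> square"
    using assms(3) along_pos[OF assms(1,2)] curves_in_square[OF assms(1,2)] by (simp add: meets_def)
  ultimately show thesis
    using square_along same_passage_meets[OF diag assms(3)] that by blast
qed

lemma regular_along:
  assumes "m < length ps" "u \<in> {-1..1}" "u \<noteq> b1 m" "u \<noteq> b2 m"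
  shows "regular D (along (ps ! m) u)"
  unfolding regular_iff_no_meets
proof (intro conjI allI notI)
  show "along (ps ! m) u \<in> passages D" by (rule along_passage[OF assms(1,2)])
  fix Q assume "meets D (along (ps ! m) u) Q"
  from meets_along[OF assms(1,2) this] meets_breaks[OF assms(1) _ assms(2)] assms(3,4)
  show False by metis
qed

context
  fixes X :: "'a set" and a b :: "nat \<times> real \<Rightarrow> 'a"
  assumes ab: "passage_colors D X a b"
begin

text \<open>The sampling parameters, the two ends and the midpoint between the breaks, lie in their
  segments and are never crossings, so the color before and the color after coincide there.\<close>

definition seg_color :: "nat \<Rightarrow> nat \<Rightarrow> 'a" where
  "seg_color m k = a (along (ps ! m) (if k = 0 then -1 else if k = 1 then (b1 m + b2 m) / 2 else 1))"

lemma along_colors_eq: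
  assumes m: "m < length ps" and u: "u \<in> {-1..1}" "u \<noteq> b1 m" "u \<noteq> b2 m"
  shows "enter (ps ! m) (a (along (ps ! m) u)) (b (along (ps ! m) u)) = a (along (ps ! m) u)"
    "leave (ps ! m) (a (along (ps ! m) u)) (b (along (ps ! m) u)) = a (along (ps ! m) u)"
  using passage_colorsD(5)[OF ab along_passage[OF m u(1)] regular_along[OF assms]]
  by (simp_all add: enter_def leave_def)

text \<open>Carries constancy between crossings over from the parameter of the component to
  \<open>u\<close>. A negative speed exchanges the ends of the interval, and it exchanges
  \<open>enter\<close> and \<open>leave\<close> accordingly.\<close>

lemma along_colors_const:
  assumes m: "m < length ps" and xy: "-1 \<le> x" "x < y" "y \<le> 1"
    and nb: "b1 m \<notin> {x<..<y}" "b2 m \<notin> {x<..<y}"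
  shows "leave (ps ! m) (a (along (ps ! m) x)) (b (along (ps ! m) x)) =
    enter (ps ! m) (a (along (ps ! m) y)) (b (along (ps ! m) y))"
proof -
  obtain i t l where p: "ps ! m = (i, t, l)" using prod_cases3 by blast
  have i: "i < ncomp D" using along_passage[OF m, of 0] p by simp
  have l: "l \<noteq> 0" using speed_nonzero[OF m] p by simp
  have reg: "regular D (i, t + l * u)" if "x < u" "u < y" for u
  proof -
    have "u \<in> {-1..1}" "u \<noteq> b1 m" "u \<noteq> b2 m" using that xy nb by auto
    from regular_along[OF m this] show ?thesis using p by simp
  qed
  show ?thesis
  proof (cases "l > 0")
    case True
    have "regular D (i, s)" if "t + l * x < s" "s < t + l * y" for s
    proof -
      have "x < (s - t) / l" "(s - t) / l < y" using that True by (simp_all add: field_simps)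
      from reg[OF this] show ?thesis using l by simp
    qed
    note * = passage_colors_const[OF diag ab i this]
    have "t + l * x < t + l * ((x + y) / 2)" "t + l * ((x + y) / 2) < t + l * y"
      using True xy by auto
    from *(1)[OF _ _ this] *(2)[OF _ _ this] show ?thesis
      using True by (simp add: p enter_def leave_def)
  next
    case False
    then have neg: "l < 0" using l by simp
    have "regular D (i, s)" if "t + l * y < s" "s < t + l * x" for s
    proof -
      have "x < (s - t) / l" "(s - t) / l < y" using that neg by (simp_all add: field_simps)
      from reg[OF this] show ?thesis using l by simp
    qed
    note * = passage_colors_const[OF diag ab i this]
    have "t + l * y < t + l * ((x + y) / 2)" "t + l * ((x + y) / 2) < t + l * x"
      using neg xy by (auto simp: mult_less_cancel_left)
    from *(1)[OF _ _ this] *(2)[OF _ _ this] show ?thesis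
      using False by (simp add: p enter_def leave_def)
  qed
qed

text \<open>Between consecutive points among the ends and the breaks the color is constant, hence
  equal to the sampled one. Only at a break can the colors before and after \<open>u\<close> differ,
  which is why the two segment functions differ exactly there.\<close>

lemma along_colors:
  assumes m: "m < length ps" and u: "u \<in> {-1..1}"
  shows "enter (ps ! m) (a (along (ps ! m) u)) (b (along (ps ! m) u)) = seg_color m (seg_before (b1 m) (b2 m) u)"
    "leave (ps ! m) (a (along (ps ! m) u)) (b (along (ps ! m) u)) = seg_color m (seg_after (b1 m) (b2 m) u)"
proof -
  define L where "L u = enter (ps ! m) (a (along (ps ! m) u)) (b (along (ps ! m) u))" for u
  define H where "H u = leave (ps ! m) (a (along (ps ! m) u)) (b (along (ps ! m) u))" for u
  define w where "w = (b1 m + b2 m) / 2"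
  note b = breaks[OF m]
  have w: "b1 m < w" "w < b2 m" using b by (auto simp: w_def)
  have LH: "L u = H u" "L u = a (along (ps ! m) u)" if "u \<in> {-1..1}" "u \<noteq> b1 m" "u \<noteq> b2 m" for u
    using along_colors_eq[OF m that] by (simp_all add: L_def H_def)
  have HL: "H x = L y" if "-1 \<le> x" "x < y" "y \<le> 1" "b1 m \<notin> {x<..<y}" "b2 m \<notin> {x<..<y}" for x y
    using along_colors_const[OF m that] by (simp add: L_def H_def)
  have c: "seg_color m 0 = L (-1)" "seg_color m 1 = L w" "seg_color m 2 = L 1" "seg_color m (Suc 0) = L w"
    using LH(2)[of "-1"] LH(2)[of w] LH(2)[of 1] b w by (simp_all add: seg_color_def w_def)
  have H0: "H (-1) = L (-1)" and Hw: "H w = L w" using LH(1)[of "-1"] LH(1)[of w] b w by auto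
  have Hb1: "H (b1 m) = L w" using HL[of "b1 m" w] b w by simp
  have Hb2: "H (b2 m) = L 1" using HL[of "b2 m" 1] b w by simp
  have "L u = seg_color m (seg_before (b1 m) (b2 m) u) \<and> H u = seg_color m (seg_after (b1 m) (b2 m) u)"
  proof -
    consider "u = -1" | "-1 < u" "u < b1 m" | "u = b1 m" | "b1 m < u" "u < b2 m" | "u = b2 m" | "b2 m < u"
      using u by fastforce
    then show ?thesis
    proof cases
      case 1 then show ?thesis using b H0 by (simp add: c seg_before_def seg_after_def)
    next
      case 2 then show ?thesis using b H0 HL[of "-1" u] LH(1)[of u]
        by (simp add: c seg_before_def seg_after_def)
    next
      case 3 then show ?thesis using b H0 HL[of "-1" u] Hb1
        by (simp add: c seg_before_def seg_after_def)
    next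
      case 4 then show ?thesis using b HL[of "b1 m" u] LH(1)[of u] Hb1
        by (simp add: c seg_before_def seg_after_def)
    next
      case 5 then show ?thesis using b HL[of "b1 m" u] Hb1 Hb2
        by (simp add: c seg_before_def seg_after_def)
    next
      case 6 then show ?thesis using u b HL[of "b2 m" u] LH(1)[of u] Hb2
        by (simp add: c seg_before_def seg_after_def)
    qed
  qed
  then show "enter (ps ! m) (a (along (ps ! m) u)) (b (along (ps ! m) u)) = seg_color m (seg_before (b1 m) (b2 m) u)"
    "leave (ps ! m) (a (along (ps ! m) u)) (b (along (ps ! m) u)) = seg_color m (seg_after (b1 m) (b2 m) u)"
    by (simp_all add: L_def H_def)
qed

lemma seg_color_in: "m < length ps \<Longrightarrow> seg_color m k \<in> X"
  using passage_colorsD(1)[OF ab along_passage] breaks[of m] by (auto simp: seg_color_def)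

lemma seg_color_local_coloring:
  assumes "\<And>P Q. meets D P Q \<Longrightarrow> crossing_rule X star R1 R2 D P Q (a P) (b P) (a Q) (b Q)"
  shows "local_coloring X star R1 R2 D ps b1 b2 seg_color"
  unfolding local_coloring_def
proof (intro conjI allI ballI impI)
  fix m k assume "m < length ps"
  then show "seg_color m k \<in> X" by (rule seg_color_in)
next
  fix m and u :: real assume "m < length ps" "u \<in> {-1..1}" "regular D (along (ps ! m) u)"
  then show "seg_color m (seg_before (b1 m) (b2 m) u) = seg_color m (seg_after (b1 m) (b2 m) u)"
    using along_colors[of m u] passage_colorsD(5)[OF ab along_passage, of m u] by simp
next
  fix m n and u v :: real
  assume "m < length ps" "n < length ps" "u \<in> {-1..1}" "v \<in> {-1..1}"
    "meets D (along (ps ! m) u) (along (ps ! n) v)"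
  then show "crossing_rule X star R1 R2 D (along (ps ! m) u) (along (ps ! n) v)
          (enter (ps ! m) (seg_color m (seg_before (b1 m) (b2 m) u)) (seg_color m (seg_after (b1 m) (b2 m) u)))
          (leave (ps ! m) (seg_color m (seg_before (b1 m) (b2 m) u)) (seg_color m (seg_after (b1 m) (b2 m) u)))
          (enter (ps ! n) (seg_color n (seg_before (b1 n) (b2 n) v)) (seg_color n (seg_after (b1 n) (b2 n) v)))
          (leave (ps ! n) (seg_color n (seg_before (b1 n) (b2 n) v)) (seg_color n (seg_after (b1 n) (b2 n) v)))"
    unfolding along_colors[symmetric] using assms by (simp flip: along_colors)
qed

end

end

text \<open>For each piece these parameters are the sum of a compact interval and the closed set
  \<open>\<int>\<close>. Closedness is what keeps the cores of the pieces away from a neighborhood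
  of any parameter that is not in them.\<close>

lemma closed_core:
  "closed {s. \<exists>m<length ps. \<exists>u\<in>{-\<beta>..\<beta>}. same_passage (i, s) (along (ps ! m) u)}" (is "closed ?K")
proof -
  let ?A = "\<lambda>m. {x + y | x y. x \<in> (\<lambda>u. fst (snd (ps ! m)) + snd (snd (ps ! m)) * u) ` {-\<beta>..\<beta>} \<and> y \<in> \<int>}"
  have eq: "?K = (\<Union>m\<in>{m. m < length ps \<and> fst (ps ! m) = i}. ?A m)" (is "_ = ?U")
  proof
    show "?K \<subseteq> ?U"
    proof
      fix s assume "s \<in> ?K"
      then obtain m u where m: "m < length ps" "u \<in> {-\<beta>..\<beta>}" "same_passage (i, s) (along (ps ! m) u)" by blast
      obtain c t l where p: "ps ! m = (c, t, l)" using prod_cases3 by blast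
      have "i = c" "s - (t + l * u) \<in> \<int>" using m(3) p by (simp_all add: same_passage_def)
      moreover from this have "s = (t + l * u) + (s - (t + l * u))" by simp
      ultimately have "s \<in> ?A m" using m(2) p by fastforce
      moreover have "m \<in> {m. m < length ps \<and> fst (ps ! m) = i}" using m(1) p \<open>i = c\<close> by simp
      ultimately show "s \<in> ?U" by (rule UN_I[rotated])
    qed
    show "?U \<subseteq> ?K"
    proof
      fix s assume "s \<in> ?U"
      then obtain m u y where m: "m < length ps" "fst (ps ! m) = i" "u \<in> {-\<beta>..\<beta>}" "y \<in> \<int>"
        "s = fst (snd (ps ! m)) + snd (snd (ps ! m)) * u + y" by blast
      then have "same_passage (i, s) (along (ps ! m) u)" by (cases "ps ! m") (simp add: same_passage_def)
      then show "s \<in> ?K" using m by blast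
    qed
  qed
  have "closed (?A m)" for m
  proof -
    have "compact ((\<lambda>u. fst (snd (ps ! m)) + snd (snd (ps ! m)) * u) ` {-\<beta>..\<beta>})"
      by (intro compact_continuous_image continuous_intros) auto
    from compact_closed_sums[OF this closed_Ints] show ?thesis
      by (rule back_subst[of closed]) blast
  qed
  then show ?thesis unfolding eq by (intro closed_UN ballI) simp_all
qed

lemma eventually_seg:
  fixes u0 :: real
  shows "\<exists>d>0. (\<forall>u. u0 - d < u \<and> u < u0 \<longrightarrow> seg_before b1 b2 u = seg_before b1 b2 u0 \<and> seg_after b1 b2 u = seg_before b1 b2 u0) \<and>
    (\<forall>u. u0 < u \<and> u < u0 + d \<longrightarrow> seg_before b1 b2 u = seg_after b1 b2 u0 \<and> seg_after b1 b2 u = seg_after b1 b2 u0)"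
proof -
  \<comment> \<open>The distance to the break. If \<open>u0\<close> is the break itself, any radius
    will do, since each side of \<open>u0\<close> lies on one side of this break.\<close>
  define d1 where "d1 = (if u0 = b1 then 1 else \<bar>u0 - b1\<bar>)"
  define d2 where "d2 = (if u0 = b2 then 1 else \<bar>u0 - b2\<bar>)"
  have "d1 > 0" "d2 > 0" by (auto simp: d1_def d2_def)
  moreover have "seg_before b1 b2 u = seg_before b1 b2 u0 \<and> seg_after b1 b2 u = seg_before b1 b2 u0"
    if "u0 - min d1 d2 < u" "u < u0" for u
    using that by (auto simp: seg_before_def seg_after_def d1_def d2_def split: if_splits)
  moreover have "seg_before b1 b2 u = seg_after b1 b2 u0 \<and> seg_after b1 b2 u = seg_after b1 b2 u0"
    if "u0 < u" "u < u0 + min d1 d2" for u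
    using that by (auto simp: seg_before_def seg_after_def d1_def d2_def split: if_splits)
  ultimately show ?thesis by (intro exI[of _ "min d1 d2"]) auto
qed

section \<open>Gluing colors inside and outside the square\<close>

locale square_change =
  old: square_part D ps cs b1 b2 + new: square_part D' ps cs' b1' b2'
  for D D' ps cs cs' b1 b2 b1' b2' +
  assumes ncomp: "ncomp D' = ncomp D"
    and same_outside: "\<And>P. P \<in> passages D \<Longrightarrow> pos D P \<notin> square \<Longrightarrow> pos D' P = pos D P \<and> kind D' P = kind D P"
begin

lemma passages_eq: "passages D' = passages D"
  by (simp add: passages_def ncomp)

text \<open>Both memberships mean lying on one of the pieces, and these are given by the same
  parameters in both diagrams.\<close>

lemma in_square_iff:
  assumes "P \<in> passages D" shows "pos D' P \<in> square \<longleftrightarrow> pos D P \<in> square"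
proof -
  have P': "P \<in> passages D'" using assms passages_eq by simp
  have "pos D' P \<in> square \<longleftrightarrow> (\<exists>m<length ps. \<exists>u\<in>{-1..1}. same_passage P (along (ps ! m) u))"
    using new.square_along[OF P'] new.along_in_square[OF P'] by blast
  moreover have "pos D P \<in> square \<longleftrightarrow> (\<exists>m<length ps. \<exists>u\<in>{-1..1}. same_passage P (along (ps ! m) u))"
    using old.square_along[OF assms] old.along_in_square[OF assms] by blast
  ultimately show ?thesis by simp
qed

lemma square_change_sym: "square_change D' D ps cs' cs b1' b2' b1 b2"
  by unfold_locales (use ncomp same_outside in_square_iff passages_eq in auto)

text \<open>The ends are left out: they are regular in both diagrams and count as outside, so that
  restriction to the outside still shows the colors on the boundary of the square.\<close>

definition in_piece :: "nat \<times> real \<Rightarrow> nat \<Rightarrow> real \<Rightarrow> bool" where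
  "in_piece P m u \<longleftrightarrow> m < length ps \<and> u \<in> {-1<..<1} \<and> same_passage P (along (ps ! m) u)"

lemma in_piece_unique:
  assumes "in_piece P m u" "in_piece P n v"
  shows "m = n \<and> u = v"
proof (rule old.along_inj)
  show "same_passage (along (ps ! m) u) (along (ps ! n) v)"
    using assms same_passage_trans same_passage_sym unfolding in_piece_def by blast
qed (use assms in \<open>auto simp: in_piece_def\<close>)

text \<open>The square is closed, so the strands of the two diagrams agree in a whole neighborhood
  of a passage outside it and have the same derivative.\<close>

lemma dir_outside:
  assumes "P \<in> passages D" "pos D P \<notin> square"
  shows "dir D' P = dir D P"
proof -
  obtain i t where P: "P = (i, t)" by force
  have i: "i < ncomp D" using assms P by simp
  have "closed square"
  proof -
    have eq: "square = {z. \<bar>Re z\<bar> \<le> 1} \<inter> {z. \<bar>Im z\<bar> \<le> 1}" by (auto simp: square_def)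
    show ?thesis unfolding eq by (intro closed_Int closed_Collect_le continuous_intros)
  qed
  then have "open (strand D i -` (- square))"
    by (intro open_vimage strand_continuous[OF old.diag i]) auto
  moreover have "t \<in> strand D i -` (- square)" using assms P by (simp add: pos_def)
  moreover have "strand D i s = strand D' i s" if "s \<in> strand D i -` (- square)" for s
    using same_outside[of "(i, s)"] that i by (simp add: pos_def)
  ultimately have "(strand D' i has_vector_derivative dir D (i, t)) (at t)"
    by (intro has_vector_derivative_transform_within_open[OF strand_has_dir[OF old.diag i]])
  then show ?thesis by (simp add: P dir_def vector_derivative_at)
qed

text \<open>The colors \<open>c\<close> are used on the pieces and the old ones elsewhere. All
  conditions are local, so the only places where the two definitions have to fit together are the
  ends of the pieces, and there \<open>agree\<close> identifies the first and last segments.\<close>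

lemma coloring_extension:
  assumes ab: "passage_colors D X a b"
    and rule: "\<And>P Q. meets D P Q \<Longrightarrow> crossing_rule X star R1 R2 D P Q (a P) (b P) (a Q) (b Q)"
    and loc: "local_coloring X star R1 R2 D' ps b1' b2' c"
    and agree: "\<And>m. m < length ps \<Longrightarrow> c m 0 = old.seg_color a m 0 \<and> c m 2 = old.seg_color a m 2"
  shows "\<exists>a' b'. passage_colors D' X a' b' \<and>
    (\<forall>P Q. meets D' P Q \<longrightarrow> crossing_rule X star R1 R2 D' P Q (a' P) (b' P) (a' Q) (b' Q)) \<and>
    (\<forall>P. (\<nexists>m u. in_piece P m u) \<longrightarrow> a' P = a P)"
proof -
  let ?B = "\<lambda>m u. c m (seg_before (b1' m) (b2' m) u)" and ?A = "\<lambda>m u. c m (seg_after (b1' m) (b2' m) u)"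
  \<comment> \<open>The choice is harmless, since a passage lies on at most one piece and at one
    parameter of it.\<close>
  define pm where "pm P = (SOME mu. in_piece P (fst mu) (snd mu))" for P
  define a' where "a' P = (if \<exists>m u. in_piece P m u then
    enter (ps ! fst (pm P)) (?B (fst (pm P)) (snd (pm P))) (?A (fst (pm P)) (snd (pm P))) else a P)" for P
  define b' where "b' P = (if \<exists>m u. in_piece P m u then
    leave (ps ! fst (pm P)) (?B (fst (pm P)) (snd (pm P))) (?A (fst (pm P)) (snd (pm P))) else b P)" for P
  have outside: "a' P = a P" "b' P = b P" if "\<nexists>m u. in_piece P m u" for P
    using that by (simp_all add: a'_def b'_def)
  have inside: "a' P = enter (ps ! m) (?B m u) (?A m u)" "b' P = leave (ps ! m) (?B m u) (?A m u)"
    if "in_piece P m u" for P m u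
  proof -
    have "in_piece P (fst (pm P)) (snd (pm P))"
      unfolding pm_def by (rule someI[of _ "(m, u)"]) (simp add: that)
    from in_piece_unique[OF this that] have "fst (pm P) = m" "snd (pm P) = u" by blast+
    then show "a' P = enter (ps ! m) (?B m u) (?A m u)" "b' P = leave (ps ! m) (?B m u) (?A m u)"
      using that unfolding a'_def b'_def by metis+
  qed
  \<comment> \<open>Beyond \<open>\<beta>\<close> the new colors agree with the old ones, so nothing has to be checked at the ends of the pieces.\<close>
  define \<beta> where "\<beta> = Max (insert 0 (\<Union>m<length ps. {\<bar>b1 m\<bar>, \<bar>b2 m\<bar>, \<bar>b1' m\<bar>, \<bar>b2' m\<bar>}))"
  have "\<beta> < 1"
    unfolding \<beta>_def using old.breaks new.breaks by (subst Max_less_iff) (auto simp: abs_less_iff, fastforce+)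
  have beta: "\<bar>b1 m\<bar> \<le> \<beta>" "\<bar>b2 m\<bar> \<le> \<beta>" "\<bar>b1' m\<bar> \<le> \<beta>" "\<bar>b2' m\<bar> \<le> \<beta>" if "m < length ps" for m
    unfolding \<beta>_def using that by (auto intro!: Max_ge)
  have collar: "a' P = a P" if "in_piece P m u" "\<bar>u\<bar> > \<beta>" "P \<in> passages D" for P m u
  proof -
    have m: "m < length ps" and u: "u \<in> {-1..1}" and same: "same_passage P (along (ps ! m) u)"
      using that by (auto simp: in_piece_def)
    have *: "(seg_before (b1 m) (b2 m) u = seg_before (b1' m) (b2' m) u \<and>
        seg_after (b1 m) (b2 m) u = seg_after (b1' m) (b2' m) u) \<and>
        seg_before (b1' m) (b2' m) u = seg_after (b1' m) (b2' m) u \<and> seg_before (b1' m) (b2' m) u \<in> {0, 2}"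
      using beta[OF m] that(2) old.breaks[OF m] new.breaks[OF m] by (auto simp: seg_before_def seg_after_def)
    then have "c m (seg_before (b1' m) (b2' m) u) = old.seg_color a m (seg_before (b1' m) (b2' m) u)"
      using agree[OF m] by auto
    moreover have "a (along (ps ! m) u) = enter (ps ! m) (old.seg_color a m (seg_before (b1 m) (b2 m) u))
        (old.seg_color a m (seg_after (b1 m) (b2 m) u))"
      using old.along_colors[OF ab m u] by (metis enter_leave(1))
    moreover have "a P = a (along (ps ! m) u)" by (rule passage_colorsD(3)[OF ab that(3) same])
    ultimately show ?thesis using inside(1)[OF that(1)] * by simp
  qed
  have cX: "c m k \<in> X" if "m < length ps" "k < 3" for m k
    using loc that unfolding local_coloring_def by blast
  have "passage_colors D' X a' b'"
    unfolding passage_colors_def passages_eq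
  proof (intro conjI ballI allI impI)
    fix P assume P: "P \<in> passages D"
    have "a' P \<in> X \<and> b' P \<in> X"
    proof (cases "\<exists>m u. in_piece P m u")
      case True
      then obtain m u where *: "in_piece P m u" by blast
      then have "m < length ps" by (simp add: in_piece_def)
      then show ?thesis unfolding inside[OF *] enter_def leave_def by (simp add: cX seg_less_3)
    next
      case False
      then show ?thesis using outside[of P] passage_colorsD(1,2)[OF ab P] by simp
    qed
    then show "a' P \<in> X" "b' P \<in> X" by blast+
  next
    fix P Q assume P: "P \<in> passages D" and PQ: "same_passage P Q"
    have iff: "in_piece P m u \<longleftrightarrow> in_piece Q m u" for m u
      using PQ same_passage_sym same_passage_trans unfolding in_piece_def by blast
    have "a' P = a' Q \<and> b' P = b' Q"
    proof (cases "\<exists>m u. in_piece P m u")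
      case True
      then obtain m u where "in_piece P m u" "in_piece Q m u" using iff by blast
      then show ?thesis using inside[of P m u] inside[of Q m u] by simp
    next
      case False
      then show ?thesis using outside[of P] outside[of Q] iff passage_colorsD(3,4)[OF ab P PQ] by simp
    qed
    then show "a' P = a' Q" "b' P = b' Q" by blast+
  next
    fix P assume reg: "regular D' P"
    then have P: "P \<in> passages D'" by (simp add: regular_def)
    show "a' P = b' P"
    proof (cases "\<exists>m u. in_piece P m u")
      case True
      then obtain m u where *: "in_piece P m u" by blast
      then have m: "m < length ps" "u \<in> {-1..1}" and same: "same_passage P (along (ps ! m) u)"
        by (auto simp: in_piece_def)
      have "regular D' (along (ps ! m) u)" by (rule same_passage_regular[OF new.diag same reg])
      then have "?B m u = ?A m u" using loc m unfolding local_coloring_def by blast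
      then show ?thesis unfolding inside[OF *] by simp
    next
      case False
      \<comment> \<open>Either \<open>P\<close> is an end of a piece, which is never a crossing, or
        it lies outside the square; there a passage meeting it in \<open>D\<close> lies outside too
        and meets it also in \<open>D'\<close>.\<close>
      have "regular D P"
      proof (cases "pos D P \<in> square")
        case True
        then obtain m u where m: "m < length ps" "u \<in> {-1..1}" and same: "same_passage P (along (ps ! m) u)"
          using old.square_along P passages_eq by blast
        have "u \<notin> {-1<..<1}" using False m same by (auto simp: in_piece_def)
        then have "u \<noteq> b1 m" "u \<noteq> b2 m" using old.breaks[OF m(1)] by auto
        from same_passage_regular[OF old.diag same_passage_sym[OF same] old.regular_along[OF m this]]
        show ?thesis .
      next
        case False
        have "\<not> meets D P Q" for Q
        proof
          assume PQ: "meets D P Q"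
          then have Q: "Q \<in> passages D" and Qs: "pos D Q \<notin> square"
            using False meets_passages[OF PQ] by (auto simp: meets_def)
          have "meets D' P Q"
            using PQ same_outside[OF _ False] same_outside[OF Q Qs] unfolding meets_def passages_eq by simp
          then show False using reg unfolding regular_iff_no_meets by blast
        qed
        then show ?thesis using P passages_eq unfolding regular_iff_no_meets by blast
      qed
      then show ?thesis using outside[OF False] passage_colorsD(5)[OF ab] P passages_eq by simp
    qed
  next
    fix i t assume i: "i < ncomp D'"
    then have i': "i < ncomp D" by (simp add: ncomp)
    let ?K = "{s. \<exists>m<length ps. \<exists>u\<in>{-\<beta>..\<beta>}. same_passage (i, s) (along (ps ! m) u)}"
    have "(\<forall>\<^sub>F s in at_left t. a' (i, s) = a' (i, t)) \<and> (\<forall>\<^sub>F s in at_right t. a' (i, s) = b' (i, t))"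
    proof (cases "\<exists>m u. in_piece (i, t) m u")
      case True
      then obtain m u0 where mu: "in_piece (i, t) m u0" by blast
      obtain i2 x l where p: "ps ! m = (i2, x, l)" using prod_cases3 by blast
      have m: "m < length ps" and u0: "-1 < u0" "u0 < 1" and k: "t - (x + l * u0) \<in> \<int>" and [simp]: "i2 = i"
        using mu p by (auto simp: in_piece_def same_passage_def)
      have l: "l \<noteq> 0" using old.speed_nonzero[OF m] p by simp
      \<comment> \<open>The parameter on the piece that belongs to the parameter \<open>s\<close> of
        the component: the affine continuation of the value \<open>u0\<close> at
        \<open>t\<close>.\<close>
      define f where "f s = u0 + (s - t) / l" for s
      have fp: "in_piece (i, s) m (f s)" if "-1 < f s" "f s < 1" for s
      proof -
        have "l * f s = l * u0 + (s - t)" using l by (simp add: f_def distrib_left)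
        then have eq: "s - (x + l * f s) = t - (x + l * u0)" by simp
        have "s - (x + l * f s) \<in> \<int>" unfolding eq by (rule k)
        then show ?thesis using that m by (simp add: in_piece_def p same_passage_def)
      qed
      obtain d0 where d0: "d0 > 0"
        "\<And>u. u0 - d0 < u \<Longrightarrow> u < u0 \<Longrightarrow> ?B m u = ?B m u0 \<and> ?A m u = ?B m u0"
        "\<And>u. u0 < u \<Longrightarrow> u < u0 + d0 \<Longrightarrow> ?B m u = ?A m u0 \<and> ?A m u = ?A m u0"
        using eventually_seg[of u0 "b1' m" "b2' m"] by metis
      define d where "d = min d0 (min (u0 + 1) (1 - u0))"
      have d: "d > 0" "d \<le> d0" "d \<le> u0 + 1" "d \<le> 1 - u0" using d0(1) u0 by (auto simp: d_def)
      have below: "a' (i, s) = ?B m u0" if "u0 - d < f s" "f s < u0" for s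
      proof -
        have "-1 < f s" "f s < 1" using that d u0 by linarith+
        from inside(1)[OF fp[OF this]] d0(2)[of "f s"] that d show ?thesis by simp
      qed
      have above: "a' (i, s) = ?A m u0" if "u0 < f s" "f s < u0 + d" for s
      proof -
        have "-1 < f s" "f s < 1" using that d u0 by linarith+
        from inside(1)[OF fp[OF this]] d0(3)[of "f s"] that d show ?thesis by simp
      qed
      show ?thesis
      proof (cases "l > 0")
        case True
        have "a' (i, t) = ?B m u0" "b' (i, t) = ?A m u0"
          using inside[OF mu] True by (simp_all add: p enter_def leave_def)
        moreover have "a' (i, s) = ?B m u0" if "t - d * l < s" "s < t" for s
          by (rule below) (use that True in \<open>simp_all add: f_def field_simps\<close>)
        moreover have "a' (i, s) = ?A m u0" if "t < s" "s < t + d * l" for s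
          by (rule above) (use that True in \<open>simp_all add: f_def field_simps\<close>)
        moreover have "t - d * l < t" "t < t + d * l" using True d by simp_all
        ultimately show ?thesis unfolding eventually_at_left_field eventually_at_right_field by metis
      next
        case False
        then have neg: "l < 0" using l by simp
        have "a' (i, t) = ?A m u0" "b' (i, t) = ?B m u0"
          using inside[OF mu] False by (simp_all add: p enter_def leave_def)
        moreover have "a' (i, s) = ?A m u0" if "t + d * l < s" "s < t" for s
          by (rule above) (use that neg in \<open>simp_all add: f_def field_simps\<close>)
        moreover have "a' (i, s) = ?B m u0" if "t < s" "s < t - d * l" for s
          by (rule below) (use that neg in \<open>simp_all add: f_def field_simps\<close>)
        moreover have "t + d * l < t" "t < t - d * l" using neg d by (simp_all add: mult_pos_neg)
        ultimately show ?thesis unfolding eventually_at_left_field eventually_at_right_field by metis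
      qed
    next
      case False
      \<comment> \<open>Near \<open>t\<close> the new colors are the old ones: parameters close to
        \<open>t\<close> avoid the closed cores, and on the collars that remain of the pieces
        \<open>a'\<close> equals \<open>a\<close>.\<close>
      have "t \<notin> ?K"
      proof
        assume "t \<in> ?K"
        then obtain m u where "m < length ps" "u \<in> {-\<beta>..\<beta>}" "same_passage (i, t) (along (ps ! m) u)" by blast
        then have "in_piece (i, t) m u" using \<open>\<beta> < 1\<close> by (auto simp: in_piece_def)
        then show False using False by blast
      qed
      moreover have "open (- ?K)" using closed_core[of ps \<beta> i] by (simp add: open_Compl)
      ultimately have ev: "\<forall>\<^sub>F s in at t. s \<in> - ?K"
        by (intro topological_tendstoD[OF tendsto_ident_at]) simp_all
      have "\<forall>\<^sub>F s in at t. a' (i, s) = a (i, s)"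
      proof (rule eventually_mono[OF ev])
        fix s assume s: "s \<in> - ?K"
        show "a' (i, s) = a (i, s)"
        proof (cases "\<exists>m u. in_piece (i, s) m u")
          case True
          then obtain m u where mu: "in_piece (i, s) m u" by blast
          then have "\<bar>u\<bar> > \<beta>" using s unfolding in_piece_def by fastforce
          then show ?thesis using collar[OF mu] i' by simp
        next
          case False
          then show ?thesis by (rule outside)
        qed
      qed
      then have "\<forall>\<^sub>F s in at_left t. a' (i, s) = a (i, s)" "\<forall>\<^sub>F s in at_right t. a' (i, s) = a (i, s)"
        unfolding eventually_at_split by blast+
      from eventually_conj[OF this(1) passage_colors_near(1)[OF ab i']]
        eventually_conj[OF this(2) passage_colors_near(2)[OF ab i']]
      show ?thesis unfolding outside[OF False]
        by (auto elim: eventually_mono)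
    qed
    then show "\<forall>\<^sub>F s in at_left t. a' (i, s) = a' (i, t)" "\<forall>\<^sub>F s in at_right t. a' (i, s) = b' (i, t)"
      by blast+
  qed
  \<comment> \<open>The two passages of a crossing share their position, so both lie inside the
    square or both outside. Inside, the rule is part of \<open>loc\<close>; outside, it is the old
    rule with the same kinds and directions.\<close>
  moreover have "crossing_rule X star R1 R2 D' P Q (a' P) (b' P) (a' Q) (b' Q)" if PQ: "meets D' P Q" for P Q
  proof -
    have P: "P \<in> passages D'" and Q: "Q \<in> passages D'" using meets_passages[OF PQ] by blast+
    show ?thesis
    proof (cases "pos D' P \<in> square")
      case True
      then obtain m u where m: "m < length ps" "u \<in> {-1..1}" and sP: "same_passage P (along (ps ! m) u)"
        using new.square_along[OF P] by blast
      have "pos D' Q \<in> square" using True PQ by (simp add: meets_def)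
      then obtain n v where n: "n < length ps" "v \<in> {-1..1}" and sQ: "same_passage Q (along (ps ! n) v)"
        using new.square_along[OF Q] by blast
      have al: "meets D' (along (ps ! m) u) (along (ps ! n) v)"
        using same_passage_meets[OF new.diag] meets_sym PQ sP sQ by blast
      have "u = b1' m \<or> u = b2' m" "v = b1' n \<or> v = b2' n"
        using new.meets_breaks[OF m(1) n(1) m(2) n(2) al] new.meets_breaks[OF n(1) m(1) n(2) m(2) meets_sym[OF al]]
        by blast+
      then have "in_piece P m u" "in_piece Q n v"
        using new.breaks[OF m(1)] new.breaks[OF n(1)] m n sP sQ by (auto simp: in_piece_def)
      moreover have "crossing_rule X star R1 R2 D' (along (ps ! m) u) (along (ps ! n) v)
        (enter (ps ! m) (?B m u) (?A m u)) (leave (ps ! m) (?B m u) (?A m u))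
        (enter (ps ! n) (?B n v) (?A n v)) (leave (ps ! n) (?B n v) (?A n v))"
        using loc m n al unfolding local_coloring_def by blast
      ultimately show ?thesis
        unfolding crossing_rule_same_passage[OF new.diag sP P sQ Q] using inside by simp
    next
      case False
      then have Ps: "pos D P \<notin> square" using in_square_iff P passages_eq by blast
      have "pos D' Q \<notin> square" using False PQ by (simp add: meets_def)
      then have Qs: "pos D Q \<notin> square" using in_square_iff Q passages_eq by blast
      have P': "P \<in> passages D" and Q': "Q \<in> passages D" using P Q passages_eq by simp_all
      have "meets D P Q"
        using PQ same_outside[OF P' Ps] same_outside[OF Q' Qs] unfolding meets_def passages_eq by simp
      moreover have "\<nexists>m u. in_piece P m u" "\<nexists>m u. in_piece Q m u"
        using old.along_in_square[OF P'] old.along_in_square[OF Q'] Ps Qs unfolding in_piece_def by fastforce+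
      ultimately show ?thesis
        using rule[of P Q] same_outside[OF P' Ps] outside[of P] outside[of Q]
          dir_outside[OF P' Ps] dir_outside[OF Q' Qs] by (simp add: crossing_rule_def)
    qed
  qed
  ultimately show ?thesis using outside by blast
qed

lemma extended_coloring:
  assumes C: "C \<in> colorings X star R1 R2 D"
    and ext: "\<And>c. local_coloring X star R1 R2 D ps b1 b2 c \<Longrightarrow>
      \<exists>c'. local_coloring X star R1 R2 D' ps b1' b2' c' \<and> (\<forall>m<length ps. c' m 0 = c m 0 \<and> c' m 2 = c m 2)"
  shows "\<exists>C'\<in>colorings X star R1 R2 D'. \<forall>P\<in>passages D. (\<nexists>m u. in_piece P m u) \<longrightarrow>
    C' (incoming D' P) = C (incoming D P)"
proof -
  let ?a = "\<lambda>P. C (incoming D P)" and ?b = "\<lambda>P. C (outgoing D P)"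
  have ab: "passage_colors D X ?a ?b" by (rule colorings_imp_passage_colors[OF old.diag C])
  have rule: "crossing_rule X star R1 R2 D P Q (?a P) (?b P) (?a Q) (?b Q)" if "meets D P Q" for P Q
    using C that unfolding colorings_iff by blast
  from ext[OF old.seg_color_local_coloring[OF ab rule]]
  obtain c' where c': "local_coloring X star R1 R2 D' ps b1' b2' c'"
    "\<And>m. m < length ps \<Longrightarrow> c' m 0 = old.seg_color ?a m 0 \<and> c' m 2 = old.seg_color ?a m 2" by blast
  from coloring_extension[OF ab rule c'] obtain a' b' where a': "passage_colors D' X a' b'"
    "\<And>P Q. meets D' P Q \<Longrightarrow> crossing_rule X star R1 R2 D' P Q (a' P) (b' P) (a' Q) (b' Q)"
    "\<And>P. (\<nexists>m u. in_piece P m u) \<Longrightarrow> a' P = ?a P" by blast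
  from passage_colors_imp_colorings[OF new.diag a'(1,2)]
  obtain C' where "C' \<in> colorings X star R1 R2 D'" "\<forall>P\<in>passages D'. C' (incoming D' P) = a' P" by blast
  then show ?thesis using a'(3) passages_eq by (intro bexI[of _ C']) simp_all
qed

text \<open>The ends of the pieces belong to the outside, so the segments 0 and 2 have equal colors.
  Then \<open>uniq\<close> yields the middle segments, and the segments determine every passage on a
  piece.\<close>

lemma coloring_determined_outside:
  assumes C: "C \<in> colorings X star R1 R2 D" and E: "E \<in> colorings X star R1 R2 D"
    and uniq: "\<forall>c e. local_coloring X star R1 R2 D ps b1 b2 c \<and> local_coloring X star R1 R2 D ps b1 b2 e \<and>
      (\<forall>m<length ps. c m 0 = e m 0 \<and> c m 2 = e m 2) \<longrightarrow> (\<forall>m<length ps. c m 1 = e m 1)"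
    and agree: "\<And>P. P \<in> passages D \<Longrightarrow> (\<nexists>m u. in_piece P m u) \<Longrightarrow> C (incoming D P) = E (incoming D P)"
  shows "C = E"
proof (rule colorings_eqI[OF old.diag C E])
  fix P assume "regular D P"
  then have P: "P \<in> passages D" by (simp add: regular_def)
  let ?c = "old.seg_color (\<lambda>P. C (incoming D P))" and ?e = "old.seg_color (\<lambda>P. E (incoming D P))"
  note Cpc = colorings_imp_passage_colors[OF old.diag C] and Epc = colorings_imp_passage_colors[OF old.diag E]
  have "local_coloring X star R1 R2 D ps b1 b2 ?c"
    by (rule old.seg_color_local_coloring[OF Cpc]) (use C in \<open>unfold colorings_iff, blast\<close>)
  moreover have "local_coloring X star R1 R2 D ps b1 b2 ?e"
    by (rule old.seg_color_local_coloring[OF Epc]) (use E in \<open>unfold colorings_iff, blast\<close>)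
  moreover have ends: "?c m 0 = ?e m 0 \<and> ?c m 2 = ?e m 2" if m: "m < length ps" for m
  proof -
    have "C (incoming D (along (ps ! m) u)) = E (incoming D (along (ps ! m) u))" if "u = -1 \<or> u = 1" for u
    proof (rule agree)
      have u: "u \<in> {-1..1}" using that by auto
      show "along (ps ! m) u \<in> passages D" by (rule old.along_passage[OF m u])
      show "\<nexists>n v. in_piece (along (ps ! m) u) n v"
      proof
        assume "\<exists>n v. in_piece (along (ps ! m) u) n v"
        then obtain n v where n: "n < length ps" "v \<in> {-1<..<1}" "same_passage (along (ps ! m) u) (along (ps ! n) v)"
          unfolding in_piece_def by blast
        then have "u = v" using old.along_inj[OF m n(1) u _ n(3)] by simp
        then show False using n(2) that by auto
      qed
    qed
    from this[of "-1"] this[of 1] show ?thesis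
      by (simp add: old.seg_color_def[OF Cpc] old.seg_color_def[OF Epc])
  qed
  ultimately have "\<forall>m<length ps. ?c m 1 = ?e m 1" using uniq by blast
  with ends have eq: "?c m k = ?e m k" if "m < length ps" "k < 3" for m k
    using that less_Suc_eq numeral_3_eq_3 by (metis One_nat_def Suc_1 less_one)
  show "C (incoming D P) = E (incoming D P)"
  proof (cases "\<exists>m u. in_piece P m u")
    case True
    then obtain m u where mu: "m < length ps" "u \<in> {-1<..<1}" and same: "same_passage P (along (ps ! m) u)"
      unfolding in_piece_def by blast
    from mu have m: "m < length ps" "u \<in> {-1..1}" by simp_all
    have "C (incoming D (along (ps ! m) u)) =
        enter (ps ! m) (?c m (seg_before (b1 m) (b2 m) u)) (?c m (seg_after (b1 m) (b2 m) u))"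
      unfolding old.along_colors[OF Cpc m, symmetric] by simp
    also have "\<dots> = enter (ps ! m) (?e m (seg_before (b1 m) (b2 m) u)) (?e m (seg_after (b1 m) (b2 m) u))"
      using eq[OF m(1)] seg_less_3 by simp
    also have "\<dots> = E (incoming D (along (ps ! m) u))"
      unfolding old.along_colors[OF Epc m, symmetric] by simp
    finally show ?thesis
      using same_passage_incoming(1)[OF old.diag same P] by simp
  next
    case False
    then show ?thesis by (rule agree[OF P])
  qed
qed

text \<open>Reduces a move to three colors per piece: \<open>ext\<close> and \<open>ext'\<close> say
  that the same colors of the outer segments occur in both pictures, \<open>uniq\<close> and
  \<open>uniq'\<close> that they determine the middle ones.\<close>

lemma square_change_bij:
  assumes ext: "\<And>c. local_coloring X star R1 R2 D ps b1 b2 c \<Longrightarrow>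
      \<exists>c'. local_coloring X star R1 R2 D' ps b1' b2' c' \<and> (\<forall>m<length ps. c' m 0 = c m 0 \<and> c' m 2 = c m 2)"
    and ext': "\<And>c. local_coloring X star R1 R2 D' ps b1' b2' c \<Longrightarrow>
      \<exists>c'. local_coloring X star R1 R2 D ps b1 b2 c' \<and> (\<forall>m<length ps. c' m 0 = c m 0 \<and> c' m 2 = c m 2)"
    and uniq: "\<forall>c e. local_coloring X star R1 R2 D ps b1 b2 c \<and> local_coloring X star R1 R2 D ps b1 b2 e \<and>
      (\<forall>m<length ps. c m 0 = e m 0 \<and> c m 2 = e m 2) \<longrightarrow> (\<forall>m<length ps. c m 1 = e m 1)"
    and uniq': "\<forall>c e. local_coloring X star R1 R2 D' ps b1' b2' c \<and> local_coloring X star R1 R2 D' ps b1' b2' e \<and>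
      (\<forall>m<length ps. c m 0 = e m 0 \<and> c m 2 = e m 2) \<longrightarrow> (\<forall>m<length ps. c m 1 = e m 1)"
  shows "\<exists>f. bij_betw f (colorings X star R1 R2 D) (colorings X star R1 R2 D')"
proof -
  interpret sym: square_change D' D ps cs' cs b1' b2' b1 b2 by (rule square_change_sym)
  let ?O = "{P \<in> passages D. \<nexists>m u. in_piece P m u}"
  let ?f = "\<lambda>C :: complex set \<Rightarrow> 'a. \<lambda>P\<in>?O. C (incoming D P)"
  let ?g = "\<lambda>C :: complex set \<Rightarrow> 'a. \<lambda>P\<in>?O. C (incoming D' P)"
  have O: "C Q = E Q" if "restrict C ?O = restrict E ?O" "Q \<in> passages D" "\<nexists>m u. in_piece Q m u" for C E :: "_ \<Rightarrow> 'a" and Q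
    using fun_cong[OF that(1), of Q] that(2,3) by simp
  show ?thesis
  proof (rule ex_bij_betw_of_injections)
    show "inj_on ?f (colorings X star R1 R2 D)"
    proof (rule inj_onI)
      fix C E assume CE: "C \<in> colorings X star R1 R2 D" "E \<in> colorings X star R1 R2 D" and eq: "?f C = ?f E"
      show "C = E"
        by (rule coloring_determined_outside[OF CE uniq O[OF eq]])
    qed
    show "inj_on ?g (colorings X star R1 R2 D')"
    proof (rule inj_onI)
      fix C E assume CE: "C \<in> colorings X star R1 R2 D'" "E \<in> colorings X star R1 R2 D'" and eq: "?g C = ?g E"
      show "C = E"
        by (rule sym.coloring_determined_outside[OF CE uniq'])
          (rule O[OF eq], simp only: passages_eq, assumption)
    qed
    show "?f ` colorings X star R1 R2 D \<subseteq> ?g ` colorings X star R1 R2 D'"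
    proof (rule image_subsetI)
      fix C assume "C \<in> colorings X star R1 R2 D"
      from extended_coloring[OF this ext] obtain C' where C': "C' \<in> colorings X star R1 R2 D'"
        "\<forall>P\<in>passages D. (\<nexists>m u. in_piece P m u) \<longrightarrow> C' (incoming D' P) = C (incoming D P)" by blast
      then have "?f C = ?g C'" by (intro restrict_ext) simp
      with C'(1) show "?f C \<in> ?g ` colorings X star R1 R2 D'" by blast
    qed
    show "?g ` colorings X star R1 R2 D' \<subseteq> ?f ` colorings X star R1 R2 D"
    proof (rule image_subsetI)
      fix C assume "C \<in> colorings X star R1 R2 D'"
      from sym.extended_coloring[OF this ext'] obtain C' where C': "C' \<in> colorings X star R1 R2 D"
        "\<forall>P\<in>passages D'. (\<nexists>m u. in_piece P m u) \<longrightarrow> C' (incoming D P) = C (incoming D' P)" by blast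
      then have "?g C = ?f C'" using passages_eq by (intro restrict_ext) simp
      with C'(1) show "?g C \<in> ?f ` colorings X star R1 R2 D" by blast
    qed
  qed
qed

end

section \<open>Algebra of crossings\<close>

context quandle
begin

lemma bar_closed: "a \<in> X \<Longrightarrow> b \<in> X \<Longrightarrow> a \<triangleleft> b \<in> X"
  and bar_star: "a \<in> X \<Longrightarrow> b \<in> X \<Longrightarrow> (a \<triangleleft> b) \<triangleright> b = a"
  using theI'[OF right_divisible, of a b] by (simp_all add: bar_def)

lemma star_cancel: "a \<in> X \<Longrightarrow> b \<in> X \<Longrightarrow> c \<in> X \<Longrightarrow> a \<triangleright> c = b \<triangleright> c \<longleftrightarrow> a = b"
  using right_divisible[of "a \<triangleright> c" c] star_closed by metis

lemma star_bar: "a \<in> X \<Longrightarrow> b \<in> X \<Longrightarrow> (a \<triangleright> b) \<triangleleft> b = a"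
  using bar_star[of "a \<triangleright> b" b] star_cancel bar_closed star_closed by metis

text \<open>Right translation by \<open>y\<close> with the sign \<open>e\<close> as exponent.
  Negating the flag inverts the translation, so that the many combinations of orientations can share
  one calculation.\<close>

definition act :: "bool \<Rightarrow> 'a \<Rightarrow> 'a \<Rightarrow> 'a" where
  "act e x y = (if e then x \<triangleright> y else x \<triangleleft> y)"

lemma act_closed [simp]: "x \<in> X \<Longrightarrow> y \<in> X \<Longrightarrow> act e x y \<in> X"
  by (simp add: act_def star_closed bar_closed)

lemma act_act [simp]:
  assumes "x \<in> X" "y \<in> X" shows "act (\<not> e) (act e x y) y = x" "act e (act (\<not> e) x y) y = x"
  using assms by (cases e; simp add: act_def bar_star star_bar)+

lemma act_cancel: "x \<in> X \<Longrightarrow> y \<in> X \<Longrightarrow> z \<in> X \<Longrightarrow> act e x z = act e y z \<longleftrightarrow> x = y"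
  using act_act(1) by metis

lemma act_eq_iff: "x \<in> X \<Longrightarrow> y \<in> X \<Longrightarrow> z \<in> X \<Longrightarrow> act e x z = y \<longleftrightarrow> x = act (\<not> e) y z"
  using act_act by metis

lemma act_idem [simp]: "x \<in> X \<Longrightarrow> act e x x = x"
  using idem star_bar[of x x] by (simp add: act_def)

text \<open>Right translations are automorphisms of the quandle, hence they preserve the inverse
  operation as well, and their inverses are automorphisms too. This covers all four combinations of
  signs.\<close>

lemma act_distrib_star:
  assumes "x \<in> X" "y \<in> X" "z \<in> X"
  shows "act e (act f x y) z = act f (act e x z) (act e y z)"
proof -
  have ss: "(a \<triangleright> b) \<triangleright> c = (a \<triangleright> c) \<triangleright> (b \<triangleright> c)" if "a \<in> X" "b \<in> X" "c \<in> X" for a b c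
    by (rule self_distrib[OF that])
  have s: "act True (act f a b) c = act f (act True a c) (act True b c)" if abc: "a \<in> X" "b \<in> X" "c \<in> X" for a b c
  proof (cases f)
    case True then show ?thesis using ss[OF abc] by (simp add: act_def)
  next
    case False
    have "(a \<triangleleft> b) \<triangleright> c \<triangleright> (b \<triangleright> c) = a \<triangleright> c"
      using ss[of "a \<triangleleft> b" b c] abc by (simp add: bar_closed bar_star)
    then have "(a \<triangleleft> b) \<triangleright> c = (a \<triangleright> c) \<triangleleft> (b \<triangleright> c)"
      using star_bar[of "(a \<triangleleft> b) \<triangleright> c" "b \<triangleright> c"] abc by (simp add: bar_closed star_closed)
    then show ?thesis using False by (simp add: act_def)
  qed
  show ?thesis
  proof (cases e)
    case True then show ?thesis using s[OF assms] by simp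
  next
    case False
    have "act f x y = act True (act f (act False x z) (act False y z)) z"
      using s[of "act False x z" "act False y z" z] act_act(2)[of _ z True] assms by simp
    then show ?thesis using False act_act(1)[of "act f (act False x z) (act False y z)" z True] assms by simp
  qed
qed

end

section \<open>Identities of singquandles and relations at a crossing\<close>

context oriented_singquandle
begin

lemma R_closed [simp]: "x \<in> X \<Longrightarrow> y \<in> X \<Longrightarrow> R1 x y \<in> X" "x \<in> X \<Longrightarrow> y \<in> X \<Longrightarrow> R2 x y \<in> X"
  by (simp_all add: R1_closed R2_closed)

text \<open>With \<open>x\<close> replaced by \<open>x \<triangleright> y\<close>, the axioms
  \<open>sing1\<close> and \<open>sing2\<close> say that right translations commute with
  \<open>R1\<close> and \<open>R2\<close>; the same then holds for inverse translations.\<close>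

lemma R_equivariant:
  assumes "x \<in> X" "y \<in> X" "z \<in> X"
  shows "act e (R1 x y) z = R1 (act e x z) (act e y z)" "act e (R2 x y) z = R2 (act e x z) (act e y z)"
proof -
  have R1s: "R1 a b \<triangleright> c = R1 (a \<triangleright> c) (b \<triangleright> c)" if "a \<in> X" "b \<in> X" "c \<in> X" for a b c
    using sing1[of "a \<triangleright> c" c b] that by (simp add: star_closed star_bar)
  have R2s: "R2 a b \<triangleright> c = R2 (a \<triangleright> c) (b \<triangleright> c)" if "a \<in> X" "b \<in> X" "c \<in> X" for a b c
    using sing2[of "a \<triangleright> c" c b] that by (simp add: star_closed star_bar bar_star)
  show "act e (R1 x y) z = R1 (act e x z) (act e y z)"
  proof (cases e)
    case True then show ?thesis using R1s[OF assms] by (simp add: act_def)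
  next
    case False
    have "R1 x y = R1 (x \<triangleleft> z) (y \<triangleleft> z) \<triangleright> z" using R1s[of "x \<triangleleft> z" "y \<triangleleft> z" z] assms by (simp add: bar_closed bar_star)
    then show ?thesis using False star_bar[of "R1 (x \<triangleleft> z) (y \<triangleleft> z)" z] assms by (simp add: act_def bar_closed)
  qed
  show "act e (R2 x y) z = R2 (act e x z) (act e y z)"
  proof (cases e)
    case True then show ?thesis using R2s[OF assms] by (simp add: act_def)
  next
    case False
    have "R2 x y = R2 (x \<triangleleft> z) (y \<triangleleft> z) \<triangleright> z" using R2s[of "x \<triangleleft> z" "y \<triangleleft> z" z] assms by (simp add: bar_closed bar_star)
    then show ?thesis using False star_bar[of "R2 (x \<triangleleft> z) (y \<triangleleft> z)" z] assms by (simp add: act_def bar_closed)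
  qed
qed

text \<open>The axiom \<open>sing3\<close> freed of inverses, by substituting
  \<open>z \<triangleright> R1 x y\<close> for its free variable: passing below both outgoing legs
  of a singular crossing has the same effect as passing below both incoming ones.\<close>

lemma act_R_pair:
  assumes "x \<in> X" "y \<in> X" "z \<in> X"
  shows "act True (act True z (R1 x y)) (R2 x y) = act True (act True z x) y"
proof -
  have "((z \<triangleright> R1 x y) \<triangleleft> R1 x y) \<triangleright> x = ((z \<triangleright> R1 x y) \<triangleright> R2 x y) \<triangleleft> y"
    using sing3[of x "z \<triangleright> R1 x y" y] assms by (simp add: star_closed)
  then have "z \<triangleright> x = ((z \<triangleright> R1 x y) \<triangleright> R2 x y) \<triangleleft> y" using assms by (simp add: star_bar)
  then show ?thesis using assms by (simp add: act_def bar_star star_closed)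
qed

text \<open>By idempotence \<open>y\<close> is its own translate by \<open>y\<close>, so
  equivariance pulls the translation out of the right side of \<open>sing4\<close>.\<close>

lemma R2_swap: "x \<in> X \<Longrightarrow> y \<in> X \<Longrightarrow> R2 x y = R1 y x \<triangleright> y"
  using sing4[of x y] R_equivariant(1)[of y x y True] by (simp add: act_def idem)

text \<open>
  A crossing of two pieces \<open>p\<close> and \<open>q\<close>, where \<open>k\<close> is the kind of \<open>p\<close>. The colors of \<open>p\<close> before and
  after the crossing are \<open>x\<close> and \<open>x'\<close>, those of \<open>q\<close> are \<open>y\<close> and \<open>y'\<close>, in the direction of
  increasing \<open>u\<close>. The flags \<open>ep\<close> and \<open>eq\<close> say whether the orientations of \<open>p\<close> and \<open>q\<close> agree with
  this direction, and \<open>left\<close> says whether \<open>q\<close> crosses \<open>p\<close> from right to left when both are followed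
  in this direction. For a classical crossing only the orientation of the over-strand matters.
\<close>

definition classical :: "passage_kind \<Rightarrow> bool \<Rightarrow> bool \<Rightarrow> bool \<Rightarrow> 'a \<Rightarrow> 'a \<Rightarrow> 'a \<Rightarrow> 'a \<Rightarrow> bool" where
  "classical k ep eq left x x' y y' \<longleftrightarrow>
     (if k = Over then x' = x \<and> y' = act (ep = left) y x else y' = y \<and> x' = act (eq \<noteq> left) x y)"

text \<open>Here \<open>px\<close>, \<open>qy\<close> are the incoming and \<open>px'\<close>,
  \<open>qy'\<close> the outgoing colors. The condition \<open>left = (ep = eq)\<close> is the sign
  with respect to the true orientations; it holds iff \<open>q\<close> is the branch that comes from
  the top left.\<close>

definition singular :: "bool \<Rightarrow> bool \<Rightarrow> bool \<Rightarrow> 'a \<Rightarrow> 'a \<Rightarrow> 'a \<Rightarrow> 'a \<Rightarrow> bool" where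
  "singular ep eq left x x' y y' \<longleftrightarrow>
     (let px = if ep then x else x'; px' = if ep then x' else x; qy = if eq then y else y'; qy' = if eq then y' else y in
      if left = (ep = eq) then px' = R1 qy px \<and> qy' = R2 qy px else qy' = R1 px qy \<and> px' = R2 px qy)"

lemma classical_determined:
  assumes "x \<in> X" "x' \<in> X" "y \<in> X" "y' \<in> X" "z \<in> X" "w \<in> X" "classical k ep eq left x x' y y'"
  shows "classical k ep eq left x z y w \<Longrightarrow> z = x' \<and> w = y'"
    "classical k ep eq left z x' w y' \<Longrightarrow> z = x \<and> w = y"
  using assms act_cancel by (auto simp: classical_def split: if_splits)

lemma classical_ex:
  assumes "x \<in> X" "y \<in> X"
  shows "\<exists>x'\<in>X. \<exists>y'\<in>X. classical k ep eq left x x' y y'"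
    "\<exists>x'\<in>X. \<exists>y'\<in>X. classical k ep eq left x' x y' y"
proof -
  show "\<exists>x'\<in>X. \<exists>y'\<in>X. classical k ep eq left x x' y y'"
    using assms by (cases "k = Over") (auto simp: classical_def)
  show "\<exists>x'\<in>X. \<exists>y'\<in>X. classical k ep eq left x' x y' y"
  proof (cases "k = Over")
    case True
    then have "classical k ep eq left x x (act (\<not> (ep = left)) y x) y"
      using act_act(2)[OF assms(2,1), of "ep = left"] by (simp add: classical_def)
    then show ?thesis using assms act_closed by blast
  next
    case False
    then have "classical k ep eq left (act (\<not> (eq \<noteq> left)) x y) x y y"
      using act_act(2)[OF assms, of "eq \<noteq> left"] by (simp add: classical_def)
    then show ?thesis using assms act_closed by blast
  qed
qed

text \<open>For the half of move 4 in which the third strand passes over: its color translates all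
  four legs simultaneously.\<close>

lemma singular_equivariant:
  assumes "x \<in> X" "x' \<in> X" "y \<in> X" "y' \<in> X" "z \<in> X" "singular ep eq left x x' y y'"
  shows "singular ep eq left (act e x z) (act e x' z) (act e y z) (act e y' z)"
  using assms by (cases ep; cases eq; cases left) (simp_all add: singular_def Let_def R_equivariant)

text \<open>For the half of move 4 in which the third strand passes under: its final color is the
  same on both routes. The four orientations of the crossing all reduce to
  \<open>act_R_pair\<close>, with some of the translations moved to the other side.\<close>

lemma act_singular:
  assumes "x \<in> X" "x' \<in> X" "y \<in> X" "y' \<in> X" "z \<in> X" "singular ep eq False x x' y y'"
  shows "act (\<not> ep) (act eq z y) x' = act eq (act (\<not> ep) z x) y'"
proof -
  have *: "act True (act True w (R1 a b)) (R2 a b) = act True (act True w a) b" if "a \<in> X" "b \<in> X" "w \<in> X" for a b w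
    by (rule act_R_pair[OF that])
  have 1: "act False (act True z b) (R2 a b) = act True (act False z a) (R1 a b)" if "a \<in> X" "b \<in> X" for a b
  proof -
    have "act True z b = act True (act True (act False z a) a) b" using act_act(2)[of z a True] that assms by simp
    also have "\<dots> = act True (act True (act False z a) (R1 a b)) (R2 a b)" using *[of a b "act False z a"] that assms by simp
    finally show ?thesis using act_act(1)[of "act True (act False z a) (R1 a b)" "R2 a b" True] that assms by simp
  qed
  have 2: "act False (act True z (R2 a b)) b = act True (act False z (R1 a b)) a" if "a \<in> X" "b \<in> X" for a b
  proof -
    have "act True z (R2 a b) = act True (act True (act False z (R1 a b)) (R1 a b)) (R2 a b)"
      using act_act(2)[of z "R1 a b" True] that assms by simp
    also have "\<dots> = act True (act True (act False z (R1 a b)) a) b" using *[of a b "act False z (R1 a b)"] that assms by simp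
    finally show ?thesis using act_act(1)[of "act True (act False z (R1 a b)) a" b True] that assms by simp
  qed
  have 3: "act False (act False z b) a = act False (act False z (R2 a b)) (R1 a b)" if "a \<in> X" "b \<in> X" for a b
  proof -
    let ?u = "act False (act False z (R2 a b)) (R1 a b)"
    have "act True (act True ?u a) b = act True (act True ?u (R1 a b)) (R2 a b)"
      using *[of a b ?u] that assms by simp
    also have "\<dots> = z"
      using act_act(2)[of "act False z (R2 a b)" "R1 a b" True] act_act(2)[of z "R2 a b" True] that assms by simp
    finally have "act False z b = act True ?u a" using act_act(1)[of "act True ?u a" b True] that assms by simp
    then show ?thesis using act_act(1)[of ?u a True] that assms by simp
  qed
  show ?thesis
  proof (cases ep; cases eq)
    assume e: "ep" "eq"
    then have "y' = R1 x y" "x' = R2 x y" using assms(6) by (simp_all add: singular_def Let_def)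
    then show ?thesis using 1[OF assms(1,3)] e by simp
  next
    assume e: "ep" "\<not> eq"
    then have "x' = R1 y' x" "y = R2 y' x" using assms(6) by (simp_all add: singular_def Let_def)
    then show ?thesis using 3[OF assms(4,1)] e by simp
  next
    assume e: "\<not> ep" "eq"
    then have "x = R1 y x'" "y' = R2 y x'" using assms(6) by (simp_all add: singular_def Let_def)
    then show ?thesis using *[OF assms(3,2,5)] e by simp
  next
    assume e: "\<not> ep" "\<not> eq"
    then have "y = R1 x' y'" "x = R2 x' y'" using assms(6) by (simp_all add: singular_def Let_def)
    then show ?thesis using 2[OF assms(2,4)] e by simp
  qed
qed

lemma R2_swap1: "x \<in> X \<Longrightarrow> y \<in> X \<Longrightarrow> R2 x y = R1 y (act True x y)"
  by (simp add: sing4 act_def)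

lemma R2_swap2: "x \<in> X \<Longrightarrow> y \<in> X \<Longrightarrow> R2 x y = act True (R1 y x) y"
  by (simp add: R2_swap act_def)

lemma act_R1_R2: "x \<in> X \<Longrightarrow> y \<in> X \<Longrightarrow> act True (R1 x y) (R2 x y) = R2 y (act True x y)"
  by (simp add: sing5 act_def)

lemma act_undo:
  "x \<in> X \<Longrightarrow> y \<in> X \<Longrightarrow> act False (act True x y) y = x"
  "x \<in> X \<Longrightarrow> y \<in> X \<Longrightarrow> act True (act False x y) y = x"
  using act_act[of x y True] by simp_all

text \<open>The calculation behind move 5. The flags \<open>k\<close> and \<open>k'\<close> are
  opposite because the ascending strand at the classical crossing is \<open>p\<close> before the
  move and \<open>q\<close> after it. For parallel strands (\<open>ep = eq\<close>) the identities
  \<open>R2_swap1\<close> and \<open>act_R1_R2\<close> suffice; antiparallel strands lead to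
  \<open>R2_swap2\<close> or, for the other choice of the over-strand, to equivariance combined with
  \<open>act_R_pair\<close>.\<close>

lemma twist_slide:
  assumes X: "x0 \<in> X" "x1 \<in> X" "x2 \<in> X" "y0 \<in> X" "y1 \<in> X" "y2 \<in> X" "u \<in> X" "v \<in> X"
    and k: "(k = Over) = (k' \<noteq> Over)"
    and s: "singular ep eq True x0 x1 y0 y1" and c: "classical k ep eq False x1 x2 y1 y2"
    and c': "classical k' ep eq True x0 u y0 v"
  shows "singular ep eq False u x2 v y2"
proof (cases ep; cases eq; cases "k = Over")
  assume e: "ep" "eq" "k = Over"
  then have h: "x1 = R1 y0 x0" "y1 = R2 y0 x0" "x2 = x1" "y2 = act False y1 x1" "v = y0" "u = act False x0 y0"
    using s c c' k by (auto simp: singular_def classical_def Let_def)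
  have "y2 = R1 u v" by (metis R2_swap1 R_closed(1) act_undo act_R1_R2  X(1,4,7) h(1,2,4,5,6))
  moreover have "x2 = R2 u v"
    by (metis X(8,1) h(6,5,3,1) R2_swap1 act_undo(2) act_closed)
  moreover have "?thesis \<longleftrightarrow> y2 = R1 u v \<and> x2 = R2 u v"
    using e by (simp add: singular_def Let_def)
  ultimately show ?thesis by blast
next
  assume e: "ep" "eq" "k \<noteq> Over"
  then have h: "x1 = R1 y0 x0" "y1 = R2 y0 x0" "y2 = y1" "x2 = act True x1 y1" "u = x0" "v = act True y0 x0"
    using s c c' k by (auto simp: singular_def classical_def Let_def)
  have "y2 = R1 u v" by (metis R2_swap1  X(1,4) h(2,3,5,6))
  moreover have "x2 = R2 u v"
    by (metis X(4,1) h(6,5,4,2,1) act_R1_R2)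
  moreover have "?thesis \<longleftrightarrow> y2 = R1 u v \<and> x2 = R2 u v"
    using e by (simp add: singular_def Let_def)
  ultimately show ?thesis by blast
next
  assume e: "ep" "\<not> eq" "k = Over"
  then have h: "y0 = R1 x0 y1" "x1 = R2 x0 y1" "x2 = x1" "y2 = act False y1 x1" "v = y0" "u = act True x0 y0"
    using s c c' k by (auto simp: singular_def classical_def Let_def)
  have "x2 = R1 y2 u" by (metis R2_swap1 R_equivariant(1) act_undo(1) act_R_pair act_closed act_idem  X(1,3,5,7) h(1,2,3,4,6))
  moreover have "v = R2 y2 u"
    by (metis (no_types, lifting) h(1,2,4,5,6) R_closed(2) R_equivariant(2) X(1,5,6,7,8) act_R1_R2 act_R_pair act_idem act_undo)
  moreover have "?thesis \<longleftrightarrow> x2 = R1 y2 u \<and> v = R2 y2 u"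
    using e by (simp add: singular_def Let_def)
  ultimately show ?thesis by blast
next
  assume e: "ep" "\<not> eq" "k \<noteq> Over"
  then have h: "y0 = R1 x0 y1" "x1 = R2 x0 y1" "y2 = y1" "x2 = act False x1 y1" "u = x0" "v = act True y0 x0"
    using s c c' k by (auto simp: singular_def classical_def Let_def)
  have "x2 = R1 y2 u" by (metis R2_swap2 act_undo(1) R_closed(1)  X(1,6) h(2,3,4,5))
  moreover have "v = R2 y2 u"
    by (metis X(6,1) h(6,5,3,1) R2_swap2)
  moreover have "?thesis \<longleftrightarrow> x2 = R1 y2 u \<and> v = R2 y2 u"
    using e by (simp add: singular_def Let_def)
  ultimately show ?thesis by blast
next
  assume e: "\<not> ep" "eq" "k = Over"
  then have h: "y1 = R1 x1 y0" "x0 = R2 x1 y0" "x2 = x1" "y2 = act True y1 x1" "v = y0" "u = act False x0 y0"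
    using s c c' k by (auto simp: singular_def classical_def Let_def)
  have "u = R1 v x2" by (metis R2_swap2 act_undo(1) R_closed(1)  X(3,8) h(2,3,5,6))
  moreover have "y2 = R2 v x2"
    by (metis X(8,2) h(5,4,3,1) R2_swap2)
  moreover have "?thesis \<longleftrightarrow> u = R1 v x2 \<and> y2 = R2 v x2"
    using e by (simp add: singular_def Let_def)
  ultimately show ?thesis by blast
next
  assume e: "\<not> ep" "eq" "k \<noteq> Over"
  then have h: "y1 = R1 x1 y0" "x0 = R2 x1 y0" "y2 = y1" "x2 = act True x1 y1" "u = x0" "v = act False y0 x0"
    using s c c' k by (auto simp: singular_def classical_def Let_def)
  have "u = R1 v x2" by (metis R2_swap1 R_equivariant(1) act_undo(1) act_R_pair act_closed act_idem  X(2,3,4,7) h(1,2,4,5,6))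
  moreover have "y2 = R2 v x2"
    by (metis h(1,2,3,4,6) R_closed(2) R_equivariant(2) X(2,3,4,6,8) act_R1_R2 act_R_pair act_idem act_undo)
  moreover have "?thesis \<longleftrightarrow> u = R1 v x2 \<and> y2 = R2 v x2"
    using e by (simp add: singular_def Let_def)
  ultimately show ?thesis by blast
next
  assume e: "\<not> ep" "\<not> eq" "k = Over"
  then have h: "x0 = R1 y1 x1" "y0 = R2 y1 x1" "x2 = x1" "y2 = act True y1 x1" "v = y0" "u = act True x0 y0"
    using s c c' k by (auto simp: singular_def classical_def Let_def)
  have "v = R1 x2 y2" by (metis R2_swap1  X(3,5) h(2,3,4,5))
  moreover have "u = R2 x2 y2"
    by (metis X(5,2) h(6,4,3,2,1) act_R1_R2)
  moreover have "?thesis \<longleftrightarrow> v = R1 x2 y2 \<and> u = R2 x2 y2"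
    using e by (simp add: singular_def Let_def)
  ultimately show ?thesis by blast
next
  assume e: "\<not> ep" "\<not> eq" "k \<noteq> Over"
  then have h: "x0 = R1 y1 x1" "y0 = R2 y1 x1" "y2 = y1" "x2 = act False x1 y1" "u = x0" "v = act False y0 x0"
    using s c c' k by (auto simp: singular_def classical_def Let_def)
  have "v = R1 x2 y2" by (metis R2_swap1 act_R1_R2 act_undo act_closed R_closed(2)  X(2,5) h(1,2,3,4,6))
  moreover have "u = R2 x2 y2"
    by (metis X(6,2) h(5,4,3,1) R2_swap1 act_undo(2) act_closed)
  moreover have "?thesis \<longleftrightarrow> v = R1 x2 y2 \<and> u = R2 x2 y2"
    using e by (simp add: singular_def Let_def)
  ultimately show ?thesis by blast
qed

text \<open>Rotating a picture of a crossing by a half turn exchanges its two strands and reverses both.\<close>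

lemma singular_rotate:
  "singular ep eq left x x' y y' \<longleftrightarrow> singular (\<not> eq) (\<not> ep) (\<not> left) y' y x' x"
  by (cases ep; cases eq; cases left) (simp_all add: singular_def Let_def)

lemma classical_rotate:
  assumes "x \<in> X" "x' \<in> X" "y \<in> X" "y' \<in> X" "(k = Over) = (k' \<noteq> Over)"
  shows "classical k ep eq left x x' y y' \<longleftrightarrow> classical k' (\<not> eq) (\<not> ep) (\<not> left) y' y x' x"
proof -
  have *: "(x' = x \<and> y' = act e y x) \<longleftrightarrow> (x = x' \<and> y = act (\<not> e) y' x')"
    "(y' = y \<and> x' = act e x y) \<longleftrightarrow> (y = y' \<and> x = act (\<not> e) x' y')" for e
    using act_eq_iff[OF assms(3,4,1), of e] act_eq_iff[OF assms(1,2,3), of e] by metis+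
  have e: "((\<not> ep) \<noteq> (\<not> left)) = (\<not> (ep = left))" "((\<not> eq) = (\<not> left)) = (\<not> (eq \<noteq> left))"
    by blast+
  show ?thesis
  proof (cases "k = Over")
    case True
    with assms(5) have "k' \<noteq> Over" by blast
    show ?thesis unfolding classical_def if_P[OF True] if_not_P[OF \<open>k' \<noteq> Over\<close>] e by (rule *(1))
  next
    case False
    with assms(5) have "k' = Over" by blast
    show ?thesis unfolding classical_def if_not_P[OF False] if_P[OF \<open>k' = Over\<close>] e by (rule *(2))
  qed
qed

text \<open>A half turn carries the picture after move 5 to a picture before it, with both strands
  exchanged and reversed. So the converse is \<open>twist_slide\<close> for the rotated strands and
  no new calculation.\<close>

lemma twist_slide':
  assumes X: "x0 \<in> X" "x1 \<in> X" "x2 \<in> X" "y0 \<in> X" "y1 \<in> X" "y2 \<in> X" "u \<in> X" "v \<in> X"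
    and k: "(k = Over) = (k' \<noteq> Over)"
    and c': "classical k' ep eq True x0 u y0 v" and s: "singular ep eq False u x2 v y2"
    and c: "classical k ep eq False x1 x2 y1 y2"
  shows "singular ep eq True x0 x1 y0 y1"
proof -
  have k': "(k' = Over) = (k \<noteq> Over)" using k by blast
  have "singular (\<not> eq) (\<not> ep) True y2 v x2 u" using s singular_rotate[of ep eq False] by simp
  moreover have "classical k (\<not> eq) (\<not> ep) False v y0 u x0"
    using c' classical_rotate[OF X(1,7,4,8) k', of ep eq True] by simp
  moreover have "classical k' (\<not> eq) (\<not> ep) True y2 y1 x2 x1"
    using c classical_rotate[OF X(2,3,5,6) k, of ep eq False] by simp
  ultimately have "singular (\<not> eq) (\<not> ep) False y1 y0 x1 x0"
    by (rule twist_slide[OF X(6,8,4,3,7,1,5,2) k])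
  then show ?thesis using singular_rotate[of ep eq True] by simp
qed

end

section \<open>Crossings of pieces\<close>

lemma (in square_part) meets_iff:
  assumes "m < length ps" "n < length ps" "u \<in> {-1..1}" "v \<in> {-1..1}"
  shows "meets D (along (ps ! m) u) (along (ps ! n) v) \<longleftrightarrow> (cs ! m) u = (cs ! n) v \<and> (m, u) \<noteq> (n, v)"
proof -
  have "same_passage (along (ps ! m) u) (along (ps ! n) v) \<longleftrightarrow> (m, u) = (n, v)"
    using along_inj[OF assms] by auto
  then show ?thesis
    unfolding meets_def using along_passage along_pos assms by metis
qed

text \<open>A piece runs along its component with constant speed, so the chain rule divides the
  derivative of the standard curve by that speed; its sign is the orientation of the piece.\<close>

lemma (in square_part) dir_along:
  assumes m: "m < length ps" and u: "-1 < u" "u < 1" and d: "(cs ! m has_vector_derivative d) (at u)"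
  shows "dir D (along (ps ! m) u) = inverse (snd (snd (ps ! m))) *\<^sub>R d"
proof -
  obtain i t l where p: "ps ! m = (i, t, l)" using prod_cases3 by blast
  have i: "i < ncomp D" using along_passage[OF m, of 0] p by simp
  have l: "l \<noteq> 0" using speed_nonzero[OF m] p by simp
  have "((\<lambda>x. t + l * x) has_vector_derivative l) (at u)"
    by (auto intro!: derivative_eq_intros simp flip: has_real_derivative_iff_has_vector_derivative)
  from vector_diff_chain_at[OF this strand_has_dir[OF diag i]]
  have 1: "(strand D i \<circ> (\<lambda>x. t + l * x) has_vector_derivative l *\<^sub>R dir D (i, t + l * u)) (at u)" .
  have "(strand D i \<circ> (\<lambda>x. t + l * x) has_vector_derivative d) (at u)"
  proof (rule has_vector_derivative_transform_within_open[OF d, of "{-1<..<1}"])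
    fix x :: real assume "x \<in> {-1<..<1}"
    then show "(cs ! m) x = (strand D i \<circ> (\<lambda>x. t + l * x)) x"
      using along_pos[OF m, of x] p by (simp add: pos_def)
  qed (use u in auto)
  then have "l *\<^sub>R dir D (i, t + l * u) = d" by (rule vector_derivative_unique_at[OF 1])
  then show ?thesis using l p by (auto simp: inverse_eq_divide)
qed

lemma cdet_commute: "cdet w v = - cdet v w"
  by (simp add: cdet_def)

lemma det_pos_iff:
  fixes k l t :: real
  assumes "k \<noteq> 0" "l \<noteq> 0" "t \<noteq> 0"
  shows "inverse k * inverse l * t > 0 \<longleftrightarrow> ((k > 0) = (l > 0)) = (t > 0)"
proof -
  have "inverse k > 0 \<longleftrightarrow> k > 0" "inverse l > 0 \<longleftrightarrow> l > 0" "inverse k < 0 \<longleftrightarrow> \<not> k > 0" "inverse l < 0 \<longleftrightarrow> \<not> l > 0"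
    "t < 0 \<longleftrightarrow> \<not> t > 0"
    using assms by auto
  then show ?thesis by (auto simp: zero_less_mult_iff mult_less_0_iff)
qed

section \<open>Local colorings as conditions at crossings\<close>

context oriented_singquandle
begin

definition crossing_ok :: "sdiagram \<Rightarrow> piece list \<Rightarrow> (nat \<Rightarrow> real) \<Rightarrow> (nat \<Rightarrow> real) \<Rightarrow> (nat \<Rightarrow> nat \<Rightarrow> 'a) \<Rightarrow>
    nat \<times> real \<Rightarrow> nat \<times> real \<Rightarrow> bool" where
  "crossing_ok D ps b1 b2 c mu nv \<longleftrightarrow>
    (case mu of (m, u) \<Rightarrow> case nv of (n, v) \<Rightarrow>
      crossing_rule X star R1 R2 D (along (ps ! m) u) (along (ps ! n) v)
          (enter (ps ! m) (c m (seg_before (b1 m) (b2 m) u)) (c m (seg_after (b1 m) (b2 m) u)))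
          (leave (ps ! m) (c m (seg_before (b1 m) (b2 m) u)) (c m (seg_after (b1 m) (b2 m) u)))
          (enter (ps ! n) (c n (seg_before (b1 n) (b2 n) v)) (c n (seg_after (b1 n) (b2 n) v)))
          (leave (ps ! n) (c n (seg_before (b1 n) (b2 n) v)) (c n (seg_after (b1 n) (b2 n) v))))"

text \<open>If every break is a crossing, the condition at regular passages holds automatically,
  since away from the breaks the segments before and after a parameter are the same.\<close>

lemma local_coloring_iff_crossings:
  assumes "square_part D ps cs b1 b2"
    and S: "\<And>m n u v. m < length ps \<Longrightarrow> n < length ps \<Longrightarrow> u \<in> {-1..1} \<Longrightarrow> v \<in> {-1..1} \<Longrightarrow>
      (cs ! m) u = (cs ! n) v \<and> (m, u) \<noteq> (n, v) \<longleftrightarrow> ((m, u), (n, v)) \<in> S \<or> ((n, v), (m, u)) \<in> S"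
    and range: "\<And>m n u v. ((m, u), (n, v)) \<in> S \<Longrightarrow> m < length ps \<and> n < length ps \<and> u \<in> {-1..1} \<and> v \<in> {-1..1}"
    and involved: "\<And>m. m < length ps \<Longrightarrow> (m, b1 m) \<in> fst ` S \<union> snd ` S \<and> (m, b2 m) \<in> fst ` S \<union> snd ` S"
  shows "local_coloring X star R1 R2 D ps b1 b2 c \<longleftrightarrow> (\<forall>m<length ps. \<forall>k<3. c m k \<in> X) \<and>
    (\<forall>(p, q)\<in>S. crossing_ok D ps b1 b2 c p q \<and> crossing_ok D ps b1 b2 c q p)" (is "?L \<longleftrightarrow> ?X \<and> ?R")
proof -
  interpret square_part D ps cs b1 b2 by (rule assms(1))
  have meets: "meets D (along (ps ! m) u) (along (ps ! n) v) \<longleftrightarrow> ((m, u), (n, v)) \<in> S \<or> ((n, v), (m, u)) \<in> S"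
    if "m < length ps" "n < length ps" "u \<in> {-1..1}" "v \<in> {-1..1}" for m n u v
    using meets_iff[OF that] S[OF that] by simp
  have reg: "c m (seg_before (b1 m) (b2 m) u) = c m (seg_after (b1 m) (b2 m) u)"
    if m: "m < length ps" "u \<in> {-1..1}" and r: "regular D (along (ps ! m) u)" for m u
  proof -
    have "u \<noteq> b" if "(m, b) \<in> fst ` S \<union> snd ` S" for b
    proof
      assume [simp]: "u = b"
      from that obtain n v where nv: "((m, b), (n, v)) \<in> S \<or> ((n, v), (m, b)) \<in> S" by force
      then have "n < length ps" "v \<in> {-1..1}" using range by blast+
      then have "meets D (along (ps ! m) u) (along (ps ! n) v)" using meets[OF m(1) _ m(2)] nv by simp
      then show False using r unfolding regular_iff_no_meets by blast
    qed
    then have "u \<noteq> b1 m" "u \<noteq> b2 m" using involved[OF m(1)] by blast+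
    then show ?thesis by (simp add: seg_before_def seg_after_def)
  qed
  have rules: "(\<forall>m<length ps. \<forall>n<length ps. \<forall>u\<in>{-1..1}. \<forall>v\<in>{-1..1}.
        meets D (along (ps ! m) u) (along (ps ! n) v) \<longrightarrow> crossing_ok D ps b1 b2 c (m, u) (n, v)) \<longleftrightarrow> ?R"
    (is "?M \<longleftrightarrow> _")
  proof
    assume M: ?M
    show ?R
    proof (intro ballI, clarify)
      fix m u n v assume s: "((m, u), (n, v)) \<in> S"
      note r = range[OF s]
      have "meets D (along (ps ! m) u) (along (ps ! n) v)" "meets D (along (ps ! n) v) (along (ps ! m) u)"
        using meets[of m n u v] r s meets_sym by blast+
      then show "crossing_ok D ps b1 b2 c (m, u) (n, v) \<and> crossing_ok D ps b1 b2 c (n, v) (m, u)"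
        using M r by blast
    qed
  next
    assume R: ?R
    show ?M
    proof (intro allI ballI impI)
      fix m n and u v :: real assume *: "m < length ps" "n < length ps" "u \<in> {-1..1}" "v \<in> {-1..1}"
        and "meets D (along (ps ! m) u) (along (ps ! n) v)"
      then have "((m, u), (n, v)) \<in> S \<or> ((n, v), (m, u)) \<in> S" using meets[OF *] by blast
      then show "crossing_ok D ps b1 b2 c (m, u) (n, v)" using R by blast
    qed
  qed
  have drop: "L \<longleftrightarrow> A \<and> C" if "B" "L \<longleftrightarrow> A \<and> B \<and> C" for A B C L
    using that by blast
  have "\<forall>m<length ps. \<forall>u\<in>{-1..1}. regular D (along (ps ! m) u) \<longrightarrow>
        c m (seg_before (b1 m) (b2 m) u) = c m (seg_after (b1 m) (b2 m) u)"
    using reg by blast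
  moreover have "local_coloring X star R1 R2 D ps b1 b2 c \<longleftrightarrow> ?X \<and>
      (\<forall>m<length ps. \<forall>u\<in>{-1..1}. regular D (along (ps ! m) u) \<longrightarrow>
        c m (seg_before (b1 m) (b2 m) u) = c m (seg_after (b1 m) (b2 m) u)) \<and> ?M"
    by (simp only: local_coloring_def crossing_ok_def prod.case)
  ultimately show ?thesis unfolding rules by (rule drop)
qed

text \<open>Without crossings the breaks are regular passages, and the condition there makes all
  three segments equal.\<close>

lemma local_coloring_iff_flat:
  assumes "square_part D ps cs b1 b2"
    and no: "\<And>m n u v. m < length ps \<Longrightarrow> n < length ps \<Longrightarrow> u \<in> {-1..1} \<Longrightarrow> v \<in> {-1..1} \<Longrightarrow>
      (cs ! m) u = (cs ! n) v \<Longrightarrow> (m, u) = (n, v)"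
  shows "local_coloring X star R1 R2 D ps b1 b2 c \<longleftrightarrow>
    (\<forall>m<length ps. c m 0 \<in> X \<and> c m 1 = c m 0 \<and> c m 2 = c m 0)"
proof -
  interpret square_part D ps cs b1 b2 by (rule assms(1))
  have nm: "\<not> meets D (along (ps ! m) u) (along (ps ! n) v)"
    if "m < length ps" "n < length ps" "u \<in> {-1..1}" "v \<in> {-1..1}" for m n u v
    using meets_iff[OF that] no[OF that] by blast
  have reg: "regular D (along (ps ! m) u)" if m: "m < length ps" "u \<in> {-1..1}" for m u
    unfolding regular_iff_no_meets
  proof (intro conjI allI notI)
    show "along (ps ! m) u \<in> passages D" by (rule along_passage[OF m])
    fix Q assume "meets D (along (ps ! m) u) Q"
    then obtain n v where n: "n < length ps" "v \<in> {-1..1}" "meets D (along (ps ! m) u) (along (ps ! n) v)"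
      by (rule meets_along[OF m])
    then show False using nm[OF m(1) n(1) m(2) n(2)] by blast
  qed
  have seg: "(\<forall>u\<in>{-1..1}. c m (seg_before (b1 m) (b2 m) u) = c m (seg_after (b1 m) (b2 m) u)) \<longleftrightarrow>
    c m 1 = c m 0 \<and> c m 2 = c m 0" if m: "m < length ps" for m
  proof
    assume *: "\<forall>u\<in>{-1..1}. c m (seg_before (b1 m) (b2 m) u) = c m (seg_after (b1 m) (b2 m) u)"
    have "c m 0 = c m 1" using *[rule_format, of "b1 m"] breaks[OF m] by (simp add: seg_before_def seg_after_def)
    moreover have "c m 1 = c m 2" using *[rule_format, of "b2 m"] breaks[OF m] by (simp add: seg_before_def seg_after_def)
    ultimately show "c m 1 = c m 0 \<and> c m 2 = c m 0" by simp
  next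
    assume "c m 1 = c m 0 \<and> c m 2 = c m 0"
    then show "\<forall>u\<in>{-1..1}. c m (seg_before (b1 m) (b2 m) u) = c m (seg_after (b1 m) (b2 m) u)"
      by (simp add: seg_before_def seg_after_def)
  qed
  have three: "(\<forall>k<3. c m k \<in> X) \<longleftrightarrow> c m 0 \<in> X \<and> c m 1 \<in> X \<and> c m 2 \<in> X" for m
    by (auto simp: numeral_3_eq_3 less_Suc_eq numeral_2_eq_2)
  let ?seg = "\<forall>m<length ps. \<forall>u\<in>{-1..1}. c m (seg_before (b1 m) (b2 m) u) = c m (seg_after (b1 m) (b2 m) u)"
  have "local_coloring X star R1 R2 D ps b1 b2 c \<longleftrightarrow> (\<forall>m<length ps. \<forall>k<3. c m k \<in> X) \<and> ?seg"
  proof (rule iffI)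
    assume "local_coloring X star R1 R2 D ps b1 b2 c"
    then show "(\<forall>m<length ps. \<forall>k<3. c m k \<in> X) \<and> ?seg"
      unfolding local_coloring_def using reg by blast
  next
    assume "(\<forall>m<length ps. \<forall>k<3. c m k \<in> X) \<and> ?seg"
    then show "local_coloring X star R1 R2 D ps b1 b2 c"
      unfolding local_coloring_def by (intro conjI allI ballI impI) (use nm in blast)+
  qed
  also have "\<dots> \<longleftrightarrow> (\<forall>m<length ps. (c m 0 \<in> X \<and> c m 1 \<in> X \<and> c m 2 \<in> X) \<and> c m 1 = c m 0 \<and> c m 2 = c m 0)"
    unfolding three using seg by blast
  also have "\<dots> \<longleftrightarrow> (\<forall>m<length ps. c m 0 \<in> X \<and> c m 1 = c m 0 \<and> c m 2 = c m 0)"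
    by auto
  finally show ?thesis .
qed

text \<open>Of the two ordered pairs, the one that begins with the over-strand has content.
  Reversing the under-strand exchanges its colors and also changes the sign of the crossing; these
  effects cancel, which leaves only the orientation of the over-strand.\<close>

lemma crossing_ok_classical:
  assumes sq: "square_part D ps cs b1 b2" and m: "m < length ps" "-1 < u" "u < 1" and n: "n < length ps" "-1 < v" "v < 1"
    and d: "(cs ! m has_vector_derivative d) (at u)" "(cs ! n has_vector_derivative e) (at v)" "cdet d e \<noteq> 0"
    and k: "kind D (along (ps ! m) u) \<noteq> Singular" "kind D (along (ps ! n) v) = opposite (kind D (along (ps ! m) u))"
    and X: "x \<in> X" "x' \<in> X" "y \<in> X" "y' \<in> X"
    and c: "x = c m (seg_before (b1 m) (b2 m) u)" "x' = c m (seg_after (b1 m) (b2 m) u)"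
      "y = c n (seg_before (b1 n) (b2 n) v)" "y' = c n (seg_after (b1 n) (b2 n) v)"
  shows "crossing_ok D ps b1 b2 c (m, u) (n, v) \<and> crossing_ok D ps b1 b2 c (n, v) (m, u) \<longleftrightarrow>
    classical (kind D (along (ps ! m) u)) (snd (snd (ps ! m)) > 0) (snd (snd (ps ! n)) > 0) (cdet d e > 0) x x' y y'"
proof -
  interpret square_part D ps cs b1 b2 by (rule sq)
  let ?P = "along (ps ! m) u" and ?Q = "along (ps ! n) v"
  define k where "k = snd (snd (ps ! m))"
  define l where "l = snd (snd (ps ! n))"
  have kl: "k \<noteq> 0" "l \<noteq> 0" using speed_nonzero m n by (simp_all add: k_def l_def)
  have det: "cdet (dir D ?P) (dir D ?Q) = inverse k * inverse l * cdet d e"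
    using dir_along[OF m d(1)] dir_along[OF n d(2)] by (simp add: k_def l_def)
  have pos: "cdet (dir D ?P) (dir D ?Q) > 0 \<longleftrightarrow> ((k > 0) = (l > 0)) = (cdet d e > 0)"
    unfolding det using kl d(3) by (rule det_pos_iff)
  have neg: "cdet (dir D ?Q) (dir D ?P) > 0 \<longleftrightarrow> \<not> (((k > 0) = (l > 0)) = (cdet d e > 0))"
  proof -
    have "cdet (dir D ?P) (dir D ?Q) \<noteq> 0" unfolding det using kl d(3) by simp
    then show ?thesis using pos cdet_commute[of "dir D ?Q" "dir D ?P"] by linarith
  qed
  have ok: "crossing_ok D ps b1 b2 c (m, u) (n, v) \<longleftrightarrow>
      crossing_rule X star R1 R2 D ?P ?Q (if k > 0 then x else x') (if k > 0 then x' else x)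
        (if l > 0 then y else y') (if l > 0 then y' else y)"
    "crossing_ok D ps b1 b2 c (n, v) (m, u) \<longleftrightarrow>
      crossing_rule X star R1 R2 D ?Q ?P (if l > 0 then y else y') (if l > 0 then y' else y)
        (if k > 0 then x else x') (if k > 0 then x' else x)"
    by (simp_all add: crossing_ok_def c enter_def leave_def k_def l_def)
  have flip: "p = act e q r \<longleftrightarrow> q = act (\<not> e) p r" if "p \<in> X" "q \<in> X" "r \<in> X" for p q r e
    using act_eq_iff[OF that(2,1,3)] by metis
  have star_if: "(if e then p \<triangleright> q else p \<triangleleft> q) = act e p q" for e p q
    by (simp add: act_def)
  show ?thesis
  proof (cases "kind D ?P")
    case Over
    then have Q: "kind D ?Q = Under" using k(2) by simp
    note y = flip[OF X(3,4) X(1)]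
    show ?thesis
      unfolding ok crossing_rule_def pos star_if Over Q classical_def k_def[symmetric] l_def[symmetric]
      by (cases "k > 0"; cases "l > 0") (auto simp: y X)
  next
    case Under
    then have Q: "kind D ?Q = Over" using k(2) by simp
    note x = flip[OF X(1,2) X(3)]
    show ?thesis
      unfolding ok crossing_rule_def neg star_if Under Q classical_def k_def[symmetric] l_def[symmetric]
      by (cases "k > 0"; cases "l > 0") (auto simp: x X)
  qed (use k in simp)
qed

text \<open>The determinant changes sign with the order of the passages, so exactly one of the two
  rules has content, and the case distinction in \<open>singular\<close> selects it.\<close>

lemma crossing_ok_singular:
  assumes sq: "square_part D ps cs b1 b2" and m: "m < length ps" "-1 < u" "u < 1" and n: "n < length ps" "-1 < v" "v < 1"
    and d: "(cs ! m has_vector_derivative d) (at u)" "(cs ! n has_vector_derivative e) (at v)" "cdet d e \<noteq> 0"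
    and k: "kind D (along (ps ! m) u) = Singular" "kind D (along (ps ! n) v) = Singular"
    and c: "x = c m (seg_before (b1 m) (b2 m) u)" "x' = c m (seg_after (b1 m) (b2 m) u)"
      "y = c n (seg_before (b1 n) (b2 n) v)" "y' = c n (seg_after (b1 n) (b2 n) v)"
  shows "crossing_ok D ps b1 b2 c (m, u) (n, v) \<and> crossing_ok D ps b1 b2 c (n, v) (m, u) \<longleftrightarrow>
    singular (snd (snd (ps ! m)) > 0) (snd (snd (ps ! n)) > 0) (cdet d e > 0) x x' y y'"
proof -
  interpret square_part D ps cs b1 b2 by (rule sq)
  let ?P = "along (ps ! m) u" and ?Q = "along (ps ! n) v"
  define k where "k = snd (snd (ps ! m))"
  define l where "l = snd (snd (ps ! n))"
  have kl: "k \<noteq> 0" "l \<noteq> 0" using speed_nonzero m n by (simp_all add: k_def l_def)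
  have det: "cdet (dir D ?P) (dir D ?Q) = inverse k * inverse l * cdet d e"
    using dir_along[OF m d(1)] dir_along[OF n d(2)] by (simp add: k_def l_def)
  have pos: "cdet (dir D ?P) (dir D ?Q) > 0 \<longleftrightarrow> ((k > 0) = (l > 0)) = (cdet d e > 0)"
    unfolding det using kl d(3) by (rule det_pos_iff)
  have nz: "cdet (dir D ?P) (dir D ?Q) \<noteq> 0" unfolding det using kl d(3) by simp
  have neg: "cdet (dir D ?P) (dir D ?Q) < 0 \<longleftrightarrow> \<not> (((k > 0) = (l > 0)) = (cdet d e > 0))"
    "cdet (dir D ?Q) (dir D ?P) < 0 \<longleftrightarrow> ((k > 0) = (l > 0)) = (cdet d e > 0)"
    using pos nz cdet_commute[of "dir D ?Q" "dir D ?P"] by linarith+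
  show ?thesis
    unfolding crossing_ok_def prod.case crossing_rule_def neg c[symmetric] enter_def leave_def k_def[symmetric] l_def[symmetric]
      singular_def Let_def k
    by (cases "k > 0"; cases "l > 0"; cases "cdet d e > 0") simp_all
qed

end

section \<open>The curves of the moves\<close>

lemma bump_minus [simp]: "bump (- u) = bump u"
  by (simp add: bump_def)

lemma bump_nonneg: "0 \<le> bump u"
  by (simp add: bump_def)

lemma bump_zero [simp]: "bump 0 = 1"
  by (simp add: bump_def)

lemma bump_strict_antimono:
  assumes "0 \<le> u" "u < v" "v \<le> 1"
  shows "bump v < bump u"
proof (cases "v = 1")
  case True
  then show ?thesis using assms by (simp add: bump_def)
next
  case False
  then have v: "v < 1" using assms by simp
  have "u\<^sup>2 < v\<^sup>2" using assms by (intro power_strict_mono) auto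
  moreover have "v\<^sup>2 < 1" using assms v by (simp add: abs_square_less_1)
  ultimately have "1 / (1 - u\<^sup>2) < 1 / (1 - v\<^sup>2)" by (intro divide_strict_left_mono) auto
  then show ?thesis using assms v by (simp add: bump_def)
qed

lemma bump_abs: "bump \<bar>u\<bar> = bump u"
  by (simp add: bump_def)

lemma bump_eq_iff:
  assumes "u \<in> {-1..1}" "v \<in> {-1..1}"
  shows "bump u = bump v \<longleftrightarrow> \<bar>u\<bar> = \<bar>v\<bar>"
proof
  assume "bump u = bump v"
  then have "bump \<bar>u\<bar> = bump \<bar>v\<bar>" by (simp add: bump_abs)
  moreover have "\<bar>u\<bar> \<le> 1" "\<bar>v\<bar> \<le> 1" using assms by auto
  ultimately show "\<bar>u\<bar> = \<bar>v\<bar>"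
    using bump_strict_antimono[of "\<bar>u\<bar>" "\<bar>v\<bar>"] bump_strict_antimono[of "\<bar>v\<bar>" "\<bar>u\<bar>"] by linarith
next
  assume "\<bar>u\<bar> = \<bar>v\<bar>"
  then show "bump u = bump v" using bump_abs[of u] bump_abs[of v] by simp
qed

lemma bump_le_1: "u \<in> {-1..1} \<Longrightarrow> bump u \<le> 1"
  using bump_strict_antimono[of 0 "\<bar>u\<bar>"] bump_abs[of u] by (cases "u = 0") (auto simp: abs_le_iff)

lemma bump_derivative:
  assumes "-1 < u" "u < 1"
  shows "(bump has_real_derivative bump u * (- (2 * u) / (1 - u\<^sup>2)\<^sup>2)) (at u)"
proof (rule has_field_derivative_transform_within_open[of "\<lambda>u. exp (1 - 1 / (1 - u\<^sup>2))" _ _ "{-1<..<1}"])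
  have "1 - u\<^sup>2 \<noteq> 0" using assms by (auto simp: power2_eq_1_iff)
  then show "((\<lambda>u. exp (1 - 1 / (1 - u\<^sup>2))) has_real_derivative bump u * (- (2 * u) / (1 - u\<^sup>2)\<^sup>2)) (at u)"
    using assms by (auto intro!: derivative_eq_intros simp: bump_def power2_eq_square)
qed (use assms in \<open>auto simp: bump_def\<close>)

lemma bump_slope:
  assumes "-1 < u" "u < 1" "u \<noteq> 0"
  obtains b where "(bump has_real_derivative b) (at u)" "b > 0 \<longleftrightarrow> u < 0" "b < 0 \<longleftrightarrow> u > 0"
proof -
  have "bump u > 0" using assms by (simp add: bump_def)
  moreover have "u\<^sup>2 < 1" using assms by (simp add: abs_square_less_1)
  then have "(1 - u\<^sup>2)\<^sup>2 > 0" by simp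
  ultimately show thesis
    using bump_derivative[OF assms(1,2)] assms(3)
    by (intro that[of "bump u * (- (2 * u) / (1 - u\<^sup>2)\<^sup>2)"])
      (auto simp: zero_less_mult_iff mult_less_0_iff zero_less_divide_iff divide_less_0_iff)
qed

lemma bump_half:
  obtains w where "0 < w" "w < 1" "\<And>u. u \<in> {-1..1} \<Longrightarrow> bump u = 1/2 \<longleftrightarrow> u = w \<or> u = - w"
proof -
  \<comment> \<open>This \<open>w\<close> is the positive solution of
    \<open>1 - 1 / (1 - w\<^sup>2) = - ln 2\<close>, that is, of
    \<open>bump w = 1/2\<close>.\<close>
  define l where "l = ln (2::real)"
  define w where "w = sqrt (l / (1 + l))"
  have l: "l > 0" by (simp add: l_def)
  then have w: "0 < w" "w < 1" "w\<^sup>2 = l / (1 + l)" by (simp_all add: w_def)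
  have "1 - w\<^sup>2 = 1 / (1 + l)" using l by (simp add: w(3) field_simps)
  then have "1 - 1 / (1 - w\<^sup>2) = - ln 2" by (simp add: l_def)
  then have half: "bump w = 1/2" using w(1,2) by (simp add: bump_def exp_minus)
  have "bump u = 1/2 \<longleftrightarrow> u = w \<or> u = - w" if "u \<in> {-1..1}" for u
  proof -
    have "w \<in> {-1..1}" using w(1,2) by simp
    from bump_eq_iff[OF that this] show ?thesis unfolding half abs_eq_iff .
  qed
  then show thesis by (rule that[OF w(1,2)])
qed

text \<open>These are the parameters at which the third strand of a triangle meets the diagonals. A
  fixed point of \<open>bump u / 2\<close> exists by the intermediate value theorem, as
  \<open>bump 0 = 1\<close> and \<open>bump (1/2) < 1\<close>. It is unique because
  \<open>bump\<close> decreases on the positive side, and the second equation reduces to the first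
  since \<open>bump\<close> is even.\<close>

lemma bump_fixed:
  obtains w where "0 < w" "w < 1" "\<And>u. u \<in> {-1..1} \<Longrightarrow> bump u / 2 = u \<longleftrightarrow> u = w"
    "\<And>u. u \<in> {-1..1} \<Longrightarrow> - bump u / 2 = u \<longleftrightarrow> u = - w"
proof -
  have cont: "continuous_on {0..1/2} (\<lambda>u. u - bump u / 2)"
  proof (intro continuous_intros continuous_at_imp_continuous_on ballI)
    fix u :: real assume "u \<in> {0..1/2}"
    then have "-1 < u" "u < 1" by auto
    from bump_derivative[OF this] show "isCont bump u" by (rule DERIV_isCont)
  qed simp
  have "bump (1/2) < 1" using bump_strict_antimono[of 0 "1/2"] bump_zero by linarith
  then have "0 - bump 0 / 2 \<le> 0" "0 \<le> 1/2 - bump (1/2) / 2" "(0::real) \<le> 1/2"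
    unfolding bump_zero by linarith+
  from IVT'[OF this cont] obtain w where w: "0 \<le> w" "w \<le> 1/2" and "w - bump w / 2 = 0" by blast
  then have fixed: "bump w / 2 = w" by linarith
  have "w \<noteq> 0"
  proof
    assume "w = 0"
    then show False using fixed bump_zero by simp
  qed
  then have w0: "0 < w" "w < 1" using w by linarith+
  have 1: "bump u / 2 = u \<longleftrightarrow> u = w" if "u \<in> {-1..1}" for u
  proof
    assume u: "bump u / 2 = u"
    then have "0 \<le> u" using bump_nonneg[of u] by simp
    moreover have "u \<le> 1" using that by simp
    ultimately show "u = w"
      using bump_strict_antimono[of u w] bump_strict_antimono[of w u] u w fixed
      by (cases u w rule: linorder_cases) linarith+
  next
    assume "u = w"
    then show "bump u / 2 = u" using fixed by (simp only:)
  qed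
  have 2: "- bump u / 2 = u \<longleftrightarrow> u = - w" if "u \<in> {-1..1}" for u
  proof -
    have u: "- u \<in> {-1..1}" using that by simp
    have e1: "- bump u / 2 = u \<longleftrightarrow> bump u / 2 = - u" by (rule iffI) linarith+
    have e2: "bump u / 2 = - u \<longleftrightarrow> - u = w" using 1[OF u] unfolding bump_minus .
    have e3: "- u = w \<longleftrightarrow> u = - w" by (rule trans[OF minus_equation_iff eq_commute])
    show ?thesis by (rule trans[OF e1 trans[OF e2 e3]])
  qed
  show thesis by (rule that[OF w0 1 2])
qed

text \<open>Speaks about curves only, so that the geometry of a standard position is computed once
  and then transferred to all diagrams in that position. \<open>S\<close> describes the crossings as
  pairs of a curve with a parameter; one order of each pair is enough.\<close>

definition crossings :: "(real \<Rightarrow> complex) list \<Rightarrow> (nat \<Rightarrow> real) \<Rightarrow> (nat \<Rightarrow> real) \<Rightarrow>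
    ((nat \<times> real) \<times> (nat \<times> real)) set \<Rightarrow> bool" where
  "crossings cs b1 b2 S \<longleftrightarrow>
     (\<forall>m<length cs. -1 < b1 m \<and> b1 m < b2 m \<and> b2 m < 1 \<and> (\<forall>u\<in>{-1..1}. (cs ! m) u \<in> square)) \<and>
     (\<forall>m n u v. ((m, u), (n, v)) \<in> S \<longrightarrow> m < length cs \<and> n < length cs \<and>
        (u = b1 m \<or> u = b2 m) \<and> (v = b1 n \<or> v = b2 n)) \<and>
     (\<forall>m<length cs. \<forall>n<length cs. \<forall>u\<in>{-1..1}. \<forall>v\<in>{-1..1}.
        (cs ! m) u = (cs ! n) v \<and> (m, u) \<noteq> (n, v) \<longleftrightarrow> ((m, u), (n, v)) \<in> S \<or> ((n, v), (m, u)) \<in> S)"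

lemma crossingsD:
  assumes "crossings cs b1 b2 S"
  shows "m < length cs \<Longrightarrow> -1 < b1 m \<and> b1 m < b2 m \<and> b2 m < 1"
    and "m < length cs \<Longrightarrow> u \<in> {-1..1} \<Longrightarrow> (cs ! m) u \<in> square"
    and "((m, u), (n, v)) \<in> S \<Longrightarrow> m < length cs \<and> n < length cs \<and> (u = b1 m \<or> u = b2 m) \<and> (v = b1 n \<or> v = b2 n)"
    and "m < length cs \<Longrightarrow> n < length cs \<Longrightarrow> u \<in> {-1..1} \<Longrightarrow> v \<in> {-1..1} \<Longrightarrow>
      (cs ! m) u = (cs ! n) v \<and> (m, u) \<noteq> (n, v) \<longleftrightarrow> ((m, u), (n, v)) \<in> S \<or> ((n, v), (m, u)) \<in> S"
  using assms unfolding crossings_def by (blast, blast, blast, meson)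

lemma crossings_square_part:
  assumes diag: "diagram D" and sq: "in_square D ps cs" and cr: "crossings cs b1 b2 S"
  shows "square_part D ps cs b1 b2"
proof
  have len: "length ps = length cs" using sq by (simp add: in_square_def)
  show "diagram D" "in_square D ps cs" by fact+
  show "(cs ! m) u \<in> square" if "m < length ps" "u \<in> {-1..1}" for m u
    using crossingsD(2)[OF cr] that len by simp
  show "-1 < b1 m \<and> b1 m < b2 m \<and> b2 m < 1" if "m < length ps" for m
    using crossingsD(1)[OF cr] that len by simp
  show "u = b1 m \<or> u = b2 m"
    if m: "m < length ps" "n < length ps" "u \<in> {-1..1}" "v \<in> {-1..1}"
      and meets: "meets D (along (ps ! m) u) (along (ps ! n) v)" for m n u v
  proof -
    have "pos D (along (ps ! m) u) = (cs ! m) u" "pos D (along (ps ! n) v) = (cs ! n) v"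
      using sq m unfolding in_square_def by blast+
    then have "(cs ! m) u = (cs ! n) v \<and> (m, u) \<noteq> (n, v)"
      using meets unfolding meets_def by auto
    then have "((m, u), (n, v)) \<in> S \<or> ((n, v), (m, u)) \<in> S"
      using crossingsD(4)[OF cr, of m n u v] m len by simp
    then show ?thesis using crossingsD(3)[OF cr] by blast
  qed
qed

lemma local_change_square_change:
  assumes lc: "local_change ps cs cs' D D'" and cr: "crossings cs b1 b2 S" "crossings cs' b1' b2' S'"
  shows "square_change D D' ps cs cs' b1 b2 b1' b2'"
proof -
  have D: "diagram D" "diagram D'" "in_square D ps cs" "in_square D' ps cs'" "ncomp D' = ncomp D"
    and out: "\<And>P. P \<in> passages D \<Longrightarrow> pos D P \<notin> square \<Longrightarrow> pos D' P = pos D P \<and> kind D' P = kind D P"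
    using lc unfolding local_change_def by blast+
  interpret old: square_part D ps cs b1 b2 by (rule crossings_square_part[OF D(1,3) cr(1)])
  interpret new: square_part D' ps cs' b1' b2' by (rule crossings_square_part[OF D(2,4) cr(2)])
  show ?thesis by unfold_locales (use D(5) out in auto)
qed

lemma has_vector_derivative_Complex:
  assumes "(f has_real_derivative f') (at u)" "(g has_real_derivative g') (at u)"
  shows "((\<lambda>u. Complex (f u) (g u)) has_vector_derivative Complex f' g') (at u)"
  using assms by (simp add: has_vector_derivative_complex_iff)

context oriented_singquandle
begin

definition crossing_rel :: "passage_kind \<Rightarrow> bool \<Rightarrow> bool \<Rightarrow> bool \<Rightarrow> 'a \<Rightarrow> 'a \<Rightarrow> 'a \<Rightarrow> 'a \<Rightarrow> bool" where
  "crossing_rel k = (if k = Singular then singular else classical k)"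

lemma crossing_ok_iff:
  assumes sq: "square_part D ps cs b1 b2" and S: "crossings cs b1 b2 S" "((m, u), (n, v)) \<in> S"
    and X: "\<forall>m<length ps. \<forall>k<3. c m k \<in> X"
    and d: "(cs ! m has_vector_derivative d) (at u)" "(cs ! n has_vector_derivative e) (at v)" "cdet d e \<noteq> 0"
  shows "crossing_ok D ps b1 b2 c (m, u) (n, v) \<and> crossing_ok D ps b1 b2 c (n, v) (m, u) \<longleftrightarrow>
    crossing_rel (kind D (along (ps ! m) u)) (snd (snd (ps ! m)) > 0) (snd (snd (ps ! n)) > 0) (cdet d e > 0)
      (c m (seg_before (b1 m) (b2 m) u)) (c m (seg_after (b1 m) (b2 m) u))
      (c n (seg_before (b1 n) (b2 n) v)) (c n (seg_after (b1 n) (b2 n) v))"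
proof -
  interpret square_part D ps cs b1 b2 by (rule sq)
  have len: "length ps = length cs" using in_sq by (simp add: in_square_def)
  have r: "m < length ps" "n < length ps" "u = b1 m \<or> u = b2 m" "v = b1 n \<or> v = b2 n"
    using crossingsD(3)[OF S] len by simp_all
  then have uv: "-1 < u" "u < 1" "-1 < v" "v < 1" using breaks[of m] breaks[of n] by auto
  then have uv': "u \<in> {-1..1}" "v \<in> {-1..1}" by auto
  have "(cs ! m) u = (cs ! n) v \<and> (m, u) \<noteq> (n, v)"
    using crossingsD(4)[OF S(1), of m n u v] S(2) r(1,2) uv' len by simp
  then have "meets D (along (ps ! m) u) (along (ps ! n) v)"
    using meets_iff[OF r(1,2) uv'] by blast
  then have k: "kind D (along (ps ! n) v) = opposite (kind D (along (ps ! m) u))"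
    using diag unfolding diagram_def by blast
  show ?thesis
  proof (cases "kind D (along (ps ! m) u) = Singular")
    case True
    show ?thesis unfolding crossing_rel_def if_P[OF True]
      by (rule crossing_ok_singular[OF sq r(1) uv(1,2) r(2) uv(3,4) d True _ refl refl refl refl]) (use k True in simp)
  next
    case False
    show ?thesis unfolding crossing_rel_def if_not_P[OF False]
      by (rule crossing_ok_classical[OF sq r(1) uv(1,2) r(2) uv(3,4) d False k _ _ _ _ refl refl refl refl])
        (use X r seg_less_3 in auto)
  qed
qed

lemma local_coloring_iff:
  assumes sq: "square_part D ps cs b1 b2" and S: "crossings cs b1 b2 S"
    and involved: "\<And>m. m < length ps \<Longrightarrow> (m, b1 m) \<in> fst ` S \<union> snd ` S \<and> (m, b2 m) \<in> fst ` S \<union> snd ` S"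
  shows "local_coloring X star R1 R2 D ps b1 b2 c \<longleftrightarrow> (\<forall>m<length ps. \<forall>k<3. c m k \<in> X) \<and>
    (\<forall>(p, q)\<in>S. crossing_ok D ps b1 b2 c p q \<and> crossing_ok D ps b1 b2 c q p)"
proof (rule local_coloring_iff_crossings[OF sq _ _ involved])
  interpret square_part D ps cs b1 b2 by (rule sq)
  have len: "length ps = length cs" using in_sq by (simp add: in_square_def)
  show "(cs ! m) u = (cs ! n) v \<and> (m, u) \<noteq> (n, v) \<longleftrightarrow> ((m, u), (n, v)) \<in> S \<or> ((n, v), (m, u)) \<in> S"
    if "m < length ps" "n < length ps" "u \<in> {-1..1}" "v \<in> {-1..1}" for m n u v
    using crossingsD(4)[OF S, of m n u v] that len by simp
  fix m n u v assume "((m, u), (n, v)) \<in> S"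
  then have r: "m < length ps" "n < length ps" "u = b1 m \<or> u = b2 m" "v = b1 n \<or> v = b2 n"
    using crossingsD(3)[OF S, of m u n v] len by simp_all
  then show "m < length ps \<and> n < length ps \<and> u \<in> {-1..1} \<and> v \<in> {-1..1}"
    using breaks[of m] breaks[of n] by auto
qed

end

section \<open>Algebra of the moves\<close>

context oriented_singquandle
begin

text \<open>Following both strands backwards turns the translation at the crossing into its inverse.
  This makes the second crossing of a bigon undo the first.\<close>

lemma classical_flip:
  assumes "x \<in> X" "x' \<in> X" "y \<in> X" "y' \<in> X"
  shows "classical k ep eq left x x' y y' \<longleftrightarrow> classical k ep eq (\<not> left) x' x y' y"
proof (cases "k = Over")
  case True
  have *: "(x' = x \<and> y' = act e y x) \<longleftrightarrow> (x = x' \<and> y = act (\<not> e) y' x')" for e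
    using act_eq_iff[OF assms(3,4,1), of e] by metis
  have e: "(ep = (\<not> left)) = (\<not> (ep = left))" by blast
  show ?thesis unfolding classical_def if_P[OF True] e by (rule *)
next
  case False
  have *: "(y' = y \<and> x' = act e x y) \<longleftrightarrow> (y = y' \<and> x = act (\<not> e) x' y')" for e
    using act_eq_iff[OF assms(1,2,3), of e] by metis
  have e: "(eq \<noteq> (\<not> left)) = (\<not> (eq \<noteq> left))" by blast
  show ?thesis unfolding classical_def if_not_P[OF False] e by (rule *)
qed

text \<open>If the first passage is the lower one, then \<open>x'\<close> is the translate of
  \<open>x\<close> by \<open>x'\<close>. By idempotence \<open>x'\<close> is also its own translate
  by \<open>x'\<close>, and cancellation gives \<open>x' = x\<close>.\<close>

lemma classical_kink:
  assumes "x \<in> X" "x' \<in> X" "x'' \<in> X"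
  shows "classical k e e left x x' x' x'' \<longleftrightarrow> x' = x \<and> x'' = x"
proof (cases "k = Over")
  case True
  show ?thesis unfolding classical_def if_P[OF True] using act_idem assms by metis
next
  case False
  show ?thesis unfolding classical_def if_not_P[OF False] using act_idem act_cancel assms by metis
qed

text \<open>The two excluded patterns are the cyclic ones, which no heights realize. The remaining
  six are the orders of three strands; in each of them the upper strands agree by direct
  substitution, and the color of the lowest strand is an instance of distributivity.\<close>

lemma yang_baxter:
  assumes X: "x0 \<in> X" "y0 \<in> X" "z0 \<in> X"
    and k: "\<not> (kpq = Over \<and> kqr = Over \<and> kpr \<noteq> Over)" "\<not> (kpq \<noteq> Over \<and> kqr \<noteq> Over \<and> kpr = Over)"
    and 1: "classical kqr eq er True y0 y1 z0 z1" "classical kpq ep eq False x0 x1 y1 y2"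
      "classical kpr ep er False x1 x2 z1 z2"
    and 2: "classical kpr ep er False x0 u z0 t" "classical kpq ep eq False u x' y0 v"
      "classical kqr eq er True v y' t z'"
  shows "x' = x2 \<and> y' = y2 \<and> z' = z2"
proof -
  note d = act_distrib_star
  consider "kpq = Over" "kpr = Over" "kqr = Over" | "kpq = Over" "kpr = Over" "kqr \<noteq> Over"
    | "kpq = Over" "kpr \<noteq> Over" "kqr \<noteq> Over" | "kpq \<noteq> Over" "kpr \<noteq> Over" "kqr \<noteq> Over"
    | "kpq \<noteq> Over" "kpr \<noteq> Over" "kqr = Over" | "kpq \<noteq> Over" "kpr = Over" "kqr = Over"
    using k by blast
  then show ?thesis
  proof cases
    case 1
    then show ?thesis using assms(6-11) d[of z0 y0 x0 "\<not> ep" eq] X by (simp add: classical_def)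
  next
    case 2
    then show ?thesis using assms(6-11) d[of y0 z0 x0 "\<not> ep" "\<not> er"] X by (simp add: classical_def)
  next
    \<comment> \<open>On the side where the lowest strand meets the middle one first, the latter has
      already passed below the top one, so the instance starts from its translated color.\<close>
    case 3
    then show ?thesis using assms(6-11) d[of y0 "act er x0 z0" z0 "\<not> er" "\<not> ep"] X by (simp add: classical_def)
  next
    case 4
    then show ?thesis using assms(6-11) d[of x0 "act (\<not> er) y0 z0" z0 er eq] X by (simp add: classical_def)
  next
    case 5
    then show ?thesis using assms(6-11) d[of x0 z0 y0 eq er] X by (simp add: classical_def)
  next
    case 6
    then show ?thesis using assms(6-11) d[of z0 x0 y0 eq "\<not> ep"] X by (simp add: classical_def)
  qed
qed

text \<open>The segment indices encode the order of the crossings. With the third strand above,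
  \<open>p\<close> meets \<open>q\<close> before \<open>r\<close>, \<open>q\<close> meets
  \<open>r\<close> before \<open>p\<close>, and \<open>r\<close> meets \<open>q\<close> before
  \<open>p\<close>; with the third strand below, each of these orders is reversed.\<close>

definition triangle_above :: "passage_kind \<Rightarrow> passage_kind \<Rightarrow> passage_kind \<Rightarrow> bool \<Rightarrow> bool \<Rightarrow> bool \<Rightarrow> (nat \<Rightarrow> nat \<Rightarrow> 'a) \<Rightarrow> bool" where
  "triangle_above kpq kpr kqr ep eq er c \<longleftrightarrow> crossing_rel kpq ep eq False (c 0 0) (c 0 1) (c 1 1) (c 1 2) \<and>
     crossing_rel kpr ep er False (c 0 1) (c 0 2) (c 2 1) (c 2 2) \<and>
     crossing_rel kqr eq er True (c 1 0) (c 1 1) (c 2 0) (c 2 1)"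

definition triangle_below :: "passage_kind \<Rightarrow> passage_kind \<Rightarrow> passage_kind \<Rightarrow> bool \<Rightarrow> bool \<Rightarrow> bool \<Rightarrow> (nat \<Rightarrow> nat \<Rightarrow> 'a) \<Rightarrow> bool" where
  "triangle_below kpq kpr kqr ep eq er c \<longleftrightarrow> crossing_rel kpq ep eq False (c 0 1) (c 0 2) (c 1 0) (c 1 1) \<and>
     crossing_rel kpr ep er False (c 0 0) (c 0 1) (c 2 0) (c 2 1) \<and>
     crossing_rel kqr eq er True (c 1 1) (c 1 2) (c 2 1) (c 2 2)"

text \<open>What moves 3 and 4 have in common. At a singular crossing of the diagonals the third
  strand is over both or under both of them; otherwise the cyclic patterns are excluded.\<close>

definition compatible_kinds :: "passage_kind \<Rightarrow> passage_kind \<Rightarrow> passage_kind \<Rightarrow> bool" where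
  "compatible_kinds kpq kpr kqr \<longleftrightarrow> kpr \<noteq> Singular \<and> kqr \<noteq> Singular \<and>
     (if kpq = Singular then kpr = kqr
      else \<not> (kpq = Over \<and> kqr = Over \<and> kpr \<noteq> Over) \<and> \<not> (kpq \<noteq> Over \<and> kqr \<noteq> Over \<and> kpr = Over))"

definition replace_middle :: "(nat \<Rightarrow> nat \<Rightarrow> 'a) \<Rightarrow> 'a list \<Rightarrow> nat \<Rightarrow> nat \<Rightarrow> 'a" where
  "replace_middle c xs m k = (if k = 1 then xs ! m else c m k)"

lemma replace_middle_simps [simp]:
  "replace_middle c xs m 0 = c m 0" "replace_middle c xs m 2 = c m 2"
  "replace_middle c xs m (Suc 0) = xs ! m"
  by (simp_all add: replace_middle_def)

lemma replace_middle_in: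
  assumes "\<forall>m<n. \<forall>k<3. c m k \<in> X" "\<forall>m<n. xs ! m \<in> X"
  shows "\<forall>m<n. \<forall>k<3. replace_middle c xs m k \<in> X"
  using assms by (simp add: replace_middle_def)

text \<open>With three classical crossings, the new picture is solved starting from the initial
  colors, and \<open>yang_baxter\<close> shows that the prescribed final colors come out. With a
  singular crossing, explicit middle colors are given.\<close>

lemma triangle_slide:
  assumes X: "\<forall>m<3. \<forall>k<3. c m k \<in> X" and k: "compatible_kinds kpq kpr kqr"
  shows "triangle_above kpq kpr kqr ep eq er c \<Longrightarrow>
      \<exists>xs. (\<forall>m<3. xs ! m \<in> X) \<and> triangle_below kpq kpr kqr ep eq er (replace_middle c xs)"
    and "triangle_below kpq kpr kqr ep eq er c \<Longrightarrow>
      \<exists>xs. (\<forall>m<3. xs ! m \<in> X) \<and> triangle_above kpq kpr kqr ep eq er (replace_middle c xs)"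
proof -
  have X0: "c 0 0 \<in> X" "c 0 1 \<in> X" "c 0 2 \<in> X" "c 1 0 \<in> X" "c 1 1 \<in> X" "c 1 2 \<in> X"
    "c 2 0 \<in> X" "c 2 1 \<in> X" "c 2 2 \<in> X"
    using X by simp_all
  have kk: "crossing_rel kpr = classical kpr" "crossing_rel kqr = classical kqr"
    using k by (simp_all add: compatible_kinds_def crossing_rel_def)
  have three: "\<forall>m<3. [x, y, z] ! m \<in> X" if "x \<in> X" "y \<in> X" "z \<in> X" for x y z
    using that by (simp add: numeral_3_eq_3 All_less_Suc)
  {
    assume a: "triangle_above kpq kpr kqr ep eq er c"
    then have qr: "classical kqr eq er True (c 1 0) (c 1 1) (c 2 0) (c 2 1)"
      and pr: "classical kpr ep er False (c 0 1) (c 0 2) (c 2 1) (c 2 2)"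
      and pq: "crossing_rel kpq ep eq False (c 0 0) (c 0 1) (c 1 1) (c 1 2)"
      by (simp_all only: triangle_above_def kk)
    have "\<exists>u\<in>X. \<exists>v\<in>X. \<exists>t\<in>X. crossing_rel kpq ep eq False u (c 0 2) (c 1 0) v \<and>
      classical kpr ep er False (c 0 0) u (c 2 0) t \<and> classical kqr eq er True v (c 1 2) t (c 2 2)"
    proof (cases "kpq = Singular")
      case False
      then have cpq: "crossing_rel kpq = classical kpq" by (simp add: crossing_rel_def)
      obtain u t where ut: "u \<in> X" "t \<in> X" "classical kpr ep er False (c 0 0) u (c 2 0) t"
        using classical_ex(1)[OF X0(1,7)] by blast
      obtain x' v where v: "x' \<in> X" "v \<in> X" "classical kpq ep eq False u x' (c 1 0) v"
        using classical_ex(1)[OF ut(1) X0(4)] by blast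
      obtain y' z' where y: "y' \<in> X" "z' \<in> X" "classical kqr eq er True v y' t z'"
        using classical_ex(1)[OF v(2) ut(2)] by blast
      have "x' = c 0 2 \<and> y' = c 1 2 \<and> z' = c 2 2"
        by (rule yang_baxter[OF X0(1,4,7) _ _ qr pq[unfolded cpq] pr ut(3) v(3) y(3)])
          (use k False in \<open>simp_all add: compatible_kinds_def\<close>)
      then show ?thesis using ut v y unfolding cpq by blast
    next
      case True
      then have s: "crossing_rel kpq = singular" and kpr: "kpr = kqr"
        using k by (simp_all add: crossing_rel_def compatible_kinds_def)
      show ?thesis
      proof (cases "kqr = Over")
        case True
        \<comment> \<open>The third strand passes under both diagonals, so the colors at the
          singular crossing do not change; only the final color of the third strand has to be
          compared, by \<open>act_singular\<close>.\<close>
        have e: "c 1 1 = c 1 0" "c 2 1 = act eq (c 2 0) (c 1 0)" "c 0 2 = c 0 1" "c 2 2 = act (\<not> ep) (c 2 1) (c 0 1)"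
          using qr pr unfolding kpr classical_def if_P[OF True] by simp_all
        have "c 2 2 = act eq (act (\<not> ep) (c 2 0) (c 0 0)) (c 1 2)"
          using act_singular[OF X0(1,2,5,6,7) pq[unfolded s]] unfolding e(4) e(2) e(1) .
        then have "classical kqr eq er True (c 1 2) (c 1 2) (act (\<not> ep) (c 2 0) (c 0 0)) (c 2 2)"
          unfolding classical_def if_P[OF True] by simp
        moreover have "classical kpr ep er False (c 0 0) (c 0 0) (c 2 0) (act (\<not> ep) (c 2 0) (c 0 0))"
          unfolding kpr classical_def if_P[OF True] by simp
        moreover have "singular ep eq False (c 0 0) (c 0 2) (c 1 0) (c 1 2)"
          using pq[unfolded s] unfolding e(1,3) .
        ultimately show ?thesis unfolding s using X0 act_closed by blast
      next
        case False
        \<comment> \<open>The third strand passes over both diagonals and keeps its color; moving it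
          translates the four colors at the singular crossing by that color.\<close>
        have e: "c 2 1 = c 2 0" "c 1 1 = act (\<not> er) (c 1 0) (c 2 0)" "c 2 2 = c 2 1" "c 0 2 = act er (c 0 1) (c 2 1)"
          using qr pr unfolding kpr classical_def if_not_P[OF False] by simp_all
        have "act er (c 1 1) (c 2 0) = c 1 0" unfolding e(2) by (rule act_act(2)[OF X0(4,7)])
        then have "singular ep eq False (act er (c 0 0) (c 2 0)) (c 0 2) (c 1 0) (act er (c 1 2) (c 2 0))"
          using singular_equivariant[OF X0(1,2,5,6,7) pq[unfolded s], of er] unfolding e(4) e(1) by simp
        moreover have "classical kqr eq er True (act er (c 1 2) (c 2 0)) (c 1 2) (c 2 0) (c 2 2)"
          using act_act(1)[OF X0(6,7), of er] unfolding classical_def if_not_P[OF False] e(3) e(1) by simp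
        moreover have "classical kpr ep er False (c 0 0) (act er (c 0 0) (c 2 0)) (c 2 0) (c 2 0)"
          unfolding kpr classical_def if_not_P[OF False] by simp
        ultimately show ?thesis unfolding s using X0 act_closed by blast
      qed
    qed
    then obtain u v t where *: "u \<in> X" "v \<in> X" "t \<in> X" "crossing_rel kpq ep eq False u (c 0 2) (c 1 0) v"
      "classical kpr ep er False (c 0 0) u (c 2 0) t" "classical kqr eq er True v (c 1 2) t (c 2 2)" by blast
    have "triangle_below kpq kpr kqr ep eq er (replace_middle c [u, v, t])"
      unfolding triangle_below_def kk using *(4-6) by simp
    then show "\<exists>xs. (\<forall>m<3. xs ! m \<in> X) \<and> triangle_below kpq kpr kqr ep eq er (replace_middle c xs)"
      using three[OF *(1-3)] by blast
  }
  {
    assume a: "triangle_below kpq kpr kqr ep eq er c"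
    then have qr: "classical kqr eq er True (c 1 1) (c 1 2) (c 2 1) (c 2 2)"
      and pr: "classical kpr ep er False (c 0 0) (c 0 1) (c 2 0) (c 2 1)"
      and pq: "crossing_rel kpq ep eq False (c 0 1) (c 0 2) (c 1 0) (c 1 1)"
      by (simp_all only: triangle_below_def kk)
    have "\<exists>x\<in>X. \<exists>y\<in>X. \<exists>z\<in>X. crossing_rel kpq ep eq False (c 0 0) x y (c 1 2) \<and>
      classical kpr ep er False x (c 0 2) z (c 2 2) \<and> classical kqr eq er True (c 1 0) y (c 2 0) z"
    proof (cases "kpq = Singular")
      case False
      then have cpq: "crossing_rel kpq = classical kpq" by (simp add: crossing_rel_def)
      obtain y1 z1 where y: "y1 \<in> X" "z1 \<in> X" "classical kqr eq er True (c 1 0) y1 (c 2 0) z1"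
        using classical_ex(1)[OF X0(4,7)] by blast
      obtain x1 y2 where x: "x1 \<in> X" "y2 \<in> X" "classical kpq ep eq False (c 0 0) x1 y1 y2"
        using classical_ex(1)[OF X0(1) y(1)] by blast
      obtain x2 z2 where z: "x2 \<in> X" "z2 \<in> X" "classical kpr ep er False x1 x2 z1 z2"
        using classical_ex(1)[OF x(1) y(2)] by blast
      have "c 0 2 = x2 \<and> c 1 2 = y2 \<and> c 2 2 = z2"
        by (rule yang_baxter[OF X0(1,4,7) _ _ y(3) x(3) z(3) pr pq[unfolded cpq] qr])
          (use k False in \<open>simp_all add: compatible_kinds_def\<close>)
      then show ?thesis using x y z unfolding cpq by blast
    next
      case True
      then have s: "crossing_rel kpq = singular" and kpr: "kpr = kqr"
        using k by (simp_all add: crossing_rel_def compatible_kinds_def)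
      show ?thesis
      proof (cases "kqr = Over")
        case True
        have e: "c 1 2 = c 1 1" "c 2 2 = act eq (c 2 1) (c 1 1)" "c 0 1 = c 0 0" "c 2 1 = act (\<not> ep) (c 2 0) (c 0 0)"
          using qr pr unfolding kpr classical_def if_P[OF True] by simp_all
        have "c 2 2 = act (\<not> ep) (act eq (c 2 0) (c 1 0)) (c 0 2)"
          using act_singular[OF X0(2,3,4,5,7) pq[unfolded s], symmetric] unfolding e(2) e(4) e(3) .
        then have "classical kpr ep er False (c 0 2) (c 0 2) (act eq (c 2 0) (c 1 0)) (c 2 2)"
          unfolding kpr classical_def if_P[OF True] by simp
        moreover have "classical kqr eq er True (c 1 0) (c 1 0) (c 2 0) (act eq (c 2 0) (c 1 0))"
          unfolding classical_def if_P[OF True] by simp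
        moreover have "singular ep eq False (c 0 0) (c 0 2) (c 1 0) (c 1 2)"
          using pq[unfolded s] unfolding e(1,3) .
        ultimately show ?thesis unfolding s using X0 act_closed by blast
      next
        case False
        have e: "c 2 2 = c 2 1" "c 1 2 = act (\<not> er) (c 1 1) (c 2 1)" "c 2 1 = c 2 0" "c 0 1 = act er (c 0 0) (c 2 0)"
          using qr pr unfolding kpr classical_def if_not_P[OF False] by simp_all
        have "act (\<not> er) (c 0 1) (c 2 0) = c 0 0" unfolding e(4) by (rule act_act(1)[OF X0(1,7)])
        then have "singular ep eq False (c 0 0) (act (\<not> er) (c 0 2) (c 2 0)) (act (\<not> er) (c 1 0) (c 2 0)) (c 1 2)"
          using singular_equivariant[OF X0(2,3,4,5,7) pq[unfolded s], of "\<not> er"] unfolding e(2) e(3) by simp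
        moreover have "classical kpr ep er False (act (\<not> er) (c 0 2) (c 2 0)) (c 0 2) (c 2 0) (c 2 2)"
          using act_act(2)[OF X0(3,7), of er] unfolding kpr classical_def if_not_P[OF False] e(1) e(3) by simp
        moreover have "classical kqr eq er True (c 1 0) (act (\<not> er) (c 1 0) (c 2 0)) (c 2 0) (c 2 0)"
          unfolding classical_def if_not_P[OF False] by simp
        ultimately show ?thesis unfolding s using X0 act_closed by blast
      qed
    qed
    then obtain x y z where *: "x \<in> X" "y \<in> X" "z \<in> X" "crossing_rel kpq ep eq False (c 0 0) x y (c 1 2)"
      "classical kpr ep er False x (c 0 2) z (c 2 2)" "classical kqr eq er True (c 1 0) y (c 2 0) z" by blast
    have "triangle_above kpq kpr kqr ep eq er (replace_middle c [x, y, z])"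
      unfolding triangle_above_def kk using *(4-6) by simp
    then show "\<exists>xs. (\<forall>m<3. xs ! m \<in> X) \<and> triangle_above kpq kpr kqr ep eq er (replace_middle c xs)"
      using three[OF *(1-3)] by blast
  }
qed

text \<open>A classical crossing can be solved from either side. So the two crossings with the third
  strand yield the middle colors, one from the initial and the other from the final colors, even if
  the diagonals cross in a singular point.\<close>

lemma triangle_determined:
  assumes X: "\<forall>m<3. \<forall>k<3. c m k \<in> X" "\<forall>m<3. \<forall>k<3. d m k \<in> X"
    and k: "compatible_kinds kpq kpr kqr"
    and cd: "\<forall>m<3. c m 0 = d m 0 \<and> c m 2 = d m 2"
  shows "triangle_above kpq kpr kqr ep eq er c \<Longrightarrow> triangle_above kpq kpr kqr ep eq er d \<Longrightarrow> \<forall>m<3. c m 1 = d m 1"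
    and "triangle_below kpq kpr kqr ep eq er c \<Longrightarrow> triangle_below kpq kpr kqr ep eq er d \<Longrightarrow> \<forall>m<3. c m 1 = d m 1"
proof -
  have XX: "c m k \<in> X" "d m k \<in> X" if "m < 3" "k < 3" for m k using X that by blast+
  have e: "c m 0 = d m 0" "c m 2 = d m 2" if "m < 3" for m using cd that by blast+
  have three: "\<forall>m<3. c m 1 = d m 1" if "c 0 1 = d 0 1" "c 1 1 = d 1 1" "c 2 1 = d 2 1"
    using that by (simp add: numeral_3_eq_3 All_less_Suc numeral_2_eq_2)
  have kk: "crossing_rel kpr = classical kpr" "crossing_rel kqr = classical kqr"
    using k by (simp_all add: compatible_kinds_def crossing_rel_def)
  {
    assume c: "triangle_above kpq kpr kqr ep eq er c" and d: "triangle_above kpq kpr kqr ep eq er d"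
    have qr: "classical kqr eq er True (c 1 0) (c 1 1) (c 2 0) (c 2 1)" "classical kqr eq er True (c 1 0) (d 1 1) (c 2 0) (d 2 1)"
      and pr: "classical kpr ep er False (c 0 1) (c 0 2) (c 2 1) (c 2 2)" "classical kpr ep er False (d 0 1) (c 0 2) (d 2 1) (c 2 2)"
      using c d e by (simp_all add: triangle_above_def kk)
    show "\<forall>m<3. c m 1 = d m 1"
      using classical_determined(1)[OF _ _ _ _ _ _ qr] classical_determined(2)[OF _ _ _ _ _ _ pr] XX by (intro three) simp_all
  }
  {
    assume c: "triangle_below kpq kpr kqr ep eq er c" and d: "triangle_below kpq kpr kqr ep eq er d"
    have qr: "classical kqr eq er True (c 1 1) (c 1 2) (c 2 1) (c 2 2)" "classical kqr eq er True (d 1 1) (c 1 2) (d 2 1) (c 2 2)"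
      and pr: "classical kpr ep er False (c 0 0) (c 0 1) (c 2 0) (c 2 1)" "classical kpr ep er False (c 0 0) (d 0 1) (c 2 0) (d 2 1)"
      using c d e by (simp_all add: triangle_below_def kk)
    show "\<forall>m<3. c m 1 = d m 1"
      using classical_determined(2)[OF _ _ _ _ _ _ qr] classical_determined(1)[OF _ _ _ _ _ _ pr] XX by (intro three) simp_all
  }
qed

end

section \<open>Crossings and tangents of the standard curves\<close>

lemma crossingsI:
  assumes "\<And>m. m < length cs \<Longrightarrow> -1 < b1 m \<and> b1 m < b2 m \<and> b2 m < 1"
    and "\<And>m u. m < length cs \<Longrightarrow> u \<in> {-1..1} \<Longrightarrow> (cs ! m) u \<in> square"
    and "\<And>m n u v. ((m, u), (n, v)) \<in> S \<Longrightarrow> m < length cs \<and> n < length cs \<and>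
        (u = b1 m \<or> u = b2 m) \<and> (v = b1 n \<or> v = b2 n)"
    and iff: "\<And>m n u v. m \<le> n \<Longrightarrow> n < length cs \<Longrightarrow> u \<in> {-1..1} \<Longrightarrow> v \<in> {-1..1} \<Longrightarrow>
        (cs ! m) u = (cs ! n) v \<and> (m, u) \<noteq> (n, v) \<longleftrightarrow> ((m, u), (n, v)) \<in> S \<or> ((n, v), (m, u)) \<in> S"
  shows "crossings cs b1 b2 S"
  unfolding crossings_def
proof (intro conjI)
  show "\<forall>m<length cs. \<forall>n<length cs. \<forall>u\<in>{-1..1}. \<forall>v\<in>{-1..1}.
        (cs ! m) u = (cs ! n) v \<and> (m, u) \<noteq> (n, v) \<longleftrightarrow> ((m, u), (n, v)) \<in> S \<or> ((n, v), (m, u)) \<in> S"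
  proof (intro allI ballI impI)
    fix m n and u v :: real
    assume *: "m < length cs" "n < length cs" "u \<in> {-1..1}" "v \<in> {-1..1}"
    show "(cs ! m) u = (cs ! n) v \<and> (m, u) \<noteq> (n, v) \<longleftrightarrow> ((m, u), (n, v)) \<in> S \<or> ((n, v), (m, u)) \<in> S"
    proof (cases "m \<le> n")
      case True
      show ?thesis by (rule iff[OF True *(2-4)])
    next
      case False
      then have "n \<le> m" by simp
      from iff[OF this *(1,4,3)] show ?thesis by metis
    qed
  qed
qed (use assms(1-3) in blast)+

abbreviation bigon :: "(real \<Rightarrow> complex) list" where
  "bigon \<equiv> [\<lambda>u. Complex u (1/2 - bump u), \<lambda>u. Complex u (bump u - 1/2)]"

abbreviation curl :: "(real \<Rightarrow> complex) list" where
  "curl \<equiv> [\<lambda>u. Complex (u * (1 - 2 * bump u)) (bump u / 2)]"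

abbreviation above :: "(real \<Rightarrow> complex) list" where
  "above \<equiv> [\<lambda>u. Complex u u, \<lambda>u. Complex u (- u), \<lambda>u. Complex u (bump u / 2)]"

abbreviation below :: "(real \<Rightarrow> complex) list" where
  "below \<equiv> [\<lambda>u. Complex u u, \<lambda>u. Complex u (- u), \<lambda>u. Complex u (- bump u / 2)]"

lemma Complex_in_square: "Complex x y \<in> square \<longleftrightarrow> \<bar>x\<bar> \<le> 1 \<and> \<bar>y\<bar> \<le> 1"
  by (simp add: square_def)

lemma less_2E: "m < Suc (Suc 0) \<Longrightarrow> m = 0 \<or> m = Suc 0"
  and less_3E: "m < Suc (Suc (Suc 0)) \<Longrightarrow> m = 0 \<or> m = Suc 0 \<or> m = Suc (Suc 0)"
  by auto

text \<open>The line has no crossings. Its breaks are arbitrary and only cut it into as many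
  segments as the curl.\<close>

lemma crossings_line: "crossings [\<lambda>u. Complex u 0] (\<lambda>_. -1/2) (\<lambda>_. 1/2) {}"
  by (rule crossingsI) (auto simp: Complex_in_square)

lemma crossings_two_lines:
  "crossings [\<lambda>u. Complex u (1/2), \<lambda>u. Complex u (-1/2)] (\<lambda>_. -1/2) (\<lambda>_. 1/2) {}"
proof (rule crossingsI)
  fix m n and u v :: real
  assume "m \<le> n" "n < length [\<lambda>u. Complex u (1/2), \<lambda>u. Complex u (-1/2)]"
  then have "(m = 0 \<and> n = 0) \<or> (m = 0 \<and> n = 1) \<or> (m = 1 \<and> n = 1)" by (auto dest: less_2E)
  then show "([\<lambda>u. Complex u (1/2), \<lambda>u. Complex u (-1/2)] ! m) u = ([\<lambda>u. Complex u (1/2), \<lambda>u. Complex u (-1/2)] ! n) v \<and> (m, u) \<noteq> (n, v) \<longleftrightarrow>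
      ((m, u), (n, v)) \<in> {} \<or> ((n, v), (m, u)) \<in> {}"
    by (elim disjE conjE) simp_all
qed (auto simp: Complex_in_square dest!: less_2E)

context
  fixes w :: real
  assumes w: "0 < w" "w < 1" and half: "\<forall>u\<in>{-1..1}. bump u = 1/2 \<longleftrightarrow> u = w \<or> u = - w"
begin

lemma half_w: "bump w = 1/2" "bump (- w) = 1/2"
  using half[rule_format, of w] w by simp_all

text \<open>The abscissa of each curve is its parameter, so meeting points have equal parameters,
  and the ordinates agree exactly where \<open>bump\<close> is 1/2.\<close>

lemma crossings_bigon:
  "crossings bigon (\<lambda>_. -w) (\<lambda>_. w) {((0, -w), (1, -w)), ((0, w), (1, w))}"
proof (rule crossingsI)
  fix m n and u v :: real
  assume mn: "m \<le> n" "n < length bigon" and u: "u \<in> {-1..1}" and v: "v \<in> {-1..1}"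
  then have "(m = 0 \<and> n = 0) \<or> (m = 0 \<and> n = 1) \<or> (m = 1 \<and> n = 1)" by (auto dest: less_2E)
  moreover have "Complex u (1/2 - bump u) = Complex v (bump v - 1/2) \<longleftrightarrow> (u = -w \<and> v = -w) \<or> (u = w \<and> v = w)"
  proof (cases "u = v")
    case True
    have "Complex v (1/2 - bump v) = Complex v (bump v - 1/2) \<longleftrightarrow> bump v = 1/2"
      unfolding complex.inject by (intro iffI conjI) linarith+
    then show ?thesis unfolding True half[rule_format, OF v] by blast
  next
    case False
    then show ?thesis by auto
  qed
  ultimately show "(bigon ! m) u = (bigon ! n) v \<and> (m, u) \<noteq> (n, v) \<longleftrightarrow>
      ((m, u), (n, v)) \<in> {((0, -w), (1, -w)), ((0, w), (1, w))} \<or> ((n, v), (m, u)) \<in> {((0, -w), (1, -w)), ((0, w), (1, w))}"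
    by (elim disjE conjE) simp_all
next
  fix m and u :: real assume "m < length bigon" and u: "u \<in> {-1..1}"
  then have "m = 0 \<or> m = 1" by (auto dest: less_2E)
  moreover have "\<bar>1/2 - bump u\<bar> \<le> 1" "\<bar>bump u - 1/2\<bar> \<le> 1" "\<bar>u\<bar> \<le> 1"
    using bump_nonneg[of u] bump_le_1[OF u] u by auto
  ultimately show "(bigon ! m) u \<in> square" by (auto simp: Complex_in_square)
qed (use w in auto)

text \<open>Equal ordinates force opposite parameters, as \<open>bump\<close> is even and injective
  on each side. The abscissa is odd, so at a double point it vanishes, and for a nonzero parameter
  this means \<open>bump u = 1/2\<close>.\<close>

lemma crossings_curl: "crossings curl (\<lambda>_. -w) (\<lambda>_. w) {((0, -w), (0, w))}"
proof (rule crossingsI)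
  fix m n and u v :: real
  assume mn: "m \<le> n" "n < length curl" and u: "u \<in> {-1..1}" and v: "v \<in> {-1..1}"
  then have "m = 0" "n = 0" by auto
  moreover have "Complex (u * (1 - 2 * bump u)) (bump u / 2) = Complex (v * (1 - 2 * bump v)) (bump v / 2) \<and> u \<noteq> v \<longleftrightarrow>
      (u = -w \<and> v = w) \<or> (u = w \<and> v = -w)" (is "?L \<longleftrightarrow> ?R")
  proof
    assume L: ?L
    then have "bump u / 2 = bump v / 2" and re: "u * (1 - 2 * bump u) = v * (1 - 2 * bump v)" and "u \<noteq> v"
      unfolding complex.inject by blast+
    then have eq: "bump u = bump v" by simp
    have vu: "v = - u"
      using bump_eq_iff[OF u v] eq \<open>u \<noteq> v\<close> unfolding abs_eq_iff by linarith
    then have "u \<noteq> 0" using \<open>u \<noteq> v\<close> by auto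
    have "u * (1 - 2 * bump u) = 0" using re unfolding vu bump_minus by simp
    then have "bump u = 1/2" using \<open>u \<noteq> 0\<close> by simp
    then show ?R using half[rule_format, OF u] vu by auto
  next
    assume ?R
    then show ?L using half_w w by auto
  qed
  ultimately show "(curl ! m) u = (curl ! n) v \<and> (m, u) \<noteq> (n, v) \<longleftrightarrow>
      ((m, u), (n, v)) \<in> {((0, -w), (0, w))} \<or> ((n, v), (m, u)) \<in> {((0, -w), (0, w))}"
    by auto
next
  fix m and u :: real assume "m < length curl" and u: "u \<in> {-1..1}"
  have "\<bar>u\<bar> * \<bar>1 - 2 * bump u\<bar> \<le> 1 * 1"
    using bump_nonneg[of u] bump_le_1[OF u] u by (intro mult_mono) auto
  moreover have "\<bar>bump u / 2\<bar> \<le> 1" using bump_nonneg[of u] bump_le_1[OF u] by auto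
  moreover have "m = 0" using \<open>m < length curl\<close> by simp
  ultimately show "(curl ! m) u \<in> square" by (simp add: Complex_in_square abs_mult)
qed (use w in auto)

lemma bigon_derivatives:
  obtains b d where "(bigon ! 0 has_vector_derivative Complex 1 (- b)) (at (- w))"
    "(bigon ! 1 has_vector_derivative Complex 1 b) (at (- w))" "b > 0"
    "(bigon ! 0 has_vector_derivative Complex 1 (- d)) (at w)"
    "(bigon ! 1 has_vector_derivative Complex 1 d) (at w)" "d < 0"
proof -
  obtain b where b: "(bump has_real_derivative b) (at (- w))" "b > 0" using bump_slope[of "- w"] w by auto
  obtain d where d: "(bump has_real_derivative d) (at w)" "d < 0" using bump_slope[of w] w by auto
  have "((\<lambda>u. 1/2 - bump u) has_real_derivative - b) (at (- w))" "((\<lambda>u. bump u - 1/2) has_real_derivative b) (at (- w))"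
    "((\<lambda>u. 1/2 - bump u) has_real_derivative - d) (at w)" "((\<lambda>u. bump u - 1/2) has_real_derivative d) (at w)"
    using DERIV_diff[OF DERIV_const b(1)] DERIV_diff[OF b(1) DERIV_const]
      DERIV_diff[OF DERIV_const d(1)] DERIV_diff[OF d(1) DERIV_const] by simp_all
  note * = this[THEN has_vector_derivative_Complex[OF DERIV_ident]]
  show thesis
    by (rule that[of b d]) (use * b(2) d(2) in simp_all)
qed

lemma curl_derivatives:
  obtains b where "(curl ! 0 has_vector_derivative Complex (2 * w * b) (b / 2)) (at (- w))"
    "(curl ! 0 has_vector_derivative Complex (2 * w * b) (- b / 2)) (at w)" "b > 0"
proof -
  have bd: "\<exists>b. (bump has_real_derivative b) (at (- w)) \<and> (bump has_real_derivative - b) (at w) \<and> b > 0"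
  proof -
    define b where "b = bump w * (2 * w / (1 - w\<^sup>2)\<^sup>2)"
    have "w\<^sup>2 < 1" using w by (simp add: abs_square_less_1)
    then have "b > 0" using w half_w by (simp add: b_def)
    moreover have "(bump has_real_derivative b) (at (- w))" "(bump has_real_derivative - b) (at w)"
      using bump_derivative[of "- w"] bump_derivative[of w] w by (simp_all add: b_def)
    ultimately show ?thesis by blast
  qed
  then obtain b where b: "(bump has_real_derivative b) (at (- w))" "(bump has_real_derivative - b) (at w)" "b > 0"
    by blast
  \<comment> \<open>At both parameters the factor \<open>1 - 2 * bump u\<close> vanishes, so only
    the derivative of \<open>bump\<close> contributes; its sign and that of \<open>u\<close> change
    together.\<close>
  have x: "((\<lambda>u. u * (1 - 2 * bump u)) has_real_derivative 2 * w * b) (at (- w))"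
    "((\<lambda>u. u * (1 - 2 * bump u)) has_real_derivative 2 * w * b) (at w)"
    using half_w by (auto intro!: derivative_eq_intros b(1,2) simp: algebra_simps)
  have y: "((\<lambda>u. bump u / 2) has_real_derivative b / 2) (at (- w))"
    "((\<lambda>u. bump u / 2) has_real_derivative - b / 2) (at w)"
    using DERIV_cdivide[OF b(1), of 2] DERIV_cdivide[OF b(2), of 2] by simp_all
  show thesis
    by (rule that[of b])
      (use has_vector_derivative_Complex[OF x(1) y(1)] has_vector_derivative_Complex[OF x(2) y(2)] b(3) in simp_all)
qed

end

section \<open>Crossings in the triangle\<close>

context
  fixes w :: real
  assumes w: "0 < w" "w < 1" and up: "\<forall>u\<in>{-1..1}. bump u / 2 = u \<longleftrightarrow> u = w"
    and down: "\<forall>u\<in>{-1..1}. - bump u / 2 = u \<longleftrightarrow> u = - w"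
begin

lemma diagonals_meet: "Complex u u = Complex v (- v) \<longleftrightarrow> u = 0 \<and> v = 0"
  by auto

lemma up_meet:
  assumes v: "v \<in> {-1..1}"
  shows "Complex u u = Complex v (bump v / 2) \<longleftrightarrow> u = w \<and> v = w"
    "Complex u (- u) = Complex v (bump v / 2) \<longleftrightarrow> u = - w \<and> v = - w"
proof -
  have "(u = v \<and> u = bump v / 2) \<longleftrightarrow> (u = v \<and> bump v / 2 = v)" by metis
  then show "Complex u u = Complex v (bump v / 2) \<longleftrightarrow> u = w \<and> v = w"
    unfolding complex.inject up[rule_format, OF v] by metis
  have "(u = v \<and> - u = bump v / 2) \<longleftrightarrow> (u = v \<and> - bump v / 2 = v)" by (intro iffI conjI) linarith+
  then show "Complex u (- u) = Complex v (bump v / 2) \<longleftrightarrow> u = - w \<and> v = - w"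
    unfolding complex.inject down[rule_format, OF v] by metis
qed

lemma down_meet:
  assumes v: "v \<in> {-1..1}"
  shows "Complex u u = Complex v (- bump v / 2) \<longleftrightarrow> u = - w \<and> v = - w"
    "Complex u (- u) = Complex v (- bump v / 2) \<longleftrightarrow> u = w \<and> v = w"
proof -
  have "(u = v \<and> u = - bump v / 2) \<longleftrightarrow> (u = v \<and> - bump v / 2 = v)" by metis
  then show "Complex u u = Complex v (- bump v / 2) \<longleftrightarrow> u = - w \<and> v = - w"
    unfolding complex.inject down[rule_format, OF v] by metis
  have "(u = v \<and> - u = - bump v / 2) \<longleftrightarrow> (u = v \<and> bump v / 2 = v)" by (intro iffI conjI) linarith+
  then show "Complex u (- u) = Complex v (- bump v / 2) \<longleftrightarrow> u = w \<and> v = w"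
    unfolding complex.inject up[rule_format, OF v] by metis
qed

lemma triangle_pairs:
  assumes "m \<le> n" "n < 3"
  shows "(m = 0 \<and> n = 0) \<or> (m = 1 \<and> n = 1) \<or> (m = 2 \<and> n = 2) \<or> (m = 0 \<and> n = 1) \<or> (m = 0 \<and> n = 2) \<or> (m = 1 \<and> n = (2::nat))"
  using assms by linarith

text \<open>The breaks of each strand are the parameters of its two crossings in increasing order;
  this is where the order of crossings along the strands enters.\<close>

lemma crossings_above:
  "crossings above (\<lambda>m. [0, -w, -w] ! m) (\<lambda>m. [w, 0, w] ! m) {((0, 0), (1, 0)), ((0, w), (2, w)), ((1, -w), (2, -w))}"
proof (rule crossingsI)
  fix m n and u v :: real
  assume mn: "m \<le> n" "n < length above" and u: "u \<in> {-1..1}" and v: "v \<in> {-1..1}"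
  from mn have "m \<le> n" "n < 3" by simp_all
  from triangle_pairs[OF this] show "(above ! m) u = (above ! n) v \<and> (m, u) \<noteq> (n, v) \<longleftrightarrow>
      ((m, u), (n, v)) \<in> {((0, 0), (1, 0)), ((0, w), (2, w)), ((1, -w), (2, -w))} \<or>
      ((n, v), (m, u)) \<in> {((0, 0), (1, 0)), ((0, w), (2, w)), ((1, -w), (2, -w))}"
    using diagonals_meet[of u v] up_meet[OF v, of u] by (elim disjE conjE) (simp_all del: complex.inject, auto)
next
  fix m and u :: real assume "m < length above" and u: "u \<in> {-1..1}"
  then have "m = 0 \<or> m = 1 \<or> m = 2" by (auto dest: less_3E)
  moreover have "\<bar>bump u / 2\<bar> \<le> 1" "\<bar>u\<bar> \<le> 1" using bump_nonneg[of u] bump_le_1[OF u] u by auto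
  ultimately show "(above ! m) u \<in> square" by (auto simp: Complex_in_square)
next
  fix m assume "m < length above"
  then have "m = 0 \<or> m = 1 \<or> m = 2" by (auto dest: less_3E)
  then show "-1 < [0, -w, -w] ! m \<and> [0, -w, -w] ! m < [w, 0, w] ! m \<and> [w, 0, w] ! m < 1"
    using w by auto
qed auto

lemma crossings_below:
  "crossings below (\<lambda>m. [-w, 0, -w] ! m) (\<lambda>m. [0, w, w] ! m) {((0, 0), (1, 0)), ((0, -w), (2, -w)), ((1, w), (2, w))}"
proof (rule crossingsI)
  fix m n and u v :: real
  assume mn: "m \<le> n" "n < length below" and u: "u \<in> {-1..1}" and v: "v \<in> {-1..1}"
  from mn have "m \<le> n" "n < 3" by simp_all
  from triangle_pairs[OF this] show "(below ! m) u = (below ! n) v \<and> (m, u) \<noteq> (n, v) \<longleftrightarrow>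
      ((m, u), (n, v)) \<in> {((0, 0), (1, 0)), ((0, -w), (2, -w)), ((1, w), (2, w))} \<or>
      ((n, v), (m, u)) \<in> {((0, 0), (1, 0)), ((0, -w), (2, -w)), ((1, w), (2, w))}"
    using diagonals_meet[of u v] down_meet[OF v, of u] by (elim disjE conjE) (simp_all del: complex.inject, auto)
next
  fix m and u :: real assume "m < length below" and u: "u \<in> {-1..1}"
  then have "m = 0 \<or> m = 1 \<or> m = 2" by (auto dest: less_3E)
  moreover have "\<bar>- bump u / 2\<bar> \<le> 1" "\<bar>u\<bar> \<le> 1" using bump_nonneg[of u] bump_le_1[OF u] u by auto
  ultimately show "(below ! m) u \<in> square" by (auto simp: Complex_in_square)
next
  fix m assume "m < length below"
  then have "m = 0 \<or> m = 1 \<or> m = 2" by (auto dest: less_3E)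
  then show "-1 < [-w, 0, -w] ! m \<and> [-w, 0, -w] ! m < [0, w, w] ! m \<and> [0, w, w] ! m < 1"
    using w by auto
qed auto

end

lemma line_derivative:
  "((\<lambda>u. Complex u u) has_vector_derivative Complex 1 1) (at u)"
  "((\<lambda>u. Complex u (- u)) has_vector_derivative Complex 1 (- 1)) (at u)"
  using has_vector_derivative_Complex[OF DERIV_ident DERIV_ident]
    has_vector_derivative_Complex[OF DERIV_ident DERIV_minus[OF DERIV_ident]] by simp_all

lemma bump_half_derivative:
  assumes "(bump has_real_derivative b) (at u)"
  shows "((\<lambda>u. Complex u (bump u / 2)) has_vector_derivative Complex 1 (b / 2)) (at u)"
    "((\<lambda>u. Complex u (- bump u / 2)) has_vector_derivative Complex 1 (- b / 2)) (at u)"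
  using has_vector_derivative_Complex[OF DERIV_ident DERIV_cdivide[OF assms, of 2]]
    has_vector_derivative_Complex[OF DERIV_ident DERIV_cdivide[OF DERIV_minus[OF assms], of 2]] by simp_all

lemma crossing_meets:
  assumes "square_part D ps cs b1 b2" "crossings cs b1 b2 S" "((m, u), (n, v)) \<in> S"
  shows "u \<in> {-1..1}" "v \<in> {-1..1}" "meets D (along (ps ! m) u) (along (ps ! n) v)"
    "kind D (along (ps ! n) v) = opposite (kind D (along (ps ! m) u))"
proof -
  interpret square_part D ps cs b1 b2 by (rule assms(1))
  have len: "length ps = length cs" using in_sq by (simp add: in_square_def)
  have r: "m < length ps" "n < length ps" "u = b1 m \<or> u = b2 m" "v = b1 n \<or> v = b2 n"
    using crossingsD(3)[OF assms(2,3)] len by simp_all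
  then show u: "u \<in> {-1..1}" and v: "v \<in> {-1..1}" using breaks[of m] breaks[of n] by auto
  have "(cs ! m) u = (cs ! n) v \<and> (m, u) \<noteq> (n, v)"
    using crossingsD(4)[OF assms(2), of m n u v] assms(3) r(1,2) u v len by simp
  then show "meets D (along (ps ! m) u) (along (ps ! n) v)"
    using meets_iff[OF r(1,2) u v] by blast
  then show "kind D (along (ps ! n) v) = opposite (kind D (along (ps ! m) u))"
    using diag unfolding diagram_def by blast
qed

section \<open>Invariance\<close>

context oriented_singquandle
begin

text \<open>The kinds are those of the first strand at the left and at the right crossing. The
  second strand crosses it from right to left at the former and returns at the latter.\<close>

definition bigon_rel :: "passage_kind \<Rightarrow> passage_kind \<Rightarrow> bool \<Rightarrow> bool \<Rightarrow> (nat \<Rightarrow> nat \<Rightarrow> 'a) \<Rightarrow> bool" where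
  "bigon_rel k k' ep eq c \<longleftrightarrow> crossing_rel k ep eq True (c 0 0) (c 0 1) (c 1 0) (c 1 1) \<and>
     crossing_rel k' ep eq False (c 0 1) (c 0 2) (c 1 1) (c 1 2)"

lemma crossing_rel_classical: "k \<noteq> Singular \<Longrightarrow> crossing_rel k = classical k"
  and crossing_rel_singular: "crossing_rel Singular = singular"
  by (simp_all add: crossing_rel_def)

lemma pair_in: "x \<in> X \<Longrightarrow> y \<in> X \<Longrightarrow> \<forall>m<2. [x, y] ! m \<in> X"
  by (simp add: numeral_2_eq_2 All_less_Suc)

text \<open>The new middle colors are solved from the ends next to the classical crossing. The
  singular crossing on the other side then holds by \<open>twist_slide\<close> or its rotated
  form.\<close>

lemma bigon_slide:
  assumes X: "\<forall>m<2. \<forall>k<3. c m k \<in> X" and k: "k \<noteq> Singular"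
  shows "bigon_rel Singular k ep eq c \<Longrightarrow>
      \<exists>xs. (\<forall>m<2. xs ! m \<in> X) \<and> bigon_rel (opposite k) Singular ep eq (replace_middle c xs)"
    and "bigon_rel (opposite k) Singular ep eq c \<Longrightarrow>
      \<exists>xs. (\<forall>m<2. xs ! m \<in> X) \<and> bigon_rel Singular k ep eq (replace_middle c xs)"
proof -
  have X0: "c 0 0 \<in> X" "c 0 1 \<in> X" "c 0 2 \<in> X" "c 1 0 \<in> X" "c 1 1 \<in> X" "c 1 2 \<in> X"
    using X by simp_all
  have op: "(k = Over) = (opposite k \<noteq> Over)" "opposite k \<noteq> Singular" using k by (cases k; simp)+
  note rel = crossing_rel_singular crossing_rel_classical[OF k] crossing_rel_classical[OF op(2)]
  {
    assume "bigon_rel Singular k ep eq c"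
    then have a: "singular ep eq True (c 0 0) (c 0 1) (c 1 0) (c 1 1)" "classical k ep eq False (c 0 1) (c 0 2) (c 1 1) (c 1 2)"
      by (simp_all only: bigon_rel_def rel)
    obtain x y where x: "x \<in> X" "y \<in> X" "classical (opposite k) ep eq True (c 0 0) x (c 1 0) y"
      using classical_ex(1)[OF X0(1,4)] by blast
    have "bigon_rel (opposite k) Singular ep eq (replace_middle c [x, y])"
      using twist_slide[OF X0 x(1,2) op(1) a x(3)] x(3) by (simp add: bigon_rel_def rel)
    then show "\<exists>xs. (\<forall>m<2. xs ! m \<in> X) \<and> bigon_rel (opposite k) Singular ep eq (replace_middle c xs)"
      using pair_in[OF x(1,2)] by blast
  }
  {
    assume "bigon_rel (opposite k) Singular ep eq c"
    then have a: "classical (opposite k) ep eq True (c 0 0) (c 0 1) (c 1 0) (c 1 1)" "singular ep eq False (c 0 1) (c 0 2) (c 1 1) (c 1 2)"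
      by (simp_all only: bigon_rel_def rel)
    obtain x y where x: "x \<in> X" "y \<in> X" "classical k ep eq False x (c 0 2) y (c 1 2)"
      using classical_ex(2)[OF X0(3,6)] by blast
    have "bigon_rel Singular k ep eq (replace_middle c [x, y])"
      using twist_slide'[OF X0(1) x(1) X0(3,4) x(2) X0(6,2,5) op(1) a x(3)] x(3) by (simp add: bigon_rel_def rel)
    then show "\<exists>xs. (\<forall>m<2. xs ! m \<in> X) \<and> bigon_rel Singular k ep eq (replace_middle c xs)"
      using pair_in[OF x(1,2)] by blast
  }
qed

text \<open>The same strand is on top at both crossings while the side of crossing changes, so the
  second crossing is the first one read backwards.\<close>

lemma bigon_cancel:
  assumes X: "\<forall>m<2. \<forall>k<3. c m k \<in> X" and k: "k \<noteq> Singular"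
  shows "bigon_rel k k ep eq c \<Longrightarrow> c 0 2 = c 0 0 \<and> c 1 2 = c 1 0"
    and "c 0 2 = c 0 0 \<Longrightarrow> c 1 2 = c 1 0 \<Longrightarrow>
      \<exists>xs. (\<forall>m<2. xs ! m \<in> X) \<and> bigon_rel k k ep eq (replace_middle c xs)"
proof -
  have X0: "c 0 0 \<in> X" "c 0 1 \<in> X" "c 0 2 \<in> X" "c 1 0 \<in> X" "c 1 1 \<in> X" "c 1 2 \<in> X"
    using X by simp_all
  have undo: "classical k ep eq False x (c 0 0) y (c 1 0)"
    if "x \<in> X" "y \<in> X" "classical k ep eq True (c 0 0) x (c 1 0) y" for x y
    using classical_flip[OF X0(1) that(1) X0(4) that(2), of k ep eq True] that(3) by simp
  {
    assume "bigon_rel k k ep eq c"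
    then have a: "classical k ep eq True (c 0 0) (c 0 1) (c 1 0) (c 1 1)" "classical k ep eq False (c 0 1) (c 0 2) (c 1 1) (c 1 2)"
      by (simp_all only: bigon_rel_def crossing_rel_classical[OF k])
    show "c 0 2 = c 0 0 \<and> c 1 2 = c 1 0"
      by (rule classical_determined(1)[OF X0(2,1,5,4,3,6) undo[OF X0(2,5) a(1)] a(2)])
  }
  {
    assume e: "c 0 2 = c 0 0" "c 1 2 = c 1 0"
    obtain x y where x: "x \<in> X" "y \<in> X" "classical k ep eq True (c 0 0) x (c 1 0) y"
      using classical_ex(1)[OF X0(1,4)] by blast
    have "bigon_rel k k ep eq (replace_middle c [x, y])"
      using x(3) undo[OF x] e by (simp add: bigon_rel_def crossing_rel_classical[OF k])
    then show "\<exists>xs. (\<forall>m<2. xs ! m \<in> X) \<and> bigon_rel k k ep eq (replace_middle c xs)"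
      using pair_in[OF x(1,2)] by blast
  }
qed

text \<open>One classical crossing is enough: it determines both middle colors from the ends
  adjacent to it.\<close>

lemma bigon_determined:
  assumes X: "\<forall>m<2. \<forall>k<3. c m k \<in> X" "\<forall>m<2. \<forall>k<3. d m k \<in> X" and k: "k \<noteq> Singular \<or> k' \<noteq> Singular"
    and rel: "bigon_rel k k' ep eq c" "bigon_rel k k' ep eq d"
    and cd: "\<forall>m<2. c m 0 = d m 0 \<and> c m 2 = d m 2"
  shows "\<forall>m<2. c m 1 = d m 1"
proof -
  have XX: "c m k \<in> X" "d m k \<in> X" if "m < 2" "k < 3" for m k using X that by blast+
  have e: "c m 0 = d m 0" "c m 2 = d m 2" if "m < 2" for m using cd that by blast+
  have "d 0 1 = c 0 1 \<and> d 1 1 = c 1 1"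
  proof (cases "k = Singular")
    case False
    then have "classical k ep eq True (c 0 0) (c 0 1) (c 1 0) (c 1 1)" "classical k ep eq True (c 0 0) (d 0 1) (c 1 0) (d 1 1)"
      using rel e by (simp_all add: bigon_rel_def crossing_rel_classical)
    from classical_determined(1)[OF _ _ _ _ _ _ this] show ?thesis by (simp add: XX)
  next
    case True
    then have "k' \<noteq> Singular" using k by blast
    then have "classical k' ep eq False (c 0 1) (c 0 2) (c 1 1) (c 1 2)" "classical k' ep eq False (d 0 1) (c 0 2) (d 1 1) (c 1 2)"
      using rel e by (simp_all add: bigon_rel_def crossing_rel_classical)
    from classical_determined(2)[OF _ _ _ _ _ _ this] show ?thesis by (simp add: XX)
  qed
  then show ?thesis by (simp add: numeral_2_eq_2 All_less_Suc)
qed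

lemma bigon_local_coloring:
  assumes w: "0 < w" "w < 1" and half: "\<forall>u\<in>{-1..1}. bump u = 1/2 \<longleftrightarrow> u = w \<or> u = - w"
    and sq: "square_part D [p, q] bigon (\<lambda>_. -w) (\<lambda>_. w)"
  shows "local_coloring X star R1 R2 D [p, q] (\<lambda>_. -w) (\<lambda>_. w) c \<longleftrightarrow> (\<forall>m<length [p, q]. \<forall>k<3. c m k \<in> X) \<and>
    bigon_rel (kind D (along p (-w))) (kind D (along p w)) (snd (snd p) > 0) (snd (snd q) > 0) c"
proof -
  let ?ok = "crossing_ok D [p, q] (\<lambda>_. -w) (\<lambda>_. w) c"
  let ?S = "{((0, -w), (1, -w)), ((0, w), (1, w))}"
  note cr = crossings_bigon[OF w half]
  obtain b d where b: "(bigon ! 0 has_vector_derivative Complex 1 (- b)) (at (- w))"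
    "(bigon ! 1 has_vector_derivative Complex 1 b) (at (- w))" "b > 0"
    and d: "(bigon ! 0 has_vector_derivative Complex 1 (- d)) (at w)"
    "(bigon ! 1 has_vector_derivative Complex 1 d) (at w)" "d < 0"
    by (rule bigon_derivatives[OF w half])
  have inv: "(m, -w) \<in> fst ` ?S \<union> snd ` ?S \<and> (m, w) \<in> fst ` ?S \<union> snd ` ?S" if "m < length [p, q]" for m
    using that by (auto dest: less_2E)
  have L: "local_coloring X star R1 R2 D [p, q] (\<lambda>_. -w) (\<lambda>_. w) c \<longleftrightarrow> (\<forall>m<length [p, q]. \<forall>k<3. c m k \<in> X) \<and>
    (\<forall>(p', q')\<in>?S. ?ok p' q' \<and> ?ok q' p')"
    by (rule local_coloring_iff[OF sq cr inv])
  have seg: "seg_before (-w) w (-w) = 0" "seg_after (-w) w (-w) = 1" "seg_before (-w) w w = 1" "seg_after (-w) w w = 2"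
    using w by (simp_all add: seg_before_def seg_after_def)
  have det: "cdet (Complex 1 (- b)) (Complex 1 b) \<noteq> 0" "(cdet (Complex 1 (- b)) (Complex 1 b) > 0) = True"
    "cdet (Complex 1 (- d)) (Complex 1 d) \<noteq> 0" "(cdet (Complex 1 (- d)) (Complex 1 d) > 0) = False"
    using b(3) d(3) by (simp_all add: cdet_def)
  have mem: "((0, -w), (1, -w)) \<in> ?S" "((0, w), (1, w)) \<in> ?S" by simp_all
  have nth: "[p, q] ! 0 = p" "[p, q] ! 1 = q" by simp_all
  have S: "(\<forall>(p', q')\<in>?S. ?ok p' q' \<and> ?ok q' p') \<longleftrightarrow>
      (?ok (0, -w) (1, -w) \<and> ?ok (1, -w) (0, -w)) \<and> (?ok (0, w) (1, w) \<and> ?ok (1, w) (0, w))"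
    by simp
  have rel: "(\<forall>(p', q')\<in>?S. ?ok p' q' \<and> ?ok q' p') \<longleftrightarrow>
      bigon_rel (kind D (along p (-w))) (kind D (along p w)) (snd (snd p) > 0) (snd (snd q) > 0) c"
    if X: "\<forall>m<length [p, q]. \<forall>k<3. c m k \<in> X"
    unfolding S crossing_ok_iff[OF sq cr mem(1) X b(1,2) det(1)] crossing_ok_iff[OF sq cr mem(2) X d(1,2) det(3)]
      seg det(2,4) nth bigon_rel_def ..
  show ?thesis unfolding L using rel by (rule conj_cong[OF refl])
qed

text \<open>Both passages of the double point lie on the same piece, so the middle segment leaves
  the first passage and enters the second, and the two orientation flags are equal. This is the
  situation of \<open>classical_kink\<close>.\<close>

lemma curl_local_coloring:
  assumes w: "0 < w" "w < 1" and half: "\<forall>u\<in>{-1..1}. bump u = 1/2 \<longleftrightarrow> u = w \<or> u = - w"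
    and sq: "square_part D [p] curl (\<lambda>_. -w) (\<lambda>_. w)" and k: "kind D (along p (-w)) \<noteq> Singular"
  shows "local_coloring X star R1 R2 D [p] (\<lambda>_. -w) (\<lambda>_. w) c \<longleftrightarrow> (\<forall>m<length [p]. c m 0 \<in> X \<and> c m 1 = c m 0 \<and> c m 2 = c m 0)"
proof -
  let ?S = "{((0, -w), (0, w))}"
  let ?ok = "crossing_ok D [p] (\<lambda>_. -w) (\<lambda>_. w) c"
  note cr = crossings_curl[OF w half]
  obtain b where b: "(curl ! 0 has_vector_derivative Complex (2 * w * b) (b / 2)) (at (- w))"
    "(curl ! 0 has_vector_derivative Complex (2 * w * b) (- b / 2)) (at w)" "b > 0"
    by (rule curl_derivatives[OF w half])
  have inv: "(m, -w) \<in> fst ` ?S \<union> snd ` ?S \<and> (m, w) \<in> fst ` ?S \<union> snd ` ?S" if "m < length [p]" for m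
    using that by auto
  have L: "local_coloring X star R1 R2 D [p] (\<lambda>_. -w) (\<lambda>_. w) c \<longleftrightarrow> (\<forall>m<length [p]. \<forall>k<3. c m k \<in> X) \<and>
    (\<forall>(p', q')\<in>?S. ?ok p' q' \<and> ?ok q' p')"
    by (rule local_coloring_iff[OF sq cr inv])
  have seg: "seg_before (-w) w (-w) = 0" "seg_after (-w) w (-w) = 1" "seg_before (-w) w w = 1" "seg_after (-w) w w = 2"
    using w by (simp_all add: seg_before_def seg_after_def)
  have "cdet (Complex (2 * w * b) (b / 2)) (Complex (2 * w * b) (- b / 2)) = - (2 * w * b * b)"
    by (simp add: cdet_def algebra_simps)
  then have det: "cdet (Complex (2 * w * b) (b / 2)) (Complex (2 * w * b) (- b / 2)) \<noteq> 0" using w b(3) by simp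
  have rel: "(\<forall>(p', q')\<in>?S. ?ok p' q' \<and> ?ok q' p') \<longleftrightarrow>
    c 0 1 = c 0 0 \<and> c 0 2 = c 0 0" if X: "\<forall>m<length [p]. \<forall>k<3. c m k \<in> X"
  proof -
    have X0: "c 0 0 \<in> X" "c 0 1 \<in> X" "c 0 2 \<in> X" using X by simp_all
    have mem: "((0, -w), (0, w)) \<in> ?S" by simp
    have "(\<forall>(p', q')\<in>?S. ?ok p' q' \<and> ?ok q' p') \<longleftrightarrow>
      ?ok (0, -w) (0, w) \<and> ?ok (0, w) (0, -w)"
      by simp
    moreover have rel: "crossing_rel (kind D (along ([p] ! 0) (-w))) = classical (kind D (along ([p] ! 0) (-w)))"
      using k by (simp add: crossing_rel_def)
    ultimately show ?thesis
      by (simp only: crossing_ok_iff[OF sq cr mem X b(1,2) det] seg rel classical_kink[OF X0])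
  qed
  have three: "(\<forall>k<3. c 0 k \<in> X) \<longleftrightarrow> c 0 0 \<in> X \<and> c 0 1 \<in> X \<and> c 0 2 \<in> X"
    by (auto simp: numeral_3_eq_3 less_Suc_eq numeral_2_eq_2)
  have one: "(\<forall>m<length [p]. P m) \<longleftrightarrow> P 0" for P by simp
  show ?thesis unfolding L
  proof
    assume a: "(\<forall>m<length [p]. \<forall>k<3. c m k \<in> X) \<and>
      (\<forall>(p', q')\<in>?S. ?ok p' q' \<and> ?ok q' p')"
    then have "c 0 1 = c 0 0 \<and> c 0 2 = c 0 0" using rel by blast
    then show "\<forall>m<length [p]. c m 0 \<in> X \<and> c m 1 = c m 0 \<and> c m 2 = c m 0"
      using a unfolding one three by blast
  next
    assume a: "\<forall>m<length [p]. c m 0 \<in> X \<and> c m 1 = c m 0 \<and> c m 2 = c m 0"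
    then have X: "\<forall>m<length [p]. \<forall>k<3. c m k \<in> X" unfolding one three by metis
    show "(\<forall>m<length [p]. \<forall>k<3. c m k \<in> X) \<and>
      (\<forall>(p', q')\<in>?S. ?ok p' q' \<and> ?ok q' p')"
      using X a unfolding rel[OF X] one by blast
  qed
qed

section \<open>Moves 3 and 4\<close>

context
  fixes w :: real
  assumes w: "0 < w" "w < 1" and up: "\<forall>u\<in>{-1..1}. bump u / 2 = u \<longleftrightarrow> u = w"
    and down: "\<forall>u\<in>{-1..1}. - bump u / 2 = u \<longleftrightarrow> u = - w"
begin

lemma above_local_coloring:
  assumes sq: "square_part D [p, q, r] above (\<lambda>m. [0, -w, -w] ! m) (\<lambda>m. [w, 0, w] ! m)"
  shows "local_coloring X star R1 R2 D [p, q, r] (\<lambda>m. [0, -w, -w] ! m) (\<lambda>m. [w, 0, w] ! m) c \<longleftrightarrow>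
    (\<forall>m<length [p, q, r]. \<forall>k<3. c m k \<in> X) \<and>
    triangle_above (kind D (along p 0)) (kind D (along p w)) (kind D (along q (-w)))
      (snd (snd p) > 0) (snd (snd q) > 0) (snd (snd r) > 0) c"
proof -
  let ?S = "{((0, 0), (1, 0)), ((0, w), (2, w)), ((1, -w), (2, -w))} :: ((nat \<times> real) \<times> (nat \<times> real)) set"
  let ?b = "\<lambda>m. [0, -w, -w] ! m" and ?b' = "\<lambda>m. [w, 0, w] ! m"
  let ?ok = "crossing_ok D [p, q, r] ?b ?b' c"
  note cr = crossings_above[OF w up down]
  obtain b where b: "(bump has_real_derivative b) (at (- w))" "b > 0" using bump_slope[of "- w"] w by auto
  obtain d where d: "(bump has_real_derivative d) (at w)" "d < 0" using bump_slope[of w] w by auto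
  have inv: "(m, ?b m) \<in> fst ` ?S \<union> snd ` ?S \<and> (m, ?b' m) \<in> fst ` ?S \<union> snd ` ?S" if "m < length [p, q, r]" for m
    using that by (auto dest!: less_3E)
  have L: "local_coloring X star R1 R2 D [p, q, r] ?b ?b' c \<longleftrightarrow> (\<forall>m<length [p, q, r]. \<forall>k<3. c m k \<in> X) \<and>
    (\<forall>(p', q')\<in>?S. ?ok p' q' \<and> ?ok q' p')"
    by (rule local_coloring_iff[OF sq cr inv])
  have seg: "seg_before 0 w 0 = 0" "seg_after 0 w 0 = 1" "seg_before (-w) 0 0 = 1" "seg_after (-w) 0 0 = 2"
    "seg_before 0 w w = 1" "seg_after 0 w w = 2" "seg_before (-w) w w = 1" "seg_after (-w) w w = 2"
    "seg_before (-w) 0 (-w) = 0" "seg_after (-w) 0 (-w) = 1" "seg_before (-w) w (-w) = 0" "seg_after (-w) w (-w) = 1"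
    using w by (simp_all add: seg_before_def seg_after_def)
  have det: "cdet (Complex 1 1) (Complex 1 (-1)) \<noteq> 0" "(cdet (Complex 1 1) (Complex 1 (-1)) > 0) = False"
    "cdet (Complex 1 1) (Complex 1 (d / 2)) \<noteq> 0" "(cdet (Complex 1 1) (Complex 1 (d / 2)) > 0) = False"
    "cdet (Complex 1 (-1)) (Complex 1 (b / 2)) \<noteq> 0" "(cdet (Complex 1 (-1)) (Complex 1 (b / 2)) > 0) = True"
    using b(2) d(2) by (simp_all add: cdet_def)
  have mem: "((0, 0), (1, 0)) \<in> ?S" "((0, w), (2, w)) \<in> ?S" "((1, -w), (2, -w)) \<in> ?S" by simp_all
  have nth: "[p, q, r] ! 0 = p" "[p, q, r] ! 1 = q" "[p, q, r] ! 2 = r" by simp_all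
  have bn: "[0, -w, -w] ! 0 = 0" "[0, -w, -w] ! 1 = -w" "[0, -w, -w] ! 2 = -w"
    "[w, 0, w] ! 0 = w" "[w, 0, w] ! 1 = 0" "[w, 0, w] ! 2 = w" by simp_all
  have dv: "(above ! 0 has_vector_derivative Complex 1 1) (at u)" "(above ! 1 has_vector_derivative Complex 1 (-1)) (at u)"
    "(above ! 2 has_vector_derivative Complex 1 (b / 2)) (at (- w))" "(above ! 2 has_vector_derivative Complex 1 (d / 2)) (at w)" for u
    using line_derivative bump_half_derivative(1)[OF b(1)] bump_half_derivative(1)[OF d(1)] by simp_all
  have S: "(\<forall>(p', q')\<in>?S. ?ok p' q' \<and> ?ok q' p') \<longleftrightarrow> (?ok (0, 0) (1, 0) \<and> ?ok (1, 0) (0, 0)) \<and>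
    (?ok (0, w) (2, w) \<and> ?ok (2, w) (0, w)) \<and> (?ok (1, -w) (2, -w) \<and> ?ok (2, -w) (1, -w))"
    by simp
  have rel: "(\<forall>(p', q')\<in>?S. ?ok p' q' \<and> ?ok q' p') \<longleftrightarrow> triangle_above (kind D (along p 0)) (kind D (along p w))
      (kind D (along q (-w))) (snd (snd p) > 0) (snd (snd q) > 0) (snd (snd r) > 0) c"
    if X: "\<forall>m<length [p, q, r]. \<forall>k<3. c m k \<in> X"
    unfolding S crossing_ok_iff[OF sq cr mem(1) X dv(1,2) det(1)] crossing_ok_iff[OF sq cr mem(2) X dv(1,4) det(3)]
      crossing_ok_iff[OF sq cr mem(3) X dv(2,3) det(5)] det(2,4,6) nth bn seg triangle_above_def ..
  show ?thesis unfolding L using rel by (rule conj_cong[OF refl])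
qed

lemma below_local_coloring:
  assumes sq: "square_part D [p, q, r] below (\<lambda>m. [-w, 0, -w] ! m) (\<lambda>m. [0, w, w] ! m)"
  shows "local_coloring X star R1 R2 D [p, q, r] (\<lambda>m. [-w, 0, -w] ! m) (\<lambda>m. [0, w, w] ! m) c \<longleftrightarrow>
    (\<forall>m<length [p, q, r]. \<forall>k<3. c m k \<in> X) \<and>
    triangle_below (kind D (along p 0)) (kind D (along p (-w))) (kind D (along q w))
      (snd (snd p) > 0) (snd (snd q) > 0) (snd (snd r) > 0) c"
proof -
  let ?S = "{((0, 0), (1, 0)), ((0, -w), (2, -w)), ((1, w), (2, w))} :: ((nat \<times> real) \<times> (nat \<times> real)) set"
  let ?b = "\<lambda>m. [-w, 0, -w] ! m" and ?b' = "\<lambda>m. [0, w, w] ! m"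
  let ?ok = "crossing_ok D [p, q, r] ?b ?b' c"
  note cr = crossings_below[OF w up down]
  obtain b where b: "(bump has_real_derivative b) (at (- w))" "b > 0" using bump_slope[of "- w"] w by auto
  obtain d where d: "(bump has_real_derivative d) (at w)" "d < 0" using bump_slope[of w] w by auto
  have inv: "(m, ?b m) \<in> fst ` ?S \<union> snd ` ?S \<and> (m, ?b' m) \<in> fst ` ?S \<union> snd ` ?S" if "m < length [p, q, r]" for m
    using that by (auto dest!: less_3E)
  have L: "local_coloring X star R1 R2 D [p, q, r] ?b ?b' c \<longleftrightarrow> (\<forall>m<length [p, q, r]. \<forall>k<3. c m k \<in> X) \<and>
    (\<forall>(p', q')\<in>?S. ?ok p' q' \<and> ?ok q' p')"
    by (rule local_coloring_iff[OF sq cr inv])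
  have seg: "seg_before (-w) 0 0 = 1" "seg_after (-w) 0 0 = 2" "seg_before 0 w 0 = 0" "seg_after 0 w 0 = 1"
    "seg_before (-w) 0 (-w) = 0" "seg_after (-w) 0 (-w) = 1" "seg_before (-w) w (-w) = 0" "seg_after (-w) w (-w) = 1"
    "seg_before 0 w w = 1" "seg_after 0 w w = 2" "seg_before (-w) w w = 1" "seg_after (-w) w w = 2"
    using w by (simp_all add: seg_before_def seg_after_def)
  have det: "cdet (Complex 1 1) (Complex 1 (-1)) \<noteq> 0" "(cdet (Complex 1 1) (Complex 1 (-1)) > 0) = False"
    "cdet (Complex 1 1) (Complex 1 (- b / 2)) \<noteq> 0" "(cdet (Complex 1 1) (Complex 1 (- b / 2)) > 0) = False"
    "cdet (Complex 1 (-1)) (Complex 1 (- d / 2)) \<noteq> 0" "(cdet (Complex 1 (-1)) (Complex 1 (- d / 2)) > 0) = True"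
    using b(2) d(2) by (simp_all add: cdet_def)
  have mem: "((0, 0), (1, 0)) \<in> ?S" "((0, -w), (2, -w)) \<in> ?S" "((1, w), (2, w)) \<in> ?S" by simp_all
  have nth: "[p, q, r] ! 0 = p" "[p, q, r] ! 1 = q" "[p, q, r] ! 2 = r" by simp_all
  have bn: "[-w, 0, -w] ! 0 = -w" "[-w, 0, -w] ! 1 = 0" "[-w, 0, -w] ! 2 = -w"
    "[0, w, w] ! 0 = 0" "[0, w, w] ! 1 = w" "[0, w, w] ! 2 = w" by simp_all
  have dv: "(below ! 0 has_vector_derivative Complex 1 1) (at u)" "(below ! 1 has_vector_derivative Complex 1 (-1)) (at u)"
    "(below ! 2 has_vector_derivative Complex 1 (- b / 2)) (at (- w))" "(below ! 2 has_vector_derivative Complex 1 (- d / 2)) (at w)" for u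
    using line_derivative bump_half_derivative(2)[OF b(1)] bump_half_derivative(2)[OF d(1)] by simp_all
  have S: "(\<forall>(p', q')\<in>?S. ?ok p' q' \<and> ?ok q' p') \<longleftrightarrow> (?ok (0, 0) (1, 0) \<and> ?ok (1, 0) (0, 0)) \<and>
    (?ok (0, -w) (2, -w) \<and> ?ok (2, -w) (0, -w)) \<and> (?ok (1, w) (2, w) \<and> ?ok (2, w) (1, w))"
    by simp
  have rel: "(\<forall>(p', q')\<in>?S. ?ok p' q' \<and> ?ok q' p') \<longleftrightarrow> triangle_below (kind D (along p 0)) (kind D (along p (-w)))
      (kind D (along q w)) (snd (snd p) > 0) (snd (snd q) > 0) (snd (snd r) > 0) c"
    if X: "\<forall>m<length [p, q, r]. \<forall>k<3. c m k \<in> X"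
    unfolding S crossing_ok_iff[OF sq cr mem(1) X dv(1,2) det(1)] crossing_ok_iff[OF sq cr mem(2) X dv(1,3) det(3)]
      crossing_ok_iff[OF sq cr mem(3) X dv(2,4) det(5)] det(2,4,6) nth bn seg triangle_below_def ..
  show ?thesis unfolding L using rel by (rule conj_cong[OF refl])
qed

text \<open>Both moves on three strands leave the kinds at the three crossings unchanged; they
  differ only in which kinds occur, and this is hidden in \<open>compatible_kinds\<close>.\<close>

lemma triangle_change_bij:
  assumes tri: "triangle_change p q r D D'"
    and kinds: "kind D (along p 0) = kind D' (along p 0)" "kind D (along p w) = kind D' (along p (-w))"
      "kind D (along q (-w)) = kind D' (along q w)"
    and comp: "compatible_kinds (kind D (along p 0)) (kind D (along p w)) (kind D (along q (-w)))"
  shows "\<exists>f. bij_betw f (colorings X star R1 R2 D) (colorings X star R1 R2 D')"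
proof -
  let ?b = "\<lambda>m. [0, -w, -w] ! m" and ?b' = "\<lambda>m. [w, 0, w] ! m"
  let ?d = "\<lambda>m. [-w, 0, -w] ! m" and ?d' = "\<lambda>m. [0, w, w] ! m"
  interpret sc: square_change D D' "[p, q, r]" above below ?b ?b' ?d ?d'
    by (rule local_change_square_change[OF tri[unfolded triangle_change_def] crossings_above[OF w up down] crossings_below[OF w up down]])
  note LD = above_local_coloring[OF sc.old.square_part_axioms]
  note LD' = below_local_coloring[OF sc.new.square_part_axioms, folded kinds]
  let ?ab = "triangle_above (kind D (along p 0)) (kind D (along p w)) (kind D (along q (-w)))
      (snd (snd p) > 0) (snd (snd q) > 0) (snd (snd r) > 0)"
  let ?be = "triangle_below (kind D (along p 0)) (kind D (along p w)) (kind D (along q (-w)))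
      (snd (snd p) > 0) (snd (snd q) > 0) (snd (snd r) > 0)"
  have len: "length [p, q, r] = 3" by simp
  show ?thesis
  proof (rule sc.square_change_bij; unfold LD LD' len)
    fix c :: "nat \<Rightarrow> nat \<Rightarrow> 'a"
    assume a: "(\<forall>m<3. \<forall>k<3. c m k \<in> X) \<and> ?ab c"
    from triangle_slide(1)[OF conjunct1[OF a] comp conjunct2[OF a]] obtain xs where xs: "\<forall>m<3. xs ! m \<in> X"
      "?be (replace_middle c xs)" by blast
    show "\<exists>c' :: nat \<Rightarrow> nat \<Rightarrow> 'a. ((\<forall>m<3. \<forall>k<3. c' m k \<in> X) \<and> ?be c') \<and> (\<forall>m<3. c' m 0 = c m 0 \<and> c' m 2 = c m 2)"
      by (rule exI[of _ "replace_middle c xs"]) (use xs replace_middle_in[OF conjunct1[OF a] xs(1)] in simp)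
  next
    fix c :: "nat \<Rightarrow> nat \<Rightarrow> 'a"
    assume a: "(\<forall>m<3. \<forall>k<3. c m k \<in> X) \<and> ?be c"
    from triangle_slide(2)[OF conjunct1[OF a] comp conjunct2[OF a]] obtain xs where xs: "\<forall>m<3. xs ! m \<in> X"
      "?ab (replace_middle c xs)" by blast
    show "\<exists>c' :: nat \<Rightarrow> nat \<Rightarrow> 'a. ((\<forall>m<3. \<forall>k<3. c' m k \<in> X) \<and> ?ab c') \<and> (\<forall>m<3. c' m 0 = c m 0 \<and> c' m 2 = c m 2)"
      by (rule exI[of _ "replace_middle c xs"]) (use xs replace_middle_in[OF conjunct1[OF a] xs(1)] in simp)
  qed (use triangle_determined[OF _ _ comp] in blast)+
qed

lemma move3_bij:
  assumes "move3 D D'"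
  shows "\<exists>f. bij_betw f (colorings X star R1 R2 D) (colorings X star R1 R2 D')"
proof -
  obtain p q r and height :: "nat \<Rightarrow> nat" where inj: "inj_on height {..<3}" and tri: "triangle_change p q r D D'"
    and h: "\<And>E m n u v. E \<in> {D, D'} \<Longrightarrow> m < 3 \<Longrightarrow> n < 3 \<Longrightarrow> u \<in> {-1..1} \<Longrightarrow> v \<in> {-1..1} \<Longrightarrow>
        meets E (along ([p, q, r] ! m) u) (along ([p, q, r] ! n) v) \<Longrightarrow> height m > height n \<Longrightarrow>
        kind E (along ([p, q, r] ! m) u) = Over"
    using assms unfolding move3_def by metis
  let ?b = "\<lambda>m. [0, -w, -w] ! m" and ?b' = "\<lambda>m. [w, 0, w] ! m"
  let ?d = "\<lambda>m. [-w, 0, -w] ! m" and ?d' = "\<lambda>m. [0, w, w] ! m"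
  interpret sc: square_change D D' "[p, q, r]" above below ?b ?b' ?d ?d'
    by (rule local_change_square_change[OF tri[unfolded triangle_change_def] crossings_above[OF w up down] crossings_below[OF w up down]])
  have neq: "height 0 \<noteq> height 1" "height 0 \<noteq> height 2" "height 1 \<noteq> height 2"
    using inj by (auto dest: inj_onD)
  \<comment> \<open>\<open>move3\<close> names the upper strand only. If that is strand
    \<open>n\<close>, the kind of strand \<open>m\<close> is the opposite one.\<close>
  have kind: "kind E (along ([p, q, r] ! m) u) = (if height m > height n then Over else Under)"
    if E: "E \<in> {D, D'}" and mn: "m < 3" "n < 3" "height m \<noteq> height n" and uv: "u \<in> {-1..1}" "v \<in> {-1..1}"
      and me: "meets E (along ([p, q, r] ! m) u) (along ([p, q, r] ! n) v)" for E m n u v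
  proof (cases "height m > height n")
    case True
    then show ?thesis using h[OF E mn(1,2) uv me] by simp
  next
    case False
    then have "kind E (along ([p, q, r] ! n) v) = Over"
      using h[OF E mn(2,1) uv(2,1) meets_sym[OF me]] mn(3) by simp
    moreover have "diagram E" using E sc.old.diag sc.new.diag by blast
    then have "kind E (along ([p, q, r] ! m) u) = opposite (kind E (along ([p, q, r] ! n) v))"
      using meets_sym[OF me] unfolding diagram_def by blast
    ultimately show ?thesis using False by simp
  qed
  note mD = crossing_meets[OF sc.old.square_part_axioms crossings_above[OF w up down]]
  note mD' = crossing_meets[OF sc.new.square_part_axioms crossings_below[OF w up down]]
  have kD: "kind D (along p 0) = (if height 0 > height 1 then Over else Under)"
    "kind D (along p w) = (if height 0 > height 2 then Over else Under)"
    "kind D (along q (-w)) = (if height 1 > height 2 then Over else Under)"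
    using kind[of D 0 1 0 0] kind[of D 0 2 w w] kind[of D 1 2 "-w" "-w"] mD(1-3)[of 0 0 1 0] mD(1-3)[of 0 w 2 w] mD(1-3)[of 1 "-w" 2 "-w"] neq
    by simp_all
  have kD': "kind D' (along p 0) = (if height 0 > height 1 then Over else Under)"
    "kind D' (along p (-w)) = (if height 0 > height 2 then Over else Under)"
    "kind D' (along q w) = (if height 1 > height 2 then Over else Under)"
    using kind[of D' 0 1 0 0] kind[of D' 0 2 "-w" "-w"] kind[of D' 1 2 w w] mD'(1-3)[of 0 0 1 0] mD'(1-3)[of 0 "-w" 2 "-w"] mD'(1-3)[of 1 w 2 w] neq
    by simp_all
  have "compatible_kinds (kind D (along p 0)) (kind D (along p w)) (kind D (along q (-w)))"
    unfolding kD compatible_kinds_def using neq by auto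
  then show ?thesis using triangle_change_bij[OF tri] kD kD' by simp
qed

lemma move4_bij:
  assumes "move4 D D'"
  shows "\<exists>f. bij_betw f (colorings X star R1 R2 D) (colorings X star R1 R2 D')"
proof -
  obtain p q r k where k: "k \<in> {Over, Under}" and tri: "triangle_change p q r D D'"
    and s: "\<And>E. E \<in> {D, D'} \<Longrightarrow> kind E (along p 0) = Singular"
    and h: "\<And>E t u v. E \<in> {D, D'} \<Longrightarrow> t \<in> {p, q} \<Longrightarrow> u \<in> {-1..1} \<Longrightarrow> v \<in> {-1..1} \<Longrightarrow>
        meets E (along r u) (along t v) \<Longrightarrow> kind E (along r u) = k"
    using assms unfolding move4_def by metis
  let ?b = "\<lambda>m. [0, -w, -w] ! m" and ?b' = "\<lambda>m. [w, 0, w] ! m"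
  let ?d = "\<lambda>m. [-w, 0, -w] ! m" and ?d' = "\<lambda>m. [0, w, w] ! m"
  interpret sc: square_change D D' "[p, q, r]" above below ?b ?b' ?d ?d'
    by (rule local_change_square_change[OF tri[unfolded triangle_change_def] crossings_above[OF w up down] crossings_below[OF w up down]])
  \<comment> \<open>\<open>move4\<close> prescribes the kind of the third strand, whereas the
    triangle relations use the kinds of the diagonals.\<close>
  have kind: "kind E (along t v) = opposite k"
    if E: "E \<in> {D, D'}" and t: "t \<in> {p, q}" and uv: "u \<in> {-1..1}" "v \<in> {-1..1}"
      and me: "meets E (along t v) (along r u)" for E t u v
  proof -
    have "diagram E" using E sc.old.diag sc.new.diag by blast
    then have "kind E (along t v) = opposite (kind E (along r u))"
      using meets_sym[OF me] unfolding diagram_def by blast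
    then show ?thesis using h[OF E t uv meets_sym[OF me]] by simp
  qed
  note mD = crossing_meets[OF sc.old.square_part_axioms crossings_above[OF w up down]]
  note mD' = crossing_meets[OF sc.new.square_part_axioms crossings_below[OF w up down]]
  have kD: "kind D (along p 0) = Singular" "kind D (along p w) = opposite k" "kind D (along q (-w)) = opposite k"
    using s[of D] kind[of D p w w] kind[of D q "-w" "-w"] mD(1-3)[of 0 w 2 w] mD(1-3)[of 1 "-w" 2 "-w"]
    by simp_all
  have kD': "kind D' (along p 0) = Singular" "kind D' (along p (-w)) = opposite k" "kind D' (along q w) = opposite k"
    using s[of D'] kind[of D' p "-w" "-w"] kind[of D' q w w] mD'(1-3)[of 0 "-w" 2 "-w"] mD'(1-3)[of 1 w 2 w]
    by simp_all
  have "compatible_kinds (kind D (along p 0)) (kind D (along p w)) (kind D (along q (-w)))"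
    unfolding kD compatible_kinds_def using k by auto
  then show ?thesis using triangle_change_bij[OF tri] kD kD' by simp
qed

end

section \<open>Moves 1, 2 and 5\<close>

lemma move1_bij:
  assumes "move1 D D'"
  shows "\<exists>f. bij_betw f (colorings X star R1 R2 D) (colorings X star R1 R2 D')"
proof -
  obtain p where lc: "local_change [p] [\<lambda>u. Complex u 0] curl D D'"
    and k: "\<And>u v. u \<in> {-1..1} \<Longrightarrow> v \<in> {-1..1} \<Longrightarrow> meets D' (along p u) (along p v) \<Longrightarrow> kind D' (along p u) \<noteq> Singular"
    using assms unfolding move1_def by blast
  obtain w where w: "0 < w" "w < 1" and half: "\<forall>u\<in>{-1..1}. bump u = 1/2 \<longleftrightarrow> u = w \<or> u = - w"
    by (rule bump_half) blast
  interpret sc: square_change D D' "[p]" "[\<lambda>u. Complex u 0]" curl "\<lambda>_. -1/2" "\<lambda>_. 1/2" "\<lambda>_. -w" "\<lambda>_. w"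
    by (rule local_change_square_change[OF lc crossings_line crossings_curl[OF w half]])
  have "kind D' (along p (-w)) \<noteq> Singular"
    using crossing_meets(1-3)[OF sc.new.square_part_axioms crossings_curl[OF w half], of 0 "-w" 0 w] k[of "-w" w] by simp
  note LD' = curl_local_coloring[OF w half sc.new.square_part_axioms this]
  have LD: "local_coloring X star R1 R2 D [p] (\<lambda>_. -1/2) (\<lambda>_. 1/2) c \<longleftrightarrow> (\<forall>m<length [p]. c m 0 \<in> X \<and> c m 1 = c m 0 \<and> c m 2 = c m 0)" for c
    by (rule local_coloring_iff_flat[OF sc.old.square_part_axioms]) auto
  show ?thesis
  proof (rule sc.square_change_bij; unfold LD LD')
    \<comment> \<open>Both local conditions say that the piece has a single color, so
      \<open>c\<close> itself serves in both directions.\<close>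
    fix c :: "nat \<Rightarrow> nat \<Rightarrow> 'a"
    assume "\<forall>m<length [p]. c m 0 \<in> X \<and> c m 1 = c m 0 \<and> c m 2 = c m 0"
    then show "\<exists>c' :: nat \<Rightarrow> nat \<Rightarrow> 'a. (\<forall>m<length [p]. c' m 0 \<in> X \<and> c' m 1 = c' m 0 \<and> c' m 2 = c' m 0) \<and>
        (\<forall>m<length [p]. c' m 0 = c m 0 \<and> c' m 2 = c m 2)"
      by (intro exI[of _ c]) simp
    then show "\<exists>c' :: nat \<Rightarrow> nat \<Rightarrow> 'a. (\<forall>m<length [p]. c' m 0 \<in> X \<and> c' m 1 = c' m 0 \<and> c' m 2 = c' m 0) \<and>
        (\<forall>m<length [p]. c' m 0 = c m 0 \<and> c' m 2 = c m 2)" .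
  qed simp_all
qed

lemma move2_bij:
  assumes "move2 D D'"
  shows "\<exists>f. bij_betw f (colorings X star R1 R2 D) (colorings X star R1 R2 D')"
proof -
  obtain p q k where k: "k \<in> {Over, Under}"
    and lc: "local_change [p, q] [\<lambda>u. Complex u (1/2), \<lambda>u. Complex u (-1/2)] bigon D D'"
    and kk: "\<And>u v. u \<in> {-1..1} \<Longrightarrow> v \<in> {-1..1} \<Longrightarrow> meets D' (along p u) (along q v) \<Longrightarrow> kind D' (along p u) = k"
    using assms unfolding move2_def by blast
  obtain w where w: "0 < w" "w < 1" and half: "\<forall>u\<in>{-1..1}. bump u = 1/2 \<longleftrightarrow> u = w \<or> u = - w"
    by (rule bump_half) blast
  let ?flat = "[\<lambda>u. Complex u (1/2), \<lambda>u. Complex u (-1/2)]"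
  interpret sc: square_change D D' "[p, q]" ?flat bigon "\<lambda>_. -1/2" "\<lambda>_. 1/2" "\<lambda>_. -w" "\<lambda>_. w"
    by (rule local_change_square_change[OF lc crossings_two_lines crossings_bigon[OF w half]])
  note mD' = crossing_meets(1-3)[OF sc.new.square_part_axioms crossings_bigon[OF w half]]
  have kD': "kind D' (along p (-w)) = k" "kind D' (along p w) = k"
    using kk[of "-w" "-w"] kk[of w w] mD'[of 0 "-w" 1 "-w"] mD'[of 0 w 1 w] by simp_all
  have ks: "k \<noteq> Singular" using k by auto
  let ?e = "snd (snd p) > 0" and ?f = "snd (snd q) > 0"
  note LD' = bigon_local_coloring[OF w half sc.new.square_part_axioms, unfolded kD']
  have LD: "local_coloring X star R1 R2 D [p, q] (\<lambda>_. -1/2) (\<lambda>_. 1/2) c \<longleftrightarrow> (\<forall>m<length [p, q]. c m 0 \<in> X \<and> c m 1 = c m 0 \<and> c m 2 = c m 0)" for c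
  proof (rule local_coloring_iff_flat[OF sc.old.square_part_axioms])
    fix m n and u v :: real
    assume "m < length [p, q]" "n < length [p, q]" "u \<in> {-1..1}" "v \<in> {-1..1}" "(?flat ! m) u = (?flat ! n) v"
    then show "(m, u) = (n, v)"
      using crossingsD(4)[OF crossings_two_lines, of m n u v] by auto
  qed
  have len: "length [p, q] = 2" by simp
  have two: "(\<forall>m<2. P m) \<longleftrightarrow> P 0 \<and> P 1" for P :: "nat \<Rightarrow> bool"
    by (auto simp: numeral_2_eq_2 All_less_Suc)
  have flat: "\<forall>m<2. \<forall>k<3. c m k \<in> X" if "\<forall>m<2. c m 0 \<in> X \<and> c m 1 = c m 0 \<and> c m 2 = c m 0" for c :: "nat \<Rightarrow> nat \<Rightarrow> 'a"
    using that by (auto simp: numeral_3_eq_3 numeral_2_eq_2 less_Suc_eq)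
  show ?thesis
  proof (rule sc.square_change_bij; unfold LD LD' len)
    fix c :: "nat \<Rightarrow> nat \<Rightarrow> 'a"
    assume a: "\<forall>m<2. c m 0 \<in> X \<and> c m 1 = c m 0 \<and> c m 2 = c m 0"
    then obtain xs where xs: "\<forall>m<2. xs ! m \<in> X" "bigon_rel k k ?e ?f (replace_middle c xs)"
      using bigon_cancel(2)[OF flat[OF a] ks] by fastforce
    show "\<exists>c'. ((\<forall>m<2. \<forall>k<3. c' m k \<in> X) \<and> bigon_rel k k ?e ?f c') \<and> (\<forall>m<2. c' m 0 = c m 0 \<and> c' m 2 = c m 2)"
      by (rule exI[of _ "replace_middle c xs"]) (use xs replace_middle_in[OF flat[OF a] xs(1)] in simp)
  next
    fix c :: "nat \<Rightarrow> nat \<Rightarrow> 'a"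
    assume a: "(\<forall>m<2. \<forall>k<3. c m k \<in> X) \<and> bigon_rel k k ?e ?f c"
    \<comment> \<open>Equal outer colors allow the straightened strand to be given its initial color
      throughout.\<close>
    then have "c 0 2 = c 0 0 \<and> c 1 2 = c 1 0" using bigon_cancel(1)[OF conjunct1[OF a] ks] by blast
    then show "\<exists>c'. (\<forall>m<2. c' m 0 \<in> X \<and> c' m 1 = c' m 0 \<and> c' m 2 = c' m 0) \<and>
        (\<forall>m<2. c' m 0 = c m 0 \<and> c' m (2 :: nat) = c m 2)"
      using a unfolding two by (intro exI[of _ "\<lambda>m k. c m 0"]) simp
  next
    show "\<forall>c e. ((\<forall>m<2. \<forall>k<3. c m k \<in> X) \<and> bigon_rel k k ?e ?f c) \<and> ((\<forall>m<2. \<forall>k<3. e m k \<in> X) \<and> bigon_rel k k ?e ?f e) \<and>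
        (\<forall>m<2. c m 0 = e m 0 \<and> c m 2 = e m 2) \<longrightarrow> (\<forall>m<2. c m 1 = (e m 1 :: 'a))"
    proof (rule allI, rule allI, rule impI)
      fix c e :: "nat \<Rightarrow> nat \<Rightarrow> 'a"
      assume "((\<forall>m<2. \<forall>k<3. c m k \<in> X) \<and> bigon_rel k k ?e ?f c) \<and> ((\<forall>m<2. \<forall>k<3. e m k \<in> X) \<and> bigon_rel k k ?e ?f e) \<and>
        (\<forall>m<2. c m 0 = e m 0 \<and> c m 2 = e m 2)"
      then show "\<forall>m<2. c m 1 = e m 1"
        by (elim conjE) (rule bigon_determined[of c e, OF _ _ disjI1[OF ks]])
    qed
  qed simp
qed

lemma move5_bij:
  assumes "move5 D D'"
  shows "\<exists>f. bij_betw f (colorings X star R1 R2 D) (colorings X star R1 R2 D')"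
proof -
  obtain p q k where k: "k \<in> {Over, Under}" and lc: "local_change [p, q] bigon bigon D D'"
    and kk: "\<And>u v. u \<in> {-1..1} \<Longrightarrow> v \<in> {-1..1} \<Longrightarrow> meets D (along p u) (along q v) \<Longrightarrow>
        kind D (along p u) = (if u < 0 then Singular else k)"
    and kk': "\<And>u v. u \<in> {-1..1} \<Longrightarrow> v \<in> {-1..1} \<Longrightarrow> meets D' (along p u) (along q v) \<Longrightarrow>
        kind D' (along q v) = (if v < 0 then k else Singular)"
    using assms unfolding move5_def by blast
  obtain w where w: "0 < w" "w < 1" and half: "\<forall>u\<in>{-1..1}. bump u = 1/2 \<longleftrightarrow> u = w \<or> u = - w"
    by (rule bump_half) blast
  note cr = crossings_bigon[OF w half]
  interpret sc: square_change D D' "[p, q]" bigon bigon "\<lambda>_. -w" "\<lambda>_. w" "\<lambda>_. -w" "\<lambda>_. w"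
    by (rule local_change_square_change[OF lc cr cr])
  note mD = crossing_meets(1-3)[OF sc.old.square_part_axioms cr]
  note mD' = crossing_meets[OF sc.new.square_part_axioms cr]
  have kD: "kind D (along p (-w)) = Singular" "kind D (along p w) = k"
    using kk[of "-w" "-w"] kk[of w w] mD[of 0 "-w" 1 "-w"] mD[of 0 w 1 w] w by simp_all
  \<comment> \<open>After the move the kinds are prescribed on the second strand, but
    \<open>bigon_rel\<close> refers to the first one; at each crossing it has the opposite
    kind.\<close>
  have "kind D' (along q (-w)) = k" "kind D' (along q w) = Singular"
    using kk'[of "-w" "-w"] kk'[of w w] mD'(1-3)[of 0 "-w" 1 "-w"] mD'(1-3)[of 0 w 1 w] w by simp_all
  moreover have "kind D' (along q (-w)) = opposite (kind D' (along p (-w)))" "kind D' (along q w) = opposite (kind D' (along p w))"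
    using mD'(4)[of 0 "-w" 1 "-w"] mD'(4)[of 0 w 1 w] by simp_all
  ultimately have kD': "kind D' (along p (-w)) = opposite k" "kind D' (along p w) = Singular"
    by (cases "kind D' (along p (-w))"; cases "kind D' (along p w)"; auto)+
  have ks: "k \<noteq> Singular" "opposite k \<noteq> Singular" using k by auto
  let ?e = "snd (snd p) > 0" and ?f = "snd (snd q) > 0"
  note LD = bigon_local_coloring[OF w half sc.old.square_part_axioms, unfolded kD]
  note LD' = bigon_local_coloring[OF w half sc.new.square_part_axioms, unfolded kD']
  have len: "length [p, q] = 2" by simp
  show ?thesis
  proof (rule sc.square_change_bij; unfold LD LD' len)
    fix c :: "nat \<Rightarrow> nat \<Rightarrow> 'a"
    assume a: "(\<forall>m<2. \<forall>k<3. c m k \<in> X) \<and> bigon_rel Singular k ?e ?f c"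
    from bigon_slide(1)[OF conjunct1[OF a] ks(1) conjunct2[OF a]] obtain xs where xs: "\<forall>m<2. xs ! m \<in> X"
      "bigon_rel (opposite k) Singular ?e ?f (replace_middle c xs)" by blast
    show "\<exists>c'. ((\<forall>m<2. \<forall>k<3. c' m k \<in> X) \<and> bigon_rel (opposite k) Singular ?e ?f c') \<and>
        (\<forall>m<2. c' m 0 = c m 0 \<and> c' m 2 = c m 2)"
      by (rule exI[of _ "replace_middle c xs"]) (use xs replace_middle_in[OF conjunct1[OF a] xs(1)] in simp)
  next
    fix c :: "nat \<Rightarrow> nat \<Rightarrow> 'a"
    assume a: "(\<forall>m<2. \<forall>k<3. c m k \<in> X) \<and> bigon_rel (opposite k) Singular ?e ?f c"
    from bigon_slide(2)[OF conjunct1[OF a] ks(1) conjunct2[OF a]] obtain xs where xs: "\<forall>m<2. xs ! m \<in> X"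
      "bigon_rel Singular k ?e ?f (replace_middle c xs)" by blast
    show "\<exists>c'. ((\<forall>m<2. \<forall>k<3. c' m k \<in> X) \<and> bigon_rel Singular k ?e ?f c') \<and>
        (\<forall>m<2. c' m 0 = c m 0 \<and> c' m 2 = c m 2)"
      by (rule exI[of _ "replace_middle c xs"]) (use xs replace_middle_in[OF conjunct1[OF a] xs(1)] in simp)
  next
    show "\<forall>c e. ((\<forall>m<2. \<forall>k<3. c m k \<in> X) \<and> bigon_rel Singular k ?e ?f c) \<and> ((\<forall>m<2. \<forall>k<3. e m k \<in> X) \<and> bigon_rel Singular k ?e ?f e) \<and>
        (\<forall>m<2. c m 0 = e m 0 \<and> c m 2 = e m 2) \<longrightarrow> (\<forall>m<2. c m 1 = (e m 1 :: 'a))"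
    proof (rule allI, rule allI, rule impI)
      fix c e :: "nat \<Rightarrow> nat \<Rightarrow> 'a"
      assume "((\<forall>m<2. \<forall>k<3. c m k \<in> X) \<and> bigon_rel Singular k ?e ?f c) \<and> ((\<forall>m<2. \<forall>k<3. e m k \<in> X) \<and> bigon_rel Singular k ?e ?f e) \<and>
        (\<forall>m<2. c m 0 = e m 0 \<and> c m 2 = e m 2)"
      then show "\<forall>m<2. c m 1 = e m 1"
        by (elim conjE) (rule bigon_determined[of c e, OF _ _ disjI2[OF ks(1)]])
    qed
  next
    show "\<forall>c e. ((\<forall>m<2. \<forall>k<3. c m k \<in> X) \<and> bigon_rel (opposite k) Singular ?e ?f c) \<and> ((\<forall>m<2. \<forall>k<3. e m k \<in> X) \<and> bigon_rel (opposite k) Singular ?e ?f e) \<and>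
        (\<forall>m<2. c m 0 = e m 0 \<and> c m 2 = e m 2) \<longrightarrow> (\<forall>m<2. c m 1 = (e m 1 :: 'a))"
    proof (rule allI, rule allI, rule impI)
      fix c e :: "nat \<Rightarrow> nat \<Rightarrow> 'a"
      assume "((\<forall>m<2. \<forall>k<3. c m k \<in> X) \<and> bigon_rel (opposite k) Singular ?e ?f c) \<and> ((\<forall>m<2. \<forall>k<3. e m k \<in> X) \<and> bigon_rel (opposite k) Singular ?e ?f e) \<and>
        (\<forall>m<2. c m 0 = e m 0 \<and> c m 2 = e m 2)"
      then show "\<forall>m<2. c m 1 = e m 1"
        by (elim conjE) (rule bigon_determined[of c e, OF _ _ disjI1[OF ks(2)]])
    qed
  qed
qed

text \<open>Each elementary step is directed, and a step taken backwards is served by the inverse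
  bijection. Existence of a bijection is then transitive along the chain.\<close>

lemma equivalent_links_bij:
  assumes "equivalent_links D D'"
  shows "\<exists>f. bij_betw f (colorings X star R1 R2 D) (colorings X star R1 R2 D')"
  using assms unfolding equivalent_links_def
proof (induction rule: equivclp_induct)
  case base
  then show ?case using bij_betw_id by blast
next
  case (step E F)
  obtain w where w: "0 < w" "w < 1" "\<forall>u\<in>{-1..1}. bump u / 2 = u \<longleftrightarrow> u = w"
    "\<forall>u\<in>{-1..1}. - bump u / 2 = u \<longleftrightarrow> u = - w"
    by (rule bump_fixed) blast
  have *: "\<exists>f. bij_betw f (colorings X star R1 R2 A) (colorings X star R1 R2 B)"
    if "planar_isotopic A B \<or> move1 A B \<or> move2 A B \<or> move3 A B \<or> move4 A B \<or> move5 A B" for A B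
    using that planar_isotopic_relabels[of A B] relabels_bij[of A B] move1_bij[of A B] move2_bij[of A B]
      move3_bij[OF w, of A B] move4_bij[OF w, of A B] move5_bij[of A B] by blast
  have "\<exists>f. bij_betw f (colorings X star R1 R2 E) (colorings X star R1 R2 F)"
    using step.hyps(2) *[of E F] *[of F E] bij_betw_inv_into by blast
  then show ?case using step.IH bij_betw_trans by blast
qed

end

theorem lemma3p5:
  fixes X :: "'a set" and star R1 R2 :: "'a \<Rightarrow> 'a \<Rightarrow> 'a" and D D' :: sdiagram
  assumes "oriented_singquandle X star R1 R2"
    and "diagram D" and "diagram D'"
    and "equivalent_links D D'"
  shows "\<exists>f. bij_betw f (colorings X star R1 R2 D) (colorings X star R1 R2 D')"
proof -
  interpret oriented_singquandle X star R1 R2 by (rule assms(1))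
  show ?thesis by (rule equivalent_links_bij[OF assms(4)])
qed

end
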